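(* Let $X=(X,d,\mu)$ be a metric space with a doubling measure $\mu$. Let $0<p<\infty$, $0<q\le\infty$ and $0<s<1$. Then $$\dot N^s_{p,q}(X)=\big(L^p(X),\dot M^{1,p}(X)\big)_{s,q}\qquad\text{and}\qquad N^s_{p,q}(X)=\big(L^p(X),M^{1,p}(X)\big)_{s,q}$$ with equivalent norms.
   Context: $\mu$ is a Borel regular outer measure on $(X,d)$ for which every ball $B(x,r)=\{y\in X:d(y,x)<r\}$ has positive and finite measure, and doubling: $\mu(B(x,2r))\le c_D\,\mu(B(x,r))$ for a fixed constant $c_D>0$ and every ball. "Norm" is also used for quasi-norms and quasi-seminorms. Haj\l asz--Besov spaces: a sequence $(g_k)_{k\in\mathbb Z}$ of nonnegative measurable functions is a fractional $s$-gradient of a measurable $u\colon X\to[-\infty,\infty]$, written $(g_k)\in\mathbb D^s(u)$, if there is $E\subset X$ with $\mu(E)=0$ such that $|u(x)-u(y)|\le d(x,y)^s(g_k(x)+g_k(y))$ for all $k\in\mathbb Z$ and all $x,y\in X\setminus E$ with $2^{-k-1}\le d(x,y)<2^{-k}$. The space $\dot N^s_{p,q}(X)$ consists of measurable $u$ with $\|u\|_{\dot N^s_{p,q}(X)}=\inf_{(g_k)\in\mathbb D^s(u)}\big\|(\|g_k\|_{L^p(X)})_{k\in\mathbb Z}\big\|_{l^q}<\infty$, and $N^s_{p,q}(X)=\dot N^s_{p,q}(X)\cap L^p(X)$ with norm $\|u\|_{L^p(X)}+\|u\|_{\dot N^s_{p,q}(X)}$. Haj\l asz spaces: a nonnegative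 measurable $g$ is a $1$-gradient of a measurable $u$ if there is $E\subset X$ with $\mu(E)=0$ such that $|u(x)-u(y)|\le d(x,y)(g(x)+g(y))$ for all $x,y\in X\setminus E$. The space $\dot M^{1,p}(X)$ consists of measurable $u$ with $\|u\|_{\dot M^{1,p}(X)}=\inf\|g\|_{L^p(X)}<\infty$, the infimum over all $1$-gradients $g$ of $u$; $M^{1,p}(X)=\dot M^{1,p}(X)\cap L^p(X)$ with norm $\|u\|_{L^p(X)}+\|u\|_{\dot M^{1,p}(X)}$. Real interpolation: for (quasi-semi)normed spaces $A_0,A_1$ continuously embedded in a topological vector space, and $f\in A_0+A_1$, $t>0$, let $K(f,t;A_0,A_1)=\inf\{\|f_0\|_{A_0}+t\|f_1\|_{A_1}: f=f_0+f_1\}$. The space $(A_0,A_1)_{s,q}$ consists of $f\in A_0+A_1$ for which $\|f\|_{(A_0,A_1)_{s,q}}=\big(\int_0^\infty(t^{-s}K(f,t;A_0,A_1))^q\frac{dt}{t}\big)^{1/q}$ (if $q<\infty$), respectively $\sup_{t>0}t^{-s}K(f,t;A_0,A_1)$ (if $q=\infty$), is finite. *)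

theory Defs
  imports "HOL-Analysis.Analysis"
begin

text \<open>A metric space \<open>X\<close> is the universe of a type of class \<open>metric_space\<close>.\<close>

definition borel_regular_outer_measure :: "('a::topological_space set \<Rightarrow> ennreal) \<Rightarrow> bool" where
  "borel_regular_outer_measure \<mu> \<longleftrightarrow>
     outer_measure_space (Pow UNIV) \<mu> \<and>
     sets borel \<subseteq> lambda_system UNIV (Pow UNIV) \<mu> \<and>
     (\<forall>A. \<exists>B\<in>sets borel. A \<subseteq> B \<and> \<mu> B = \<mu> A)"

definition doubling_measure :: "('a::metric_space set \<Rightarrow> ennreal) \<Rightarrow> bool" where
  "doubling_measure \<mu> \<longleftrightarrow>
     borel_regular_outer_measure \<mu> \<and>
     (\<forall>x. \<forall>r>0. 0 < \<mu> (ball x r) \<and> \<mu> (ball x r) < \<infinity>) \<and>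
     (\<exists>cD>0::real. \<forall>x. \<forall>r>0. \<mu> (ball x (2 * r)) \<le> ennreal cD * \<mu> (ball x r))"

text \<open>The measure space of Caratheodory-measurable sets; it is complete.\<close>

definition induced_measure :: "('a set \<Rightarrow> ennreal) \<Rightarrow> 'a measure" where
  "induced_measure \<mu> = measure_of UNIV (lambda_system UNIV (Pow UNIV) \<mu>) \<mu>"

text \<open>Powers with positive exponent on \<open>[0,\<infinity>]\<close>.\<close>

definition epowr :: "ennreal \<Rightarrow> real \<Rightarrow> ennreal" where
  "epowr x a = (if x = \<infinity> then \<infinity> else ennreal (enn2real x powr a))"

text \<open>
  A function space is a pair of a carrier and an \<open>[0,\<infinity>]\<close>-valued functional on it. Its elements are
  extended real functions rather than classes of functions modulo equality almost everywhere.
\<close>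

type_synonym 'a fspace = "('a \<Rightarrow> ereal) set \<times> (('a \<Rightarrow> ereal) \<Rightarrow> ennreal)"

abbreviation carrier_of :: "'a fspace \<Rightarrow> ('a \<Rightarrow> ereal) set" where "carrier_of \<equiv> fst"
abbreviation norm_of :: "'a fspace \<Rightarrow> ('a \<Rightarrow> ereal) \<Rightarrow> ennreal" where "norm_of \<equiv> snd"

definition inter_space :: "'a fspace \<Rightarrow> 'a fspace \<Rightarrow> 'a fspace" where
  "inter_space A B = (carrier_of A \<inter> carrier_of B, \<lambda>u. norm_of A u + norm_of B u)"

definition eq_with_equivalent_norms :: "'a fspace \<Rightarrow> 'a fspace \<Rightarrow> bool" where
  "eq_with_equivalent_norms A B \<longleftrightarrow>
     carrier_of A = carrier_of B \<and>
     (\<exists>C>0::real. \<forall>u\<in>carrier_of A.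
        norm_of A u \<le> ennreal C * norm_of B u \<and> norm_of B u \<le> ennreal C * norm_of A u)"

text \<open>
  The ambient topological vector space of all spaces below: measurable functions that are finite
  almost everywhere. Finiteness makes sums well defined up to null sets. For the Hajlasz space, and
  for the Hajlasz--Besov space if \<open>X\<close> has at least two points, it already follows from finiteness
  of the norm, because \<open>\<bar>\<infinity> - \<infinity>\<bar> = \<infinity>\<close> for \<open>ereal\<close>.
\<close>

definition L0 :: "'a measure \<Rightarrow> ('a \<Rightarrow> ereal) set" where
  "L0 M = {u \<in> borel_measurable M. AE x in M. \<bar>u x\<bar> \<noteq> \<infinity>}"

definition Lp_norm :: "'a measure \<Rightarrow> real \<Rightarrow> ('a \<Rightarrow> ennreal) \<Rightarrow> ennreal" where
  "Lp_norm M p g = epowr (\<integral>\<^sup>+x. epowr (g x) p \<partial>M) (1 / p)"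

definition Lp_space :: "'a measure \<Rightarrow> real \<Rightarrow> 'a fspace" where
  "Lp_space M p =
     ({u \<in> L0 M. Lp_norm M p (\<lambda>x. e2ennreal \<bar>u x\<bar>) < \<infinity>}, \<lambda>u. Lp_norm M p (\<lambda>x. e2ennreal \<bar>u x\<bar>))"

definition lq_norm :: "ennreal \<Rightarrow> (int \<Rightarrow> ennreal) \<Rightarrow> ennreal" where
  "lq_norm q a =
     (if q = \<infinity> then (SUP k. a k)
      else epowr (\<integral>\<^sup>+k. epowr (a k) (enn2real q) \<partial>count_space UNIV) (1 / enn2real q))"

definition fractional_gradients ::
    "('a::metric_space set \<Rightarrow> ennreal) \<Rightarrow> real \<Rightarrow> ('a \<Rightarrow> ereal) \<Rightarrow> (int \<Rightarrow> 'a \<Rightarrow> ennreal) set" where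
  "fractional_gradients \<mu> s u =
     {g. (\<forall>k. g k \<in> borel_measurable (induced_measure \<mu>)) \<and>
         (\<exists>E. \<mu> E = 0 \<and>
           (\<forall>k. \<forall>x\<in>-E. \<forall>y\<in>-E.
              2 powi (-k - 1) \<le> dist x y \<and> dist x y < 2 powi (-k) \<longrightarrow>
              e2ennreal \<bar>u x - u y\<bar> \<le> ennreal (dist x y powr s) * (g k x + g k y)))}"

definition Besov_seminorm ::
    "('a::metric_space set \<Rightarrow> ennreal) \<Rightarrow> real \<Rightarrow> real \<Rightarrow> ennreal \<Rightarrow> ('a \<Rightarrow> ereal) \<Rightarrow> ennreal" where
  "Besov_seminorm \<mu> s p q u =
     (INF g\<in>fractional_gradients \<mu> s u. lq_norm q (\<lambda>k. Lp_norm (induced_measure \<mu>) p (g k)))"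

definition hom_Besov_space ::
    "('a::metric_space set \<Rightarrow> ennreal) \<Rightarrow> real \<Rightarrow> real \<Rightarrow> ennreal \<Rightarrow> 'a fspace" where
  "hom_Besov_space \<mu> s p q =
     ({u \<in> L0 (induced_measure \<mu>). Besov_seminorm \<mu> s p q u < \<infinity>}, Besov_seminorm \<mu> s p q)"

definition Besov_space ::
    "('a::metric_space set \<Rightarrow> ennreal) \<Rightarrow> real \<Rightarrow> real \<Rightarrow> ennreal \<Rightarrow> 'a fspace" where
  "Besov_space \<mu> s p q = inter_space (Lp_space (induced_measure \<mu>) p) (hom_Besov_space \<mu> s p q)"

definition one_gradients ::
    "('a::metric_space set \<Rightarrow> ennreal) \<Rightarrow> ('a \<Rightarrow> ereal) \<Rightarrow> ('a \<Rightarrow> ennreal) set" where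
  "one_gradients \<mu> u =
     {g \<in> borel_measurable (induced_measure \<mu>).
        \<exists>E. \<mu> E = 0 \<and>
          (\<forall>x\<in>-E. \<forall>y\<in>-E. e2ennreal \<bar>u x - u y\<bar> \<le> ennreal (dist x y) * (g x + g y))}"

definition Hajlasz_seminorm ::
    "('a::metric_space set \<Rightarrow> ennreal) \<Rightarrow> real \<Rightarrow> ('a \<Rightarrow> ereal) \<Rightarrow> ennreal" where
  "Hajlasz_seminorm \<mu> p u = (INF g\<in>one_gradients \<mu> u. Lp_norm (induced_measure \<mu>) p g)"

definition hom_Hajlasz_space ::
    "('a::metric_space set \<Rightarrow> ennreal) \<Rightarrow> real \<Rightarrow> 'a fspace" where
  "hom_Hajlasz_space \<mu> p =
     ({u \<in> L0 (induced_measure \<mu>). Hajlasz_seminorm \<mu> p u < \<infinity>}, Hajlasz_seminorm \<mu> p)"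

definition Hajlasz_space ::
    "('a::metric_space set \<Rightarrow> ennreal) \<Rightarrow> real \<Rightarrow> 'a fspace" where
  "Hajlasz_space \<mu> p = inter_space (Lp_space (induced_measure \<mu>) p) (hom_Hajlasz_space \<mu> p)"

text \<open>
  Real interpolation of two spaces inside \<open>L0 M\<close>. Since \<open>L0 M\<close> is understood modulo equality almost
  everywhere, so are the decompositions \<open>f = f\<^sub>0 + f\<^sub>1\<close>.
\<close>

definition decompositions ::
    "'a measure \<Rightarrow> 'a fspace \<Rightarrow> 'a fspace \<Rightarrow> ('a \<Rightarrow> ereal) \<Rightarrow> (('a \<Rightarrow> ereal) \<times> ('a \<Rightarrow> ereal)) set" where
  "decompositions M A0 A1 f =
     {(f0, f1). f0 \<in> carrier_of A0 \<and> f1 \<in> carrier_of A1 \<and> (AE x in M. f x = f0 x + f1 x)}"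

definition sum_carrier :: "'a measure \<Rightarrow> 'a fspace \<Rightarrow> 'a fspace \<Rightarrow> ('a \<Rightarrow> ereal) set" where
  "sum_carrier M A0 A1 = {f \<in> L0 M. decompositions M A0 A1 f \<noteq> {}}"

definition K_functional ::
    "'a measure \<Rightarrow> 'a fspace \<Rightarrow> 'a fspace \<Rightarrow> ('a \<Rightarrow> ereal) \<Rightarrow> real \<Rightarrow> ennreal" where
  "K_functional M A0 A1 f t =
     (INF (f0, f1)\<in>decompositions M A0 A1 f. norm_of A0 f0 + ennreal t * norm_of A1 f1)"

definition interpolation_norm ::
    "'a measure \<Rightarrow> 'a fspace \<Rightarrow> 'a fspace \<Rightarrow> real \<Rightarrow> ennreal \<Rightarrow> ('a \<Rightarrow> ereal) \<Rightarrow> ennreal" where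
  "interpolation_norm M A0 A1 s q f =
     (if q = \<infinity> then (SUP t\<in>{0<..}. ennreal (t powr (-s)) * K_functional M A0 A1 f t)
      else epowr
        (\<integral>\<^sup>+t\<in>{0<..}. epowr (ennreal (t powr (-s)) * K_functional M A0 A1 f t) (enn2real q)
           * ennreal (1 / t) \<partial>lborel)
        (1 / enn2real q))"

definition interpolation_space ::
    "'a measure \<Rightarrow> 'a fspace \<Rightarrow> 'a fspace \<Rightarrow> real \<Rightarrow> ennreal \<Rightarrow> 'a fspace" where
  "interpolation_space M A0 A1 s q =
     ({f \<in> sum_carrier M A0 A1. interpolation_norm M A0 A1 s q f < \<infinity>},
      interpolation_norm M A0 A1 s q)"

end

theory Submission
  imports Defs
begin

text \<open>
  The key idea is to compare both norms with one sequence. For \<open>g\<close> a fractional \<open>s\<close>-gradient of \<open>u\<close>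
  put \<open>a\<^sub>j = \<parallel>g\<^sub>j\<parallel>\<^sub>p\<close>; for the interpolation space put \<open>b\<^sub>k = 2^(k s) K(u, 2^(-k))\<close>. Since \<open>K\<close> is
  monotone in its scale, the interpolation norm is comparable to the \<open>\<ell>\<^sup>q\<close> norm of \<open>b\<close>
  (\<open>scale_norm_le_dyadic\<close>, \<open>dyadic_le_scale_norm\<close>), so the theorem compares \<open>a\<close> and \<open>b\<close> in \<open>\<ell>\<^sup>q\<close>.

  From the interpolation space to the Besov space one takes, for every \<open>k\<close>, a nearly optimal
  decomposition \<open>u = f\<^sub>0 + f\<^sub>1\<close> for \<open>K(u, 2^(-k))\<close> and a nearly optimal 1-gradient \<open>h\<close> of \<open>f\<^sub>1\<close>. On pairs
  at distance about \<open>2^(-k)\<close> the increments of \<open>u\<close> are controlled by \<open>\<bar>f\<^sub>0\<bar> + 2^(-k) h\<close>, so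
  \<open>2^(k s) (\<bar>f\<^sub>0\<bar> + 2^(-k) h)\<close> is, up to a constant, a fractional gradient, and \<open>a\<^sub>k\<close> is bounded by a
  multiple of \<open>b\<^sub>k\<close> (\<open>Besov_le_near_optimal\<close>).

  For the other inclusion one smooths \<open>u\<close> at scale \<open>t = 2^(-k)\<close>. With \<open>\<theta> = min s (1 - s)\<close>, the gradients
  of all scales combine into the single function \<open>H = 2^(1 - k s) sup\<^sub>j 2^(-\<theta> \<bar>k - j\<bar>) g\<^sub>j\<close>, which satisfies
  \<open>\<bar>u x - u y\<bar> \<le> (1 + d(x,y) / t) (H x + H y)\<close> (\<open>fractional_gradient_dyadic_bound\<close>). This one inequality
  suffices to build a continuous \<open>v\<close> with \<open>\<bar>u - v\<bar> \<le> h\<close> and with 1-gradient \<open>h / t\<close>, where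
  \<open>\<parallel>h\<parallel>\<^sub>p \<le> C \<parallel>H\<parallel>\<^sub>p\<close> (\<open>smoothing\<close>). Hence \<open>K(u, t) \<le> 2 C \<parallel>H\<parallel>\<^sub>p\<close>, and \<open>b\<^sub>k\<close> is bounded by a
  multiple of \<open>sup\<^sub>j 2^(-\<theta> \<bar>k - j\<bar> / 2) a\<^sub>j\<close>, whose \<open>\<ell>\<^sup>q\<close> norm is bounded by that of \<open>a\<close> (\<open>lq_norm_decay_sup\<close>).

  For \<open>p < 1\<close> the function \<open>u\<close> need not be locally integrable, so \<open>v\<close> cannot be built from averages of
  \<open>u\<close>. It is built from values of \<open>u\<close> instead: in every ball \<open>B(z, t)\<close> around a point \<open>z\<close> of a maximal
  \<open>t\<close>-separated set there is a point at which \<open>H\<^sup>p\<close> is at most twice its mean over that ball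
  (\<open>good_point\<close>), and \<open>v\<close> interpolates the values of \<open>u\<close> at these points with a Lipschitz partition
  of unity. The doubling property enters through the bounded overlap of the balls
  (\<open>separated_card\<close>). Since the means are those of \<open>H\<^sup>p\<close>, exchanging sums and integrals bounds their
  contribution to the \<open>L\<^sup>p\<close> norm of \<open>h\<close> for every exponent \<open>p\<close> (\<open>smoothing_Lp\<close>).

  The inhomogeneous case needs in addition that \<open>K(u, t) \<le> \<parallel>u\<parallel>\<^sub>p\<close> for \<open>t > 1\<close>, that \<open>t \<parallel>u\<parallel>\<^sub>p\<close>
  is of lower order than \<open>t\<^sup>s\<close> as \<open>t \<rightarrow> 0\<close>, and that \<open>\<parallel>u\<parallel>\<^sub>p\<close> is controlled by \<open>K(u, 1)\<close>.
\<close>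

section \<open>Powers, quasi-norms and dyadic kernels\<close>

lemma epowr_ennreal: "0 \<le> r \<Longrightarrow> epowr (ennreal r) a = ennreal (r powr a)"
  by (simp add: epowr_def)

lemma epowr_top [simp]: "epowr top a = top"
  by (simp add: epowr_def)

lemma epowr_0 [simp]: "epowr 0 a = 0"
  by (simp add: epowr_def)

lemma epowr_1 [simp]: "epowr x 1 = x"
  by (cases x) (auto simp: epowr_def)

lemma epowr_eq_top_iff [simp]: "epowr x a = top \<longleftrightarrow> x = top"
  by (simp add: epowr_def)

lemma epowr_less_top_iff [simp]: "epowr x a < top \<longleftrightarrow> x < top"
  by (simp add: less_top[symmetric])

lemma epowr_mono: "0 < a \<Longrightarrow> x \<le> y \<Longrightarrow> epowr x a \<le> epowr y a"
  by (cases x; cases y) (auto simp: epowr_ennreal powr_mono2 ennreal_leI top_unique)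

lemma epowr_mult:
  assumes "0 < a" shows "epowr (x * y) a = epowr x a * epowr y a"
proof -
  have top: "epowr (top * z) a = top * epowr z a" for z
    by (cases "z = 0") (auto simp: ennreal_top_mult epowr_def enn2real_eq_0_iff ennreal_eq_0_iff)
  show ?thesis
  proof (cases x)
    case top: top
    then show ?thesis using \<open>\<And>z. epowr (top * z) a = top * epowr z a\<close> by simp
  next
    case (real r)
    note x = this
    show ?thesis
    proof (cases y)
      case top
      then show ?thesis using \<open>\<And>z. epowr (top * z) a = top * epowr z a\<close>[of x] by (simp add: mult.commute)
    next
      case (real r')
      then show ?thesis using x by (simp add: ennreal_mult[symmetric] epowr_ennreal powr_mult)
    qed
  qed
qed

lemma epowr_epowr: "epowr (epowr x a) b = epowr x (a * b)"
  by (cases x) (auto simp: epowr_ennreal powr_powr)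

lemma epowr_inverse: "0 < a \<Longrightarrow> epowr (epowr x a) (1 / a) = x"
  by (simp add: epowr_epowr)

lemma epowr_inverse': "0 < a \<Longrightarrow> epowr (epowr x (1 / a)) a = x"
  by (simp add: epowr_epowr)

lemma epowr_le_swap: "0 < a \<Longrightarrow> x \<le> epowr y (1 / a) \<longleftrightarrow> epowr x a \<le> y"
  by (metis epowr_inverse epowr_inverse' epowr_mono zero_less_divide_1_iff)

text \<open>
  This replaces both convexity (for \<open>a \<ge> 1\<close>) and subadditivity (for \<open>a \<le> 1\<close>): \<open>x + y\<close> is at most
  twice the larger summand. The constant is not sharp, but one inequality covers all exponents.
\<close>

lemma epowr_add_le:
  assumes "0 < a"
  shows "epowr (x + y) a \<le> ennreal (2 powr a) * (epowr x a + epowr y a)"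
proof -
  have *: "epowr (x + y) a \<le> ennreal (2 powr a) * epowr (max x y) a"
  proof -
    have "x + y \<le> 2 * max x y"
      by (metis add_mono max.cobounded1 max.cobounded2 mult_2)
    then have "epowr (x + y) a \<le> epowr (ennreal 2 * max x y) a"
      by (intro epowr_mono assms) simp
    then show ?thesis
      by (simp only: epowr_mult[OF assms] epowr_ennreal)
  qed
  have "epowr (max x y) a \<le> epowr x a + epowr y a"
    by (auto simp: max_def add_increasing add_increasing2)
  then show ?thesis
    using * by (meson mult_left_mono order_trans zero_le)
qed

lemma measurable_epowr [measurable]:
  assumes "f \<in> borel_measurable M"
  shows "(\<lambda>x. epowr (f x) a) \<in> borel_measurable M"
proof -
  have "(\<lambda>x. if x \<in> {top} then top else ennreal (enn2real x powr a)) \<in> borel_measurable borel"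
    by (intro measurable_If_set) auto
  then have "(\<lambda>x. epowr x a) \<in> borel_measurable borel"
    by (simp add: epowr_def)
  from measurable_compose[OF assms this] show ?thesis .
qed

lemma Lp_norm_powr:
  "0 < p \<Longrightarrow> epowr (Lp_norm M p g) p = (\<integral>\<^sup>+x. epowr (g x) p \<partial>M)"
  by (simp add: Lp_norm_def epowr_inverse')

lemma Lp_norm_mono_AE:
  assumes "0 < p" "AE x in M. f x \<le> g x"
  shows "Lp_norm M p f \<le> Lp_norm M p g"
  unfolding Lp_norm_def using assms
  by (intro epowr_mono nn_integral_mono_AE) (auto intro: epowr_mono)

lemma Lp_norm_cmult:
  assumes "0 < p" "g \<in> borel_measurable M"
  shows "Lp_norm M p (\<lambda>x. c * g x) = c * Lp_norm M p g"
  using assms by (simp add: Lp_norm_def epowr_mult nn_integral_cmult epowr_inverse)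

text \<open>
  The constant of the quasi-triangle inequality in \<open>L\<^sup>p\<close> and in \<open>\<ell>\<^sup>q\<close>. For \<open>q = \<infinity>\<close> it appears at
  \<open>enn2real \<infinity> = 0\<close>, where its value is 2, because division by 0 gives 0.
\<close>

definition quasi_const :: "real \<Rightarrow> real" where
  "quasi_const p = 2 powr (1 + 1 / p)"

lemma quasi_const_pos [simp]: "0 < quasi_const p"
  by (simp add: quasi_const_def)

lemma epowr_sum_le:
  assumes "0 < p"
  shows "epowr (ennreal (2 powr p) * (epowr a p + epowr b p)) (1 / p) \<le> ennreal (quasi_const p) * (a + b)"
proof -
  have "epowr (ennreal (2 powr p) * (epowr a p + epowr b p)) (1 / p)
     = epowr (ennreal (2 powr p)) (1/p) * epowr (epowr a p + epowr b p) (1 / p)"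
    using assms by (simp add: epowr_mult)
  also have "epowr (ennreal (2 powr p)) (1/p) = ennreal 2"
    using assms by (simp add: epowr_ennreal powr_powr)
  also have "epowr (epowr a p + epowr b p) (1 / p) \<le> ennreal (2 powr (1/p)) * (a + b)"
    using epowr_add_le[of "1/p" "epowr a p" "epowr b p"] assms by (simp add: epowr_inverse)
  finally have "epowr (ennreal (2 powr p) * (epowr a p + epowr b p)) (1 / p)
     \<le> ennreal 2 * (ennreal (2 powr (1/p)) * (a + b))"
    by (simp add: mult_left_mono)
  also have "\<dots> = ennreal (quasi_const p) * (a + b)"
    by (simp only: mult.assoc[symmetric] ennreal_mult[symmetric]) (simp add: quasi_const_def powr_add ennreal_mult)
  finally show ?thesis .
qed

lemma Lp_norm_add:
  assumes "0 < p" and [measurable]: "f \<in> borel_measurable M" "g \<in> borel_measurable M"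
  shows "Lp_norm M p (\<lambda>x. f x + g x) \<le> ennreal (quasi_const p) * (Lp_norm M p f + Lp_norm M p g)"
proof -
  have "(\<integral>\<^sup>+x. epowr (f x + g x) p \<partial>M) \<le> (\<integral>\<^sup>+x. ennreal (2 powr p) * (epowr (f x) p + epowr (g x) p) \<partial>M)"
    by (intro nn_integral_mono epowr_add_le assms)
  also have "\<dots> = ennreal (2 powr p) * (epowr (Lp_norm M p f) p + epowr (Lp_norm M p g) p)"
    using assms(1) by (simp add: nn_integral_cmult nn_integral_add Lp_norm_powr)
  finally have "Lp_norm M p (\<lambda>x. f x + g x)
      \<le> epowr (ennreal (2 powr p) * (epowr (Lp_norm M p f) p + epowr (Lp_norm M p g) p)) (1 / p)"
    unfolding Lp_norm_def[of M p "\<lambda>x. f x + g x"] using assms(1) by (intro epowr_mono) auto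
  also have "\<dots> \<le> ennreal (quasi_const p) * (Lp_norm M p f + Lp_norm M p g)"
    by (rule epowr_sum_le) fact
  finally show ?thesis .
qed

lemma enn2real_pos: "0 < q \<Longrightarrow> q \<noteq> \<infinity> \<Longrightarrow> 0 < enn2real q"
  by (simp add: enn2real_positive_iff less_top)

lemma lq_norm_mono:
  assumes "0 < q" "\<And>k. a k \<le> b k"
  shows "lq_norm q a \<le> lq_norm q b"
  unfolding lq_norm_def using assms enn2real_pos[of q]
  by (auto intro!: SUP_mono' epowr_mono nn_integral_mono)

lemma lq_norm_cmult:
  assumes "0 < q"
  shows "lq_norm q (\<lambda>k. c * a k) = c * lq_norm q a"
  unfolding lq_norm_def using assms enn2real_pos[of q]
  by (auto simp: epowr_mult nn_integral_cmult epowr_inverse SUP_mult_left_ennreal)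

text \<open>
  For finite \<open>q\<close> the space \<open>\<ell>\<^sup>q\<close> is the \<open>L\<^sup>q\<close> space of the counting measure on the integers.
\<close>

lemma lq_norm_add:
  assumes "0 < q"
  shows "lq_norm q (\<lambda>k. a k + b k)
    \<le> ennreal (quasi_const (enn2real q)) * (lq_norm q a + lq_norm q b)"
proof (cases "q = \<infinity>")
  case True
  have "1 \<le> ennreal (quasi_const (enn2real q))"
    using True by (simp add: quasi_const_def)
  moreover have "(SUP k. a k + b k) \<le> (SUP k. a k) + (SUP k. b k)"
    by (intro SUP_least add_mono SUP_upper) auto
  ultimately have "1 * (SUP k. a k + b k) \<le> ennreal (quasi_const (enn2real q)) * ((SUP k. a k) + (SUP k. b k))"
    by (intro mult_mono) auto
  then show ?thesis
    using True by (simp only: lq_norm_def refl if_True mult_1)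
next
  case False
  then have "0 < enn2real q" using enn2real_pos assms by blast
  from Lp_norm_add[OF this, of a "count_space UNIV" b] show ?thesis
    using False by (simp add: lq_norm_def Lp_norm_def)
qed

lemma lq_norm_component:
  assumes "0 < q"
  shows "a k \<le> lq_norm q a"
proof (cases "q = \<infinity>")
  case True
  then show ?thesis by (auto simp: lq_norm_def intro: SUP_upper)
next
  case False
  then have r: "0 < enn2real q" using enn2real_pos assms by blast
  have "epowr (a k) (enn2real q) \<le> (\<integral>\<^sup>+k. epowr (a k) (enn2real q) \<partial>count_space UNIV)"
    by (rule nn_integral_ge_point) simp
  then show ?thesis
    using False r by (simp add: lq_norm_def epowr_le_swap)
qed

definition decay :: "real \<Rightarrow> int \<Rightarrow> ennreal" where
  "decay \<delta> m = ennreal (2 powr (- \<delta> * \<bar>real_of_int m\<bar>))"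

text \<open>
  A convolution on the integers with a geometrically decaying kernel, in which the sum is replaced
  by a supremum. The supremum commutes with all powers, and it is bounded by the sum when one is
  needed, so that exponents below and above 1 can be treated alike.
\<close>

definition decay_sup :: "real \<Rightarrow> (int \<Rightarrow> ennreal) \<Rightarrow> int \<Rightarrow> ennreal" where
  "decay_sup \<delta> a k = (SUP j. decay \<delta> (k - j) * a j)"

definition decay_mass :: "real \<Rightarrow> ennreal" where
  "decay_mass \<delta> = (\<integral>\<^sup>+m. decay \<delta> m \<partial>count_space UNIV)"

lemma epowr_decay: "epowr (decay \<delta> m) r = decay (\<delta> * r) m"
  by (simp add: decay_def epowr_ennreal powr_powr mult_ac)

lemma decay_split: "decay \<delta> m = decay (\<delta> / 2) m * decay (\<delta> / 2) m"
  by (simp add: decay_def ennreal_mult[symmetric] powr_add[symmetric])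

lemma decay_0 [simp]: "decay \<delta> 0 = 1"
  by (simp add: decay_def)

lemma decay_mass_less_top:
  assumes "0 < \<delta>"
  shows "decay_mass \<delta> < top"
proof -
  define r where "r = 2 powr (-\<delta>)"
  have r: "0 < r" "r < 1"
    using assms powr_less_mono[of "-\<delta>" 0 2] by (auto simp: r_def)
  have pw: "2 powr (- \<delta> * real n) = r ^ n" for n
    using r by (simp add: powr_realpow[symmetric] powr_powr r_def)
  have sum: "(\<integral>\<^sup>+n. ennreal (r ^ n) \<partial>count_space (UNIV :: nat set)) < top"
    using r by (simp add: nn_integral_count_space_nat suminf_ennreal2 summable_geometric)
  have "decay_mass \<delta> \<le> (\<integral>\<^sup>+m. decay \<delta> m * indicator (range int) m
        + decay \<delta> m * indicator (range (\<lambda>n. - int n)) m \<partial>count_space UNIV)"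
    unfolding decay_mass_def
  proof (rule nn_integral_mono)
    fix m :: int
    show "decay \<delta> m \<le> decay \<delta> m * indicator (range int) m + decay \<delta> m * indicator (range (\<lambda>n. - int n)) m"
    proof (cases "0 \<le> m")
      case True
      then have "m \<in> range int" by (auto intro: image_eqI[of _ _ "nat m"])
      then show ?thesis by simp
    next
      case False
      then have "m \<in> range (\<lambda>n. - int n)" by (auto intro: image_eqI[of _ _ "nat (-m)"])
      then show ?thesis by simp
    qed
  qed
  also have "\<dots> = (\<integral>\<^sup>+m. decay \<delta> m \<partial>count_space (range int)) + (\<integral>\<^sup>+m. decay \<delta> m \<partial>count_space (range (\<lambda>n. - int n)))"
    by (simp add: nn_integral_add nn_integral_count_space_indicator)
  also have "(\<integral>\<^sup>+m. decay \<delta> m \<partial>count_space (range int)) = (\<integral>\<^sup>+n. ennreal (r ^ n) \<partial>count_space UNIV)"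
    by (subst nn_integral_bij_count_space[symmetric, OF inj_on_imp_bij_betw[of int UNIV]])
       (auto simp: decay_def pw[symmetric])
  also have "(\<integral>\<^sup>+m. decay \<delta> m \<partial>count_space (range (\<lambda>n. - int n))) = (\<integral>\<^sup>+n. ennreal (r ^ n) \<partial>count_space UNIV)"
    by (subst nn_integral_bij_count_space[symmetric, OF inj_on_imp_bij_betw[of "\<lambda>n. - int n" UNIV]])
       (auto simp: decay_def pw[symmetric] inj_on_def)
  finally show ?thesis using sum by (auto elim!: order_le_less_trans)
qed

lemma decay_mass_shift:
  "(\<integral>\<^sup>+k. decay \<delta> (k - j) \<partial>count_space UNIV) = decay_mass \<delta>"
  "(\<integral>\<^sup>+j. decay \<delta> (k - j) \<partial>count_space UNIV) = decay_mass \<delta>"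
proof -
  have "bij (\<lambda>k. k - j)" by (rule bij_betw_byWitness[where f' = "\<lambda>k. k + j"]) auto
  from nn_integral_bij_count_space[OF this, of "decay \<delta>"]
  show "(\<integral>\<^sup>+k. decay \<delta> (k - j) \<partial>count_space UNIV) = decay_mass \<delta>"
    by (simp add: decay_mass_def)
  have "bij (\<lambda>j. k - j)" by (rule bij_betw_byWitness[where f' = "\<lambda>j. k - j"]) auto
  from nn_integral_bij_count_space[OF this, of "decay \<delta>"]
  show "(\<integral>\<^sup>+j. decay \<delta> (k - j) \<partial>count_space UNIV) = decay_mass \<delta>"
    by (simp add: decay_mass_def)
qed

text \<open>
  The inclusion of \<open>\<ell>\<^sup>r\<close> in \<open>\<ell>\<^sup>\<infinity>\<close>. It allows suprema over scales to be integrated term by term.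
\<close>

lemma epowr_SUP_le_sum:
  assumes "0 < r"
  shows "epowr (SUP j. x j) r \<le> (\<integral>\<^sup>+j. epowr (x j) r \<partial>count_space UNIV)"
proof -
  have "(SUP j. x j) \<le> epowr (\<integral>\<^sup>+j. epowr (x j) r \<partial>count_space UNIV) (1 / r)"
    proof (rule SUP_least)
    fix j
    have "epowr (x j) r \<le> (\<integral>\<^sup>+j. epowr (x j) r \<partial>count_space UNIV)"
      by (rule nn_integral_ge_point) simp
    then show "x j \<le> epowr (\<integral>\<^sup>+j. epowr (x j) r \<partial>count_space UNIV) (1 / r)"
      by (simp add: epowr_le_swap assms)
  qed
  then show ?thesis using assms by (simp add: epowr_le_swap)
qed

lemma decay_mass_root:
  assumes "0 < \<delta>" "0 < r"
  obtains C :: real where "0 < C" "epowr (decay_mass \<delta>) (1 / r) \<le> ennreal C"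
proof
  have "epowr (decay_mass \<delta>) (1 / r) < top" using decay_mass_less_top[OF assms(1)] by simp
  then have "epowr (decay_mass \<delta>) (1 / r) = ennreal (enn2real (epowr (decay_mass \<delta>) (1 / r)))"
    by simp
  also have "\<dots> \<le> ennreal (enn2real (epowr (decay_mass \<delta>) (1 / r)) + 1)"
    by (intro ennreal_leI) simp
  finally show "epowr (decay_mass \<delta>) (1 / r) \<le> ennreal (enn2real (epowr (decay_mass \<delta>) (1 / r)) + 1)" .
qed (simp add: add_nonneg_pos)

text \<open>
  A form of Young's inequality. After bounding the supremum by an \<open>\<ell>\<^sup>q\<close> sum, the order of summation
  can be exchanged, and the kernel, raised to the power \<open>q\<close>, is still summable.
\<close>

lemma lq_norm_decay_sup:
  assumes "0 < q" "0 < \<delta>"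
  obtains C :: real where "0 < C" "\<And>a. lq_norm q (decay_sup \<delta> a) \<le> ennreal C * lq_norm q a"
proof (cases "q = \<infinity>")
  case True
  have "decay_sup \<delta> a k \<le> (SUP j. a j)" for a k
    unfolding decay_sup_def
  proof (rule SUP_least)
    fix j
    have "decay \<delta> (k - j) \<le> 1"
      using assms powr_mono[of "- \<delta> * \<bar>real_of_int (k - j)\<bar>" 0 2] by (simp add: decay_def)
    then have "decay \<delta> (k - j) * a j \<le> 1 * a j" by (rule mult_right_mono) simp
    also have "\<dots> \<le> (SUP j. a j)" by (auto intro: SUP_upper)
    finally show "decay \<delta> (k - j) * a j \<le> (SUP j. a j)" .
  qed
  then have "lq_norm q (decay_sup \<delta> a) \<le> ennreal 1 * lq_norm q a" for a
    using True by (auto simp: lq_norm_def intro!: SUP_least)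
  then show thesis using that[of 1] by simp
next
  case False
  define r where "r = enn2real q"
  have r: "0 < r" using False assms enn2real_pos unfolding r_def by blast
  have "0 < \<delta> * r" using r assms by simp
  then obtain C where C: "0 < C" "epowr (decay_mass (\<delta> * r)) (1 / r) \<le> ennreal C"
    using decay_mass_root r by metis
  have "lq_norm q (decay_sup \<delta> a) \<le> ennreal C * lq_norm q a" for a
  proof -
    have "(\<integral>\<^sup>+k. epowr (decay_sup \<delta> a k) r \<partial>count_space UNIV)
        \<le> (\<integral>\<^sup>+k. \<integral>\<^sup>+j. decay (\<delta> * r) (k - j) * epowr (a j) r \<partial>count_space UNIV \<partial>count_space UNIV)"
      unfolding decay_sup_def
      by (intro nn_integral_mono order_trans[OF epowr_SUP_le_sum[OF r]])
         (simp add: epowr_mult r epowr_decay)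
    also have "\<dots> = (\<integral>\<^sup>+j. \<integral>\<^sup>+k. decay (\<delta> * r) (k - j) * epowr (a j) r \<partial>count_space UNIV \<partial>count_space UNIV)"
      by (rule nn_integral_count_space_nn_integral) auto
    also have "\<dots> = decay_mass (\<delta> * r) * (\<integral>\<^sup>+j. epowr (a j) r \<partial>count_space UNIV)"
      by (simp add: nn_integral_multc nn_integral_cmult decay_mass_shift)
    finally have "lq_norm q (decay_sup \<delta> a)
        \<le> epowr (decay_mass (\<delta> * r) * (\<integral>\<^sup>+j. epowr (a j) r \<partial>count_space UNIV)) (1 / r)"
      using False r by (simp add: lq_norm_def r_def[symmetric] epowr_mono)
    also have "\<dots> = epowr (decay_mass (\<delta> * r)) (1 / r) * lq_norm q a"
      using False r by (simp add: epowr_mult lq_norm_def r_def[symmetric])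
    also have "\<dots> \<le> ennreal C * lq_norm q a"
      by (intro mult_right_mono C) simp
    finally show ?thesis .
  qed
  with C(1) show thesis by (rule that)
qed

lemma measurable_decay_sup [measurable]:
  "(\<And>j. g j \<in> borel_measurable M) \<Longrightarrow> (\<lambda>x. decay_sup \<delta> (\<lambda>j. g j x) k) \<in> borel_measurable M"
  unfolding decay_sup_def by measurable

text \<open>
  The \<open>L\<^sup>p\<close> norm passes through the supremum at the cost of half of the decay: one half of the kernel
  stays with the norms on the right, and the other half makes the sum over \<open>j\<close> converge.
\<close>

lemma Lp_norm_decay_sup:
  fixes M :: "'a measure"
  assumes "0 < p" "0 < \<delta>"
  obtains C :: real where "0 < C"
    "\<And>(g :: int \<Rightarrow> 'a \<Rightarrow> ennreal) k. (\<And>j. g j \<in> borel_measurable M) \<Longrightarrow>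
       Lp_norm M p (\<lambda>x. decay_sup \<delta> (\<lambda>j. g j x) k) \<le> ennreal C * decay_sup (\<delta> / 2) (\<lambda>j. Lp_norm M p (g j)) k"
proof -
  have "0 < \<delta> * p / 2" using assms by simp
  then obtain C where C: "0 < C" "epowr (decay_mass (\<delta> * p / 2)) (1 / p) \<le> ennreal C"
    using decay_mass_root assms(1) by metis
  have "Lp_norm M p (\<lambda>x. decay_sup \<delta> (\<lambda>j. g j x) k) \<le> ennreal C * decay_sup (\<delta> / 2) (\<lambda>j. Lp_norm M p (g j)) k"
    if [measurable]: "\<And>j. g j \<in> borel_measurable M" for g :: "int \<Rightarrow> 'a \<Rightarrow> ennreal" and k
  proof -
    define T where "T = decay_sup (\<delta> / 2) (\<lambda>j. Lp_norm M p (g j)) k"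
    have "(\<integral>\<^sup>+x. epowr (decay_sup \<delta> (\<lambda>j. g j x) k) p \<partial>M)
        \<le> (\<integral>\<^sup>+x. \<integral>\<^sup>+j. decay (\<delta> * p) (k - j) * epowr (g j x) p \<partial>count_space UNIV \<partial>M)"
      unfolding decay_sup_def
      by (intro nn_integral_mono order_trans[OF epowr_SUP_le_sum[OF assms(1)]])
         (simp add: epowr_mult assms epowr_decay)
    also have "\<dots> = (\<integral>\<^sup>+j. \<integral>\<^sup>+x. decay (\<delta> * p) (k - j) * epowr (g j x) p \<partial>M \<partial>count_space UNIV)"
      by (rule nn_integral_count_space_nn_integral) auto
    also have "\<dots> = (\<integral>\<^sup>+j. decay (\<delta> * p) (k - j) * epowr (Lp_norm M p (g j)) p \<partial>count_space UNIV)"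
      using assms(1) by (simp add: nn_integral_cmult Lp_norm_powr)
    also have "\<dots> \<le> (\<integral>\<^sup>+j. decay (\<delta> * p / 2) (k - j) * epowr T p \<partial>count_space UNIV)"
    proof (rule nn_integral_mono)
      fix j
      have "decay (\<delta> / 2) (k - j) * Lp_norm M p (g j) \<le> T"
        unfolding T_def decay_sup_def by (rule SUP_upper) simp
      from epowr_mono[OF assms(1) this]
      have "decay (\<delta> * p / 2) (k - j) * epowr (Lp_norm M p (g j)) p \<le> epowr T p"
        by (simp add: epowr_mult assms epowr_decay)
      then have "decay (\<delta> * p / 2) (k - j) * (decay (\<delta> * p / 2) (k - j) * epowr (Lp_norm M p (g j)) p)
          \<le> decay (\<delta> * p / 2) (k - j) * epowr T p"
        by (rule mult_left_mono) simp
      then show "decay (\<delta> * p) (k - j) * epowr (Lp_norm M p (g j)) p \<le> decay (\<delta> * p / 2) (k - j) * epowr T p"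
        by (subst decay_split) (simp add: mult.assoc)
    qed
    also have "\<dots> = decay_mass (\<delta> * p / 2) * epowr T p"
      by (simp add: nn_integral_multc decay_mass_shift)
    finally have "Lp_norm M p (\<lambda>x. decay_sup \<delta> (\<lambda>j. g j x) k) \<le> epowr (decay_mass (\<delta> * p / 2) * epowr T p) (1 / p)"
      unfolding Lp_norm_def using assms(1) by (intro epowr_mono) auto
    also have "\<dots> = epowr (decay_mass (\<delta> * p / 2)) (1 / p) * T"
      using assms(1) by (simp add: epowr_mult epowr_inverse)
    also have "\<dots> \<le> ennreal C * T"
      by (intro mult_right_mono C) simp
    finally show ?thesis unfolding T_def .
  qed
  with C(1) show thesis by (rule that)
qed

lemma lq_norm_indicator:
  assumes "0 < q"
  shows "lq_norm q (indicator {0}) = 1"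
proof (cases "q = \<infinity>")
  case True
  have "(SUP k::int. indicator {0} k) = (1::ennreal)"
    by (intro antisym SUP_least SUP_upper2[of 0]) (auto simp: indicator_def)
  then show ?thesis using True by (simp add: lq_norm_def)
next
  case False
  have "(\<integral>\<^sup>+k. epowr (indicator {0} k) r \<partial>count_space (UNIV :: int set)) = (\<Sum>k\<in>{0::int}. epowr (indicator {0} k) r)" for r
    by (intro nn_integral_count_space') auto
  moreover have "epowr 1 r = 1" for r by (simp add: epowr_def)
  ultimately show ?thesis using False by (simp add: lq_norm_def)
qed

lemma decay_le_decay_sup: "decay \<delta> (k - j) * a j \<le> decay_sup \<delta> a k"
  unfolding decay_sup_def by (rule SUP_upper) simp

lemma decay_sup_mono: "(\<And>j. a j \<le> b j) \<Longrightarrow> decay_sup \<delta> a k \<le> decay_sup \<delta> b k"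
  unfolding decay_sup_def by (intro SUP_mono' mult_left_mono) auto

lemma decay_le_1: "0 < \<delta> \<Longrightarrow> decay \<delta> k \<le> 1"
  using powr_mono[of "- \<delta> * \<bar>real_of_int k\<bar>" 0 2] by (simp add: decay_def)

lemma decay_sup_le_lq_norm:
  assumes "0 < q" "0 < \<delta>" shows "decay_sup \<delta> a k \<le> lq_norm q a"
  unfolding decay_sup_def
proof (rule SUP_least)
  fix j
  show "decay \<delta> (k - j) * a j \<le> lq_norm q a"
    using mult_mono[OF decay_le_1[OF assms(2), of "k - j"] lq_norm_component[OF assms(1), of a j]] by simp
qed

lemma lq_norm_decay_less_top:
  assumes "0 < q" "0 < \<delta>" shows "lq_norm q (decay \<delta>) < top"
proof -
  obtain C :: real where C: "\<And>a. lq_norm q (decay_sup \<delta> a) \<le> ennreal C * lq_norm q a"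
    using lq_norm_decay_sup[OF assms] by blast
  have "lq_norm q (decay \<delta>) \<le> lq_norm q (decay_sup \<delta> (indicator {0}))"
    using decay_le_decay_sup[of \<delta> _ 0 "indicator {0}"] by (intro lq_norm_mono assms) simp
  also have "\<dots> \<le> ennreal C * 1" using C[of "indicator {0}"] by (simp add: lq_norm_indicator assms)
  also have "\<dots> < top" by simp
  finally show ?thesis .
qed

text \<open>
  Infima over gradients and decompositions are compared through their members; the constant is
  positive and finite and can be divided out.
\<close>

lemma le_mult_INF:
  fixes X :: ennreal
  assumes "0 < C" "\<And>y. y \<in> Y \<Longrightarrow> X \<le> ennreal C * f y"
  shows "X \<le> ennreal C * (INF y\<in>Y. f y)"
proof -
  have inv: "ennreal (1 / C) * (ennreal C * z) = z" "ennreal C * (ennreal (1 / C) * z) = z" for z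
    using assms(1) by (simp_all add: mult.assoc[symmetric] ennreal_mult[symmetric])
  have "ennreal (1 / C) * X \<le> (INF y\<in>Y. f y)"
  proof (rule INF_greatest)
    fix y assume "y \<in> Y"
    from mult_left_mono[OF assms(2)[OF this], of "ennreal (1 / C)"]
    show "ennreal (1 / C) * X \<le> f y" by (simp add: inv)
  qed
  from mult_left_mono[OF this, of "ennreal C"] show ?thesis by (simp add: inv)
qed

section \<open>Interpolation norms as dyadic sequence norms\<close>

lemma dyadic_scale:
  fixes t :: real
  assumes "0 < t"
  obtains k :: int where "2 powr (- real_of_int k - 1) \<le> t" "t < 2 powr (- real_of_int k)"
proof
  define k where "k = - \<lfloor>log 2 t\<rfloor> - 1"
  have *: "t = 2 powr (log 2 t)" using assms by simp
  show "2 powr (- real_of_int k - 1) \<le> t"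
  proof -
    have "2 powr (- real_of_int k - 1) \<le> 2 powr (log 2 t)"
      by (intro powr_mono) (auto simp: k_def)
    then show ?thesis using * by simp
  qed
  show "t < 2 powr (- real_of_int k)"
  proof -
    have "2 powr (log 2 t) < 2 powr (- real_of_int k)"
      by (intro powr_less_mono) (auto simp: k_def, linarith)
    then show ?thesis using * by simp
  qed
qed

lemma dyadic_scale_unique:
  fixes t :: real
  assumes "2 powr (- real_of_int k - 1) \<le> t" "t < 2 powr (- real_of_int k)"
    "2 powr (- real_of_int j - 1) \<le> t" "t < 2 powr (- real_of_int j)"
  shows "j = k"
proof -
  have "2 powr (- real_of_int k - 1) < 2 powr (- real_of_int j)" using assms by linarith
  then have "- real_of_int k - 1 < - real_of_int j" by simp
  moreover have "2 powr (- real_of_int j - 1) < 2 powr (- real_of_int k)" using assms by linarith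
  then have "- real_of_int j - 1 < - real_of_int k" by simp
  ultimately show ?thesis by linarith
qed

text \<open>
  The interpolation norm for an arbitrary function \<open>K\<close> of the scale in place of a \<open>K\<close>-functional.
\<close>

definition scale_norm :: "real \<Rightarrow> ennreal \<Rightarrow> (real \<Rightarrow> ennreal) \<Rightarrow> ennreal" where
  "scale_norm s q K =
     (if q = \<infinity> then (SUP t\<in>{0<..}. ennreal (t powr (-s)) * K t)
      else epowr (\<integral>\<^sup>+t\<in>{0<..}. epowr (ennreal (t powr (-s)) * K t) (enn2real q)
           * ennreal (1 / t) \<partial>lborel) (1 / enn2real q))"

definition dyadic :: "real \<Rightarrow> (real \<Rightarrow> ennreal) \<Rightarrow> int \<Rightarrow> ennreal" where
  "dyadic s K k = ennreal (2 powr (real_of_int k * s)) * K (2 powr (- real_of_int k))"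

definition shell :: "int \<Rightarrow> real set" where
  "shell k = {2 powr (- real_of_int k - 1) ..< 2 powr (- real_of_int k)}"

lemma shell_sum:
  assumes "t \<in> shell k"
  shows "(\<integral>\<^sup>+j. c j * indicator (shell j) t \<partial>count_space UNIV) = c k"
proof -
  have "(\<integral>\<^sup>+j. c j * indicator (shell j) t \<partial>count_space UNIV) = (\<Sum>j\<in>{k}. c j * indicator (shell j) t)"
    using assms dyadic_scale_unique[of k t]
    by (intro nn_integral_count_space') (auto simp: shell_def indicator_def)
  then show ?thesis using assms by simp
qed

text \<open>
  Shells are disjoint, so the inner sum is a step function; the shell of index \<open>j\<close> has length
  \<open>2^(-j - 1)\<close>.
\<close>

lemma shell_integral:
  "(\<integral>\<^sup>+t. \<integral>\<^sup>+j. c j * indicator (shell j) t \<partial>count_space UNIV \<partial>lborel)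
     = (\<integral>\<^sup>+j. c j * ennreal (2 powr (- real_of_int j - 1)) \<partial>count_space UNIV)"
proof -
  have "(\<integral>\<^sup>+t. \<integral>\<^sup>+j. c j * indicator (shell j) t \<partial>count_space UNIV \<partial>lborel)
     = (\<integral>\<^sup>+j. \<integral>\<^sup>+t. c j * indicator (shell j) t \<partial>lborel \<partial>count_space UNIV)"
    by (rule nn_integral_count_space_nn_integral) (auto simp: shell_def)
  also have "\<dots> = (\<integral>\<^sup>+j. c j * emeasure lborel (shell j) \<partial>count_space UNIV)"
    by (intro nn_integral_cong nn_integral_cmult_indicator) (simp add: shell_def)
  also have "\<dots> = (\<integral>\<^sup>+j. c j * ennreal (2 powr (- real_of_int j - 1)) \<partial>count_space UNIV)"
  proof (rule nn_integral_cong)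
    fix j
    have "2 powr (- real_of_int j) = 2 * 2 powr (- real_of_int j - 1)"
      by (simp add: powr_diff)
    then show "c j * emeasure lborel (shell j) = c j * ennreal (2 powr (- real_of_int j - 1))"
      by (simp add: shell_def)
  qed
  finally show ?thesis .
qed

text \<open>
  On the shell of index \<open>k\<close>, \<open>K\<close> is at most its value at the right end point \<open>2^(-k)\<close>, and \<open>t powr (-s)\<close>
  is at most its value at the left end point, which is larger than at the right one by \<open>2 powr s\<close>.
\<close>

lemma scale_norm_le_dyadic:
  assumes "0 < q" "0 < s" and mono: "\<And>t t'. 0 < t \<Longrightarrow> t \<le> t' \<Longrightarrow> K t \<le> K t'"
  shows "scale_norm s q K \<le> ennreal (2 powr s) * lq_norm q (dyadic s K)"
proof -
  have pt: "ennreal (t powr (-s)) * K t \<le> ennreal (2 powr s) * dyadic s K k" if "t \<in> shell k" for t k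
  proof -
    have t: "2 powr (- real_of_int k - 1) \<le> t" "t < 2 powr (- real_of_int k)" using that by (auto simp: shell_def)
    then have "0 < t" using powr_gt_zero[of 2 "- real_of_int k - 1"] by linarith
    have "t powr (-s) \<le> (2 powr (- real_of_int k - 1)) powr (-s)"
      using t(1) assms(2) by (intro powr_mono2') auto
    also have "\<dots> = 2 powr s * 2 powr (real_of_int k * s)"
      by (simp add: powr_powr powr_add[symmetric] algebra_simps)
    finally have "ennreal (t powr (-s)) * K t \<le> ennreal (2 powr s * 2 powr (real_of_int k * s)) * K (2 powr (- real_of_int k))"
      using \<open>0 < t\<close> t by (intro mult_mono mono ennreal_leI) auto
    then show ?thesis by (simp add: dyadic_def ennreal_mult mult.assoc)
  qed
  have ex: "\<exists>k. t \<in> shell k" if "0 < t" for t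
    using dyadic_scale[OF that] unfolding shell_def by (metis atLeastLessThan_iff)
  show ?thesis
  proof (cases "q = \<infinity>")
    case True
    have "ennreal (t powr (-s)) * K t \<le> ennreal (2 powr s) * (SUP k. dyadic s K k)" if "0 < t" for t
    proof -
      obtain k where "t \<in> shell k" using ex[OF \<open>0 < t\<close>] by blast
      from pt[OF this] show ?thesis
        by (rule order_trans) (intro mult_left_mono SUP_upper, auto)
    qed
    then show ?thesis using True by (auto simp: scale_norm_def lq_norm_def intro!: SUP_least)
  next
    case False
    define r where "r = enn2real q"
    have r: "0 < r" using False assms enn2real_pos unfolding r_def by blast
    define c where "c k = epowr (ennreal (2 powr s) * dyadic s K k) r" for k
    have "(\<integral>\<^sup>+t\<in>{0<..}. epowr (ennreal (t powr (-s)) * K t) r * ennreal (1 / t) \<partial>lborel)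
        \<le> (\<integral>\<^sup>+t. \<integral>\<^sup>+j. (c j * ennreal (2 powr (real_of_int j + 1))) * indicator (shell j) t \<partial>count_space UNIV \<partial>lborel)"
    proof (rule nn_integral_mono)
      fix t :: real
      show "epowr (ennreal (t powr (-s)) * K t) r * ennreal (1 / t) * indicator {0<..} t
         \<le> (\<integral>\<^sup>+j. (c j * ennreal (2 powr (real_of_int j + 1))) * indicator (shell j) t \<partial>count_space UNIV)"
      proof (cases "0 < t")
        case True
        then obtain k where k: "t \<in> shell k" using ex[OF True] by blast
        have "1 / t \<le> 1 / 2 powr (- real_of_int k - 1)"
          using k True by (intro divide_left_mono) (auto simp: shell_def)
        also have "\<dots> = 2 powr (real_of_int k + 1)"
          by (simp add: powr_minus_divide[symmetric] add.commute)
        finally have "epowr (ennreal (t powr (-s)) * K t) r * ennreal (1 / t) \<le> c k * ennreal (2 powr (real_of_int k + 1))"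
          unfolding c_def by (intro mult_mono[OF epowr_mono[OF r pt[OF k]] ennreal_leI]) auto
        then show ?thesis using True by (simp add: shell_sum[OF k])
      qed simp
    qed
    also have "\<dots> = (\<integral>\<^sup>+j. c j \<partial>count_space UNIV)"
      unfolding shell_integral by (simp add: mult.assoc ennreal_mult[symmetric] powr_add[symmetric])
    finally have "scale_norm s q K \<le> epowr (\<integral>\<^sup>+j. c j \<partial>count_space UNIV) (1 / r)"
      using False r by (simp add: scale_norm_def r_def[symmetric] epowr_mono)
    also have "\<dots> = lq_norm q (\<lambda>k. ennreal (2 powr s) * dyadic s K k)"
      using False by (simp add: lq_norm_def c_def r_def)
    finally show ?thesis by (simp add: lq_norm_cmult assms)
  qed
qed

text \<open>
  The same comparison with the end points exchanged: \<open>K\<close> is at least its value at \<open>2^(-k - 1)\<close>.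
  The factor \<open>2 powr (1 / q)\<close> comes from
  \<open>dt / t\<close>, which gives each shell at least the mass \<open>1 / 2\<close>.
\<close>

lemma dyadic_le_scale_norm:
  assumes "0 < q" "0 < s" and mono: "\<And>t t'. 0 < t \<Longrightarrow> t \<le> t' \<Longrightarrow> K t \<le> K t'"
  shows "lq_norm q (dyadic s K) \<le> ennreal (2 powr (s + 1 / enn2real q)) * scale_norm s q K"
proof (cases "q = \<infinity>")
  case True
  have "dyadic s K k \<le> (SUP t\<in>{0<..}. ennreal (t powr (-s)) * K t)" for k
  proof -
    have "dyadic s K k = ennreal ((2 powr (- real_of_int k)) powr (-s)) * K (2 powr (- real_of_int k))"
      by (simp add: dyadic_def powr_powr)
    also have "\<dots> \<le> (SUP t\<in>{0<..}. ennreal (t powr (-s)) * K t)"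
      by (rule SUP_upper) simp
    finally show ?thesis .
  qed
  then have "lq_norm q (dyadic s K) \<le> 1 * scale_norm s q K"
    using True by (auto simp: scale_norm_def lq_norm_def intro!: SUP_least)
  also have "\<dots> \<le> ennreal (2 powr (s + 1 / enn2real q)) * scale_norm s q K"
    using assms True by (intro mult_right_mono) (auto intro!: ge_one_powr_ge_zero)
  finally show ?thesis .
next
  case False
  define r where "r = enn2real q"
  have r: "0 < r" using False assms enn2real_pos unfolding r_def by blast
  have pt: "ennreal (2 powr (-s)) * dyadic s K (k + 1) \<le> ennreal (t powr (-s)) * K t" if "t \<in> shell k" for t k
  proof -
    have t: "2 powr (- real_of_int k - 1) \<le> t" "t < 2 powr (- real_of_int k)" using that by (auto simp: shell_def)
    then have "0 < t" using powr_gt_zero[of 2 "- real_of_int k - 1"] by linarith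
    have "- real_of_int (k + 1) = - real_of_int k - 1" by simp
    then have Kt: "K (2 powr (- real_of_int (k + 1))) \<le> K t" using t by (intro mono) simp_all
    have "2 powr (-s) * 2 powr (real_of_int (k + 1) * s) = (2 powr (- real_of_int k)) powr (-s)"
      by (simp add: powr_powr powr_add[symmetric] algebra_simps)
    also have "\<dots> \<le> t powr (-s)"
      using t \<open>0 < t\<close> assms(2) by (intro powr_mono2') auto
    finally have "ennreal (2 powr (-s) * 2 powr (real_of_int (k + 1) * s)) * K (2 powr (- real_of_int (k + 1)))
        \<le> ennreal (t powr (-s)) * K t"
      by (intro mult_mono Kt ennreal_leI) auto
    then show ?thesis by (simp add: dyadic_def ennreal_mult mult.assoc)
  qed
  define c where "c k = epowr (ennreal (2 powr (-s)) * dyadic s K (k + 1)) r" for k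
  define I where "I = (\<integral>\<^sup>+t\<in>{0<..}. epowr (ennreal (t powr (-s)) * K t) r * ennreal (1 / t) \<partial>lborel)"
  have "(\<integral>\<^sup>+t. \<integral>\<^sup>+j. (c j * ennreal (2 powr (real_of_int j))) * indicator (shell j) t \<partial>count_space UNIV \<partial>lborel) \<le> I"
    unfolding I_def
  proof (rule nn_integral_mono)
    fix t :: real
    show "(\<integral>\<^sup>+j. (c j * ennreal (2 powr (real_of_int j))) * indicator (shell j) t \<partial>count_space UNIV)
       \<le> epowr (ennreal (t powr (-s)) * K t) r * ennreal (1 / t) * indicator {0<..} t"
    proof (cases "0 < t")
      case True
      then obtain k where k: "t \<in> shell k" using dyadic_scale[OF True] unfolding shell_def by (metis atLeastLessThan_iff)
      have "2 powr (real_of_int k) = 1 / 2 powr (- real_of_int k)"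
        by (simp add: powr_minus_divide)
      also have "\<dots> \<le> 1 / t"
        using k True by (intro divide_left_mono) (auto simp: shell_def)
      finally have "c k * ennreal (2 powr (real_of_int k)) \<le> epowr (ennreal (t powr (-s)) * K t) r * ennreal (1 / t)"
        unfolding c_def by (intro mult_mono[OF epowr_mono[OF r pt[OF k]] ennreal_leI]) auto
      then show ?thesis using True by (simp add: shell_sum[OF k])
    next
      case False
      then have "t \<notin> shell j" for j
        using powr_gt_zero[of 2 "- real_of_int j - 1"] unfolding shell_def by (auto simp del: powr_gt_zero)
      then show ?thesis by simp
    qed
  qed
  also have "(\<integral>\<^sup>+t. \<integral>\<^sup>+j. (c j * ennreal (2 powr (real_of_int j))) * indicator (shell j) t \<partial>count_space UNIV \<partial>lborel)
      = (\<integral>\<^sup>+j. c j * ennreal (1/2) \<partial>count_space UNIV)"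
    unfolding shell_integral
    by (simp add: mult.assoc ennreal_mult[symmetric] powr_add[symmetric] powr_minus_divide)
  also have "\<dots> = (\<integral>\<^sup>+j. c j \<partial>count_space UNIV) * ennreal (1/2)"
    by (simp add: nn_integral_multc)
  also have "(\<integral>\<^sup>+j. c j \<partial>count_space UNIV)
      = (\<integral>\<^sup>+j. epowr (ennreal (2 powr (-s)) * dyadic s K j) r \<partial>count_space UNIV)"
  proof -
    have "bij (\<lambda>k::int. k + 1)" by (rule bij_betw_byWitness[where f' = "\<lambda>k. k - 1"]) auto
    from nn_integral_bij_count_space[OF this, of "\<lambda>j. epowr (ennreal (2 powr (-s)) * dyadic s K j) r"]
    show ?thesis by (simp add: c_def)
  qed
  finally have "epowr ((\<integral>\<^sup>+j. epowr (ennreal (2 powr (-s)) * dyadic s K j) r \<partial>count_space UNIV) * ennreal (1/2)) (1 / r)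
      \<le> epowr I (1 / r)"
    using r by (intro epowr_mono) auto
  then have "lq_norm q (\<lambda>j. ennreal (2 powr (-s)) * dyadic s K j) * ennreal ((1/2) powr (1/r)) \<le> scale_norm s q K"
    using r False by (simp only: epowr_mult zero_less_divide_1_iff lq_norm_def scale_norm_def I_def r_def if_False
        epowr_ennreal le_divide_eq_1)
  then have "ennreal (2 powr (-s)) * lq_norm q (dyadic s K) * ennreal ((1/2) powr (1/r)) \<le> scale_norm s q K"
    by (simp add: lq_norm_cmult assms)
  then have "ennreal (2 powr (s + 1/r)) * (ennreal (2 powr (-s)) * lq_norm q (dyadic s K) * ennreal ((1/2) powr (1/r)))
      \<le> ennreal (2 powr (s + 1/r)) * scale_norm s q K"
    by (rule mult_left_mono) simp
  moreover have "2 powr (s + 1/r) * (2 powr (-s) * (1/2) powr (1/r)) = (1::real)"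
    by (simp add: powr_add powr_minus powr_divide field_simps)
  then have "ennreal (2 powr (s + 1/r)) * (ennreal (2 powr (-s)) * lq_norm q (dyadic s K) * ennreal ((1/2) powr (1/r)))
      = lq_norm q (dyadic s K)"
  proof -
    have "ennreal c1 * (ennreal c2 * L * ennreal c3) = ennreal (c1 * (c2 * c3)) * L"
      if "0 \<le> c1" "0 \<le> c2" "0 \<le> c3" for c1 c2 c3 L
      using that by (simp add: ennreal_mult mult_ac)
    then show ?thesis using \<open>2 powr (s + 1/r) * (2 powr (-s) * (1/2) powr (1/r)) = (1::real)\<close>
      by simp
  qed
  ultimately show ?thesis by (simp add: r_def)
qed

lemma scale_norm_mono:
  assumes "0 < q" "\<And>t. 0 < t \<Longrightarrow> K t \<le> K' t"
  shows "scale_norm s q K \<le> scale_norm s q K'"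
proof (cases "q = \<infinity>")
  case True
  then show ?thesis unfolding scale_norm_def using assms
    by (auto intro!: SUP_subset_mono mult_left_mono)
next
  case False
  then have "0 < enn2real q" using enn2real_pos assms by blast
  moreover have "(\<integral>\<^sup>+t\<in>{0<..}. epowr (ennreal (t powr (-s)) * K t) (enn2real q) * ennreal (1 / t) \<partial>lborel)
      \<le> (\<integral>\<^sup>+t\<in>{0<..}. epowr (ennreal (t powr (-s)) * K' t) (enn2real q) * ennreal (1 / t) \<partial>lborel)"
  proof (rule nn_integral_mono)
    fix t :: real
    show "epowr (ennreal (t powr (-s)) * K t) (enn2real q) * ennreal (1 / t) * indicator {0<..} t
       \<le> epowr (ennreal (t powr (-s)) * K' t) (enn2real q) * ennreal (1 / t) * indicator {0<..} t"
      using assms(2)[of t] calculation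
      by (cases "0 < t") (auto intro!: mult_right_mono epowr_mono mult_left_mono)
  qed
  ultimately show ?thesis unfolding scale_norm_def using False by (simp add: epowr_mono)
qed

lemma K_functional_mono:
  "t \<le> t' \<Longrightarrow> K_functional N A0 A1 f t \<le> K_functional N A0 A1 f t'"
  unfolding K_functional_def by (intro INF_mono') (auto intro!: add_left_mono mult_right_mono ennreal_leI)

lemma interpolation_norm_eq: "interpolation_norm N A0 A1 s q f = scale_norm s q (K_functional N A0 A1 f)"
  by (simp add: interpolation_norm_def scale_norm_def)

lemma K_functional_le:
  "(f0, f1) \<in> decompositions N A0 A1 f \<Longrightarrow> K_functional N A0 A1 f t \<le> norm_of A0 f0 + ennreal t * norm_of A1 f1"
  unfolding K_functional_def by (rule INF_lower2[of "(f0, f1)"]) simp_all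

lemma eq_with_equivalent_normsI:
  assumes "0 < C1" "0 < C2"
    and "\<And>u. u \<in> carrier_of A \<Longrightarrow> u \<in> carrier_of B \<and> norm_of B u \<le> ennreal C1 * norm_of A u"
    and "\<And>u. u \<in> carrier_of B \<Longrightarrow> u \<in> carrier_of A \<and> norm_of A u \<le> ennreal C2 * norm_of B u"
  shows "eq_with_equivalent_norms A B"
  unfolding eq_with_equivalent_norms_def
proof (intro conjI exI[of _ "C1 + C2"] ballI)
  show "carrier_of A = carrier_of B" using assms by blast
  fix u assume u: "u \<in> carrier_of A"
  have "norm_of A u \<le> ennreal C2 * norm_of B u" "norm_of B u \<le> ennreal C1 * norm_of A u"
    using assms u by blast+
  moreover have "ennreal C2 * norm_of B u \<le> ennreal (C1 + C2) * norm_of B u"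
      "ennreal C1 * norm_of A u \<le> ennreal (C1 + C2) * norm_of A u"
    using assms by (auto intro!: mult_right_mono ennreal_leI)
  ultimately show "norm_of A u \<le> ennreal (C1 + C2) * norm_of B u" "norm_of B u \<le> ennreal (C1 + C2) * norm_of A u"
    by (meson order_trans)+
qed (use assms in auto)

section \<open>Doubling measures\<close>

locale doubling_space =
  fixes \<mu> :: "'a::metric_space set \<Rightarrow> ennreal"
  assumes doubling: "doubling_measure \<mu>"
begin

abbreviation "M \<equiv> induced_measure \<mu>"

lemma outer_measure: "outer_measure_space (Pow UNIV) \<mu>"
  using doubling by (simp add: doubling_measure_def borel_regular_outer_measure_def)

lemma measure_space_lambda: "measure_space UNIV (lambda_system UNIV (Pow UNIV) \<mu>) \<mu>"
proof -
  interpret sigma_algebra UNIV "Pow UNIV" by (rule sigma_algebra_Pow)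
  show ?thesis by (rule caratheodory_lemma[OF outer_measure])
qed

lemma sets_M: "sets M = lambda_system UNIV (Pow UNIV) \<mu>"
proof -
  have sa: "sigma_algebra UNIV (lambda_system UNIV (Pow UNIV) \<mu>)"
    using measure_space_lambda by (simp add: measure_space_def)
  show ?thesis
    unfolding induced_measure_def
    by (subst sets_measure_of) (use sigma_algebra.sigma_sets_eq[OF sa] in auto)
qed

lemma space_M [simp]: "space M = UNIV"
  by (simp add: induced_measure_def)

lemma emeasure_M: "A \<in> sets M \<Longrightarrow> emeasure M A = \<mu> A"
  using measure_space_lambda unfolding sets_M unfolding induced_measure_def
  by (intro emeasure_measure_of_sigma) (auto simp: measure_space_def)

lemma borel_sets_M: "A \<in> sets borel \<Longrightarrow> A \<in> sets M"
  using doubling by (auto simp: doubling_measure_def borel_regular_outer_measure_def sets_M)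

lemma borel_measurable_M: "f \<in> borel_measurable borel \<Longrightarrow> f \<in> borel_measurable M"
  using borel_sets_M by (auto simp: measurable_def)

lemma open_sets_M [measurable]: "open A \<Longrightarrow> A \<in> sets M"
  by (intro borel_sets_M borel_open)

lemma ball_sets_M [measurable]: "ball x r \<in> sets M"
  by (simp add: open_sets_M)

lemma mu_mono: "A \<subseteq> B \<Longrightarrow> \<mu> A \<le> \<mu> B"
  using outer_measure by (auto simp: outer_measure_space_def increasing_def)

lemma null_sets_M: "\<mu> E = 0 \<Longrightarrow> E \<in> null_sets M"
proof -
  assume E: "\<mu> E = 0"
  interpret sigma_algebra UNIV "Pow UNIV :: 'a set set" by (rule sigma_algebra_Pow)
  have sub: "subadditive (Pow UNIV) \<mu>"
    using outer_measure unfolding outer_measure_space_def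
    by (intro countably_subadditive_subadditive) blast+
  have "\<mu> (E \<inter> X) + \<mu> ((UNIV - E) \<inter> X) = \<mu> X" for X
  proof -
    have 1: "\<mu> (E \<inter> X) = 0" using mu_mono[of "E \<inter> X" E] E by simp
    have "\<mu> ((E \<inter> X) \<union> ((UNIV - E) \<inter> X)) \<le> \<mu> (E \<inter> X) + \<mu> ((UNIV - E) \<inter> X)"
      by (rule subadditiveD[OF sub]) auto
    moreover have "(E \<inter> X) \<union> ((UNIV - E) \<inter> X) = X" by auto
    ultimately show ?thesis using 1 mu_mono[of "(UNIV - E) \<inter> X" X] by (auto intro: antisym)
  qed
  then have "E \<in> sets M" unfolding sets_M by (simp add: lambda_system_def)
  then show ?thesis using E emeasure_M by auto
qed

text \<open>
  The exceptional sets in the definitions of gradients are null sets of the outer measure, while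
  equality almost everywhere refers to the induced measure. The two notions agree because the
  induced measure is complete.
\<close>

lemma AE_M_iff: "(AE x in M. P x) \<longleftrightarrow> (\<exists>E. \<mu> E = 0 \<and> (\<forall>x\<in>-E. P x))"
proof
  assume "AE x in M. P x"
  then obtain N where "N \<in> null_sets M" "{x \<in> space M. \<not> P x} \<subseteq> N"
    by (rule AE_E3) auto
  then show "\<exists>E. \<mu> E = 0 \<and> (\<forall>x\<in>-E. P x)"
    using emeasure_M by (intro exI[of _ N]) (auto simp: null_sets_def)
next
  assume "\<exists>E. \<mu> E = 0 \<and> (\<forall>x\<in>-E. P x)"
  then obtain E where "E \<in> null_sets M" "\<forall>x\<in>-E. P x" using null_sets_M by auto
  then show "AE x in M. P x" by (intro AE_I'[of E]) auto
qed

lemma AE_null_superset: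
  assumes "AE x in M. P x" "\<mu> E = 0"
  obtains N where "\<mu> N = 0" "E \<subseteq> N" "\<And>x. x \<notin> N \<Longrightarrow> P x"
proof -
  have "AE x in M. x \<notin> E" using assms(2) null_sets_M AE_not_in by blast
  with assms(1) have "AE x in M. P x \<and> x \<notin> E" by auto
  then show thesis using that unfolding AE_M_iff by blast
qed

lemma emeasure_ball: "emeasure M (ball x r) = \<mu> (ball x r)"
  by (simp add: emeasure_M)

lemma mu_ball_pos: "0 < r \<Longrightarrow> 0 < \<mu> (ball x r)"
  and mu_ball_finite: "0 < r \<Longrightarrow> \<mu> (ball x r) < top"
  using doubling by (auto simp: doubling_measure_def)

definition dconst :: real where
  "dconst = (SOME c. 0 < c \<and> (\<forall>x. \<forall>r>0. \<mu> (ball x (2 * r)) \<le> ennreal c * \<mu> (ball x r)))"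

lemma dconst: "0 < dconst" "0 < r \<Longrightarrow> \<mu> (ball x (2 * r)) \<le> ennreal dconst * \<mu> (ball x r)"
proof -
  have "\<exists>c. 0 < c \<and> (\<forall>x. \<forall>r>0. \<mu> (ball x (2 * r)) \<le> ennreal c * \<mu> (ball x r))"
    using doubling by (auto simp: doubling_measure_def)
  from someI_ex[OF this, folded dconst_def]
  show "0 < dconst" "0 < r \<Longrightarrow> \<mu> (ball x (2 * r)) \<le> ennreal dconst * \<mu> (ball x r)" by auto
qed

lemma doubling_iterate:
  assumes "0 < r"
  shows "\<mu> (ball x (2 ^ m * r)) \<le> ennreal (dconst ^ m) * \<mu> (ball x r)"
proof (induction m)
  case (Suc m)
  have "\<mu> (ball x (2 ^ Suc m * r)) \<le> ennreal dconst * \<mu> (ball x (2 ^ m * r))"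
    using dconst(2)[of "2 ^ m * r" x] assms by (simp add: mult.assoc)
  also have "\<dots> \<le> ennreal dconst * (ennreal (dconst ^ m) * \<mu> (ball x r))"
    by (intro mult_left_mono Suc) simp
  also have "\<dots> = ennreal (dconst ^ Suc m) * \<mu> (ball x r)"
    using dconst(1) by (simp add: ennreal_mult mult.assoc)
  finally show ?case .
qed simp

definition separated :: "real \<Rightarrow> 'a set \<Rightarrow> bool" where
  "separated t S \<longleftrightarrow> (\<forall>x\<in>S. \<forall>y\<in>S. x \<noteq> y \<longrightarrow> t \<le> dist x y)"

text \<open>
  The balls of radius \<open>t / 2\<close> around the points of \<open>F\<close> are disjoint and lie in \<open>B(x, R + t / 2)\<close>, and by
  doubling each of them carries at least the fraction \<open>dconst ^ (-m)\<close> of the measure of that ball.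
\<close>

lemma separated_card_finite:
  assumes "0 < t" "separated t F" "finite F" "F \<subseteq> ball x R" "2 * R + t / 2 \<le> 2 ^ m * (t / 2)"
  shows "real (card F) \<le> dconst ^ m"
proof (cases "F = {}")
  case True
  then show ?thesis using dconst(1) by simp
next
  case False
  then obtain z where "z \<in> F" by auto
  then have "dist x z < R" using assms(4) by auto
  then have "0 < R" using zero_le_dist[of x z] by linarith
  define B where "B = ball x (R + t / 2)"
  have B: "0 < \<mu> B" "\<mu> B < top"
    unfolding B_def using \<open>0 < R\<close> assms(1) by (auto intro!: mu_ball_pos mu_ball_finite)
  have disj: "disjoint_family_on (\<lambda>z. ball z (t / 2)) F"
    unfolding disjoint_family_on_def
  proof safe
    fix a b y assume ab: "a \<in> F" "b \<in> F" "a \<noteq> b" and y: "y \<in> ball a (t / 2)" "y \<in> ball b (t / 2)"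
    then have "dist a b < t" using dist_triangle[of a b y] by (simp add: dist_commute)
    moreover have "t \<le> dist a b" using assms(2) ab by (auto simp: separated_def)
    ultimately show "y \<in> {}" by simp
  qed
  have "ennreal (real (card F)) * \<mu> B = (\<Sum>z\<in>F. \<mu> B)"
    by (simp add: ennreal_of_nat_eq_real_of_nat)
  also have "\<dots> \<le> (\<Sum>z\<in>F. ennreal (dconst ^ m) * \<mu> (ball z (t / 2)))"
  proof (rule sum_mono)
    fix z assume "z \<in> F"
    then have "dist x z < R" using assms(4) by auto
    have "B \<subseteq> ball z (2 ^ m * (t / 2))"
    proof
      fix y assume "y \<in> B"
      then have "dist z y < 2 * R + t / 2"
        using \<open>dist x z < R\<close> dist_triangle[of z y x] by (simp add: B_def dist_commute)
      then show "y \<in> ball z (2 ^ m * (t / 2))" using assms(5) by simp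
    qed
    then have "\<mu> B \<le> \<mu> (ball z (2 ^ m * (t / 2)))" by (rule mu_mono)
    also have "\<dots> \<le> ennreal (dconst ^ m) * \<mu> (ball z (t / 2))"
      using assms(1) by (intro doubling_iterate) simp
    finally show "\<mu> B \<le> ennreal (dconst ^ m) * \<mu> (ball z (t / 2))" .
  qed
  also have "\<dots> = ennreal (dconst ^ m) * (\<Sum>z\<in>F. emeasure M (ball z (t / 2)))"
    by (simp add: sum_distrib_left emeasure_ball)
  also have "(\<Sum>z\<in>F. emeasure M (ball z (t / 2))) = emeasure M (\<Union>z\<in>F. ball z (t / 2))"
    using disj assms(3) by (intro sum_emeasure) auto
  also have "\<dots> \<le> emeasure M B"
  proof (rule emeasure_mono)
    show "(\<Union>z\<in>F. ball z (t / 2)) \<subseteq> B"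
    proof safe
      fix z y assume "z \<in> F" "y \<in> ball z (t / 2)"
      then show "y \<in> B" using assms(4) dist_triangle[of x y z] by (force simp: B_def)
    qed
  qed (simp add: B_def)
  finally have "ennreal (real (card F)) * \<mu> B \<le> ennreal (dconst ^ m) * \<mu> B"
    by (simp add: mult_left_mono B_def emeasure_ball)
  then have "ennreal (real (card F)) \<le> ennreal (dconst ^ m)"
    using B ennreal_mult_le_mult_iff[of "\<mu> B"] by (simp add: mult.commute)
  then show ?thesis using dconst(1) by simp
qed

lemma separated_card:
  assumes "0 < t" "separated t S" "2 * R + t / 2 \<le> 2 ^ m * (t / 2)"
  shows "finite (S \<inter> ball x R)" "real (card (S \<inter> ball x R)) \<le> dconst ^ m"
proof -
  have *: "real (card F) \<le> dconst ^ m" if "finite F" "F \<subseteq> S \<inter> ball x R" for F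
  proof (rule separated_card_finite[OF assms(1) _ that(1) _ assms(3)])
    show "separated t F" using assms(2) that by (auto simp: separated_def)
  qed (use that in auto)
  show fin: "finite (S \<inter> ball x R)"
  proof (rule ccontr)
    assume "infinite (S \<inter> ball x R)"
    then obtain F where F: "F \<subseteq> S \<inter> ball x R" "finite F" "card F = nat \<lceil>dconst ^ m\<rceil> + 1"
      using infinite_arbitrarily_large by metis
    from *[OF F(2,1)] F(3) show False by linarith
  qed
  show "real (card (S \<inter> ball x R)) \<le> dconst ^ m" using *[OF fin] by simp
qed

lemma separated_countable:
  assumes "0 < t" "separated t S"
  shows "countable S"
proof -
  fix x0 :: 'a
  have "S = (\<Union>n. S \<inter> ball x0 (real n))"
    using reals_Archimedean2[of "dist x0 _"] by auto
  moreover have "finite (S \<inter> ball x0 (real n))" for n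
  proof -
    obtain m where "(2 * real n + t / 2) / (t / 2) < 2 ^ m"
      using real_arch_pow[of 2] by auto
    then have "2 * real n + t / 2 \<le> 2 ^ m * (t / 2)"
      using assms(1) by (simp add: field_simps)
    from separated_card(1)[OF assms this] show ?thesis .
  qed
  ultimately show ?thesis
    by (metis countable_UN countable_finite uncountable_def countableI_type)
qed

lemma maximal_separated:
  assumes "0 < t"
  obtains S where "separated t S" "\<And>x. \<exists>z\<in>S. dist x z < t"
proof -
  have "\<exists>S\<in>Collect (separated t). \<forall>X\<in>Collect (separated t). S \<subseteq> X \<longrightarrow> X = S"
  proof (rule subset_Zorn')
    fix C assume C: "subset.chain (Collect (separated t)) C"
    show "\<Union>C \<in> Collect (separated t)"
      unfolding mem_Collect_eq separated_def
    proof (intro ballI impI)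
      fix x y assume "x \<in> \<Union>C" "y \<in> \<Union>C" "x \<noteq> y"
      then obtain A B where AB: "A \<in> C" "x \<in> A" "B \<in> C" "y \<in> B" by auto
      have "A \<subseteq> B \<or> B \<subseteq> A" using C AB by (auto simp: subset.chain_def subset_chain_def)
      moreover have "separated t A" "separated t B" using C AB by (auto simp: subset_chain_def)
      ultimately show "t \<le> dist x y" using AB \<open>x \<noteq> y\<close> by (auto simp: separated_def)
    qed
  qed
  then obtain S where S: "separated t S" "\<And>X. separated t X \<Longrightarrow> S \<subseteq> X \<Longrightarrow> X = S" by auto
  have "\<exists>z\<in>S. dist x z < t" for x
  proof (rule ccontr)
    assume "\<not> (\<exists>z\<in>S. dist x z < t)"
    then have far: "\<And>z. z \<in> S \<Longrightarrow> t \<le> dist x z" by force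
    then have "separated t (insert x S)"
      using S(1) by (auto simp: separated_def dist_commute)
    then have "x \<in> S" using S(2)[of "insert x S"] by auto
    then show False using far[of x] assms by simp
  qed
  then show thesis using that S(1) by blast
qed

text \<open>
  A Chebyshev argument: if \<open>f\<close> exceeded twice its mean at all points of the ball outside \<open>E\<close>, then the
  integral of \<open>f\<close> would be at least twice itself and hence 0 or infinite, and both values contradict
  the strict inequality.
\<close>

lemma good_point:
  assumes "0 < r" "\<mu> E = 0" and [measurable]: "f \<in> borel_measurable M"
  obtains y where "dist x y < r" "y \<notin> E" "f y * \<mu> (ball x r) \<le> 2 * (\<integral>\<^sup>+y\<in>ball x r. f y \<partial>M)"
proof -
  define m where "m = \<mu> (ball x r)"
  define I where "I = (\<integral>\<^sup>+y\<in>ball x r. f y \<partial>M)"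
  have m: "0 < m" "m < top" using assms(1) mu_ball_pos mu_ball_finite by (auto simp: m_def)
  have nonnull: "\<not> (AE y in M. y \<notin> ball x r)"
  proof
    assume "AE y in M. y \<notin> ball x r"
    then have "emeasure M (ball x r) = 0"
      by (subst (asm) AE_iff_measurable[of "ball x r"]) auto
    then show False using m by (simp add: emeasure_ball m_def)
  qed
  \<comment> \<open>The exceptional set cannot cover the ball, which has positive measure.\<close>
  have notE: "AE y in M. y \<notin> E" using assms(2) null_sets_M AE_not_in by blast
  have "\<exists>y. y \<in> ball x r \<and> y \<notin> E \<and> f y * m \<le> 2 * I"
  proof (rule ccontr)
    assume "\<not> ?thesis"
    then have big: "2 * I < f y * m" if "y \<in> ball x r" "y \<notin> E" for y using that by force
    have "2 * I * m = (\<integral>\<^sup>+y. 2 * I * indicator (ball x r) y \<partial>M)"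
      by (simp add: nn_integral_cmult_indicator emeasure_ball m_def)
    also have "\<dots> \<le> (\<integral>\<^sup>+y. (f y * indicator (ball x r) y) * m \<partial>M)"
    proof (rule nn_integral_mono_AE)
      show "AE y in M. 2 * I * indicator (ball x r) y \<le> (f y * indicator (ball x r) y) * m"
        using notE
      proof eventually_elim
        case (elim y)
        then show ?case using big[of y] by (cases "y \<in> ball x r") (auto simp del: mem_ball)
      qed
    qed
    also have "\<dots> = I * m" by (simp add: nn_integral_multc I_def)
    finally have "m * (2 * I) \<le> m * I" by (simp add: mult.commute)
    then have "2 * I \<le> I" using m by (subst (asm) ennreal_mult_le_mult_iff) auto
    then have "I = 0 \<or> I = top"
      by (cases I) (auto simp: ennreal_mult[symmetric] ennreal_numeral[symmetric] simp del: ennreal_numeral)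
    then show False
    proof
      assume "I = 0"
      then have "AE y in M. f y * indicator (ball x r) y = 0"
        unfolding I_def by (subst (asm) nn_integral_0_iff_AE) auto
      with notE have "AE y in M. y \<notin> ball x r"
      proof eventually_elim
        case (elim y)
        then show ?case using big[of y] by (auto simp: indicator_def split: if_splits)
      qed
      then show False using nonnull by simp
    next
      assume "I = top"
      then have "AE y in M. y \<notin> ball x r"
        using notE
      proof (elim eventually_mono)
        fix y assume "y \<notin> E"
        then show "y \<notin> ball x r" using big[of y] \<open>I = top\<close> by (auto simp: ennreal_mult_top)
      qed
      then show False using nonnull by simp
    qed
  qed
  then show thesis using that by (auto simp: m_def I_def)
qed

end

section \<open>Smoothing at a fixed scale\<close>

lemma weighted_average_dist:
  fixes \<psi> b :: "'b \<Rightarrow> real"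
  assumes "\<And>z. z \<in> F \<Longrightarrow> 0 \<le> \<psi> z" "0 < sum \<psi> F" "\<And>z. z \<in> F \<Longrightarrow> \<bar>b z - c\<bar> \<le> B"
  shows "\<bar>(\<Sum>z\<in>F. \<psi> z * b z) / sum \<psi> F - c\<bar> \<le> B"
proof -
  have "(\<Sum>z\<in>F. \<psi> z * b z) / sum \<psi> F - c = (\<Sum>z\<in>F. \<psi> z * (b z - c)) / sum \<psi> F"
    using assms(2) by (simp add: field_simps sum_subtractf sum_distrib_left)
  moreover have "\<bar>\<Sum>z\<in>F. \<psi> z * (b z - c)\<bar> \<le> (\<Sum>z\<in>F. \<psi> z * B)"
    by (intro order_trans[OF sum_abs] sum_mono) (simp add: abs_mult assms mult_left_mono)
  then have "\<bar>\<Sum>z\<in>F. \<psi> z * (b z - c)\<bar> \<le> B * sum \<psi> F"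
    by (simp add: sum_distrib_left mult.commute)
  ultimately show ?thesis
    using assms(2) by (simp add: abs_divide divide_le_eq)
qed

text \<open>
  With \<open>q\<close> the second average, the sum of \<open>\<psi> z * (b z - q)\<close> vanishes, so the difference of the averages
  is the sum of \<open>(\<phi> z - \<psi> z) * (b z - q)\<close> divided by the total weight of \<open>\<phi>\<close>.
\<close>

lemma weighted_average_diff:
  fixes \<phi> \<psi> b :: "'b \<Rightarrow> real"
  assumes "\<And>z. z \<in> F \<Longrightarrow> 0 \<le> \<psi> z" "1 / 2 \<le> sum \<phi> F" "1 / 2 \<le> sum \<psi> F"
    and "\<And>z. z \<in> F \<Longrightarrow> \<bar>b z - c\<bar> \<le> B" "\<And>z. z \<in> F \<Longrightarrow> \<bar>\<phi> z - \<psi> z\<bar> \<le> \<eta>"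
  shows "\<bar>(\<Sum>z\<in>F. \<phi> z * b z) / sum \<phi> F - (\<Sum>z\<in>F. \<psi> z * b z) / sum \<psi> F\<bar> \<le> 4 * real (card F) * \<eta> * B"
proof -
  define q where "q = (\<Sum>z\<in>F. \<psi> z * b z) / sum \<psi> F"
  have q: "\<bar>q - c\<bar> \<le> B"
    unfolding q_def using assms by (intro weighted_average_dist) auto
  have "(\<Sum>z\<in>F. \<psi> z * (b z - q)) = (\<Sum>z\<in>F. \<psi> z * b z) - sum \<psi> F * q"
    by (simp add: right_diff_distrib sum_subtractf sum_distrib_right)
  also have "\<dots> = 0" using assms(3) by (simp add: q_def)
  finally have zero: "(\<Sum>z\<in>F. \<psi> z * (b z - q)) = 0" .
  have "(\<Sum>z\<in>F. \<phi> z * b z) / sum \<phi> F - q = ((\<Sum>z\<in>F. \<phi> z * b z) - sum \<phi> F * q) / sum \<phi> F"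
    using assms(2) by (simp add: field_simps)
  also have "(\<Sum>z\<in>F. \<phi> z * b z) - sum \<phi> F * q = (\<Sum>z\<in>F. \<phi> z * (b z - q)) - (\<Sum>z\<in>F. \<psi> z * (b z - q))"
    unfolding zero by (simp add: right_diff_distrib sum_subtractf sum_distrib_right)
  also have "\<dots> = (\<Sum>z\<in>F. (\<phi> z - \<psi> z) * (b z - q))"
    by (simp add: left_diff_distrib sum_subtractf)
  finally have eq: "(\<Sum>z\<in>F. \<phi> z * b z) / sum \<phi> F - q = (\<Sum>z\<in>F. (\<phi> z - \<psi> z) * (b z - q)) / sum \<phi> F" .
  have "\<bar>\<Sum>z\<in>F. (\<phi> z - \<psi> z) * (b z - q)\<bar> \<le> (\<Sum>z\<in>F. \<eta> * (2 * B))"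
  proof (intro order_trans[OF sum_abs] sum_mono)
    fix z assume z: "z \<in> F"
    have "\<bar>b z - q\<bar> \<le> 2 * B" using assms(4)[OF z] q by linarith
    then show "\<bar>(\<phi> z - \<psi> z) * (b z - q)\<bar> \<le> \<eta> * (2 * B)"
      unfolding abs_mult using assms(5)[OF z] by (intro mult_mono) auto
  qed
  then have num: "\<bar>\<Sum>z\<in>F. (\<phi> z - \<psi> z) * (b z - q)\<bar> \<le> real (card F) * (\<eta> * (2 * B))" by simp
  have "\<bar>\<Sum>z\<in>F. (\<phi> z - \<psi> z) * (b z - q)\<bar> / sum \<phi> F \<le> (real (card F) * (\<eta> * (2 * B))) / (1/2)"
    using assms(2) num order_trans[OF abs_ge_zero num] by (intro frac_le) linarith+
  then show ?thesis
    unfolding q_def[symmetric] eq using assms(2) by (simp add: abs_divide mult_ac)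
qed

lemma measurable_nn_integral_count_space:
  assumes "countable S" and [measurable]: "\<And>z. z \<in> S \<Longrightarrow> f z \<in> borel_measurable M"
  shows "(\<lambda>x. \<integral>\<^sup>+z. f z x \<partial>count_space S) \<in> borel_measurable M"
proof -
  interpret sigma_finite_measure "count_space S"
    by (rule sigma_finite_measure_count_space_countable) fact
  have "(\<lambda>(z, x). f z x) \<in> borel_measurable (count_space S \<Otimes>\<^sub>M M)"
    by (rule measurable_pair_measure_countable1) (use assms in auto)
  from measurable_pair_swap[OF this]
  have "(\<lambda>(x, z). f z x) \<in> borel_measurable (M \<Otimes>\<^sub>M count_space S)" by (simp add: case_prod_beta)
  from borel_measurable_nn_integral[OF this] show ?thesis by simp
qed

context doubling_space
begin

text \<open>
  A bound for the number of points of a \<open>t\<close>-separated set in a ball of radius \<open>3 * t\<close>, since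
  \<open>2 * (3 * t) + t / 2\<close> is at most \<open>2 ^ 4 * (t / 2)\<close>.
\<close>

definition overlap :: real where "overlap = dconst ^ 4"

lemma net_finite:
  assumes "0 < t" "separated t S" "R \<le> 3 * t"
  shows "finite (S \<inter> ball x R)" "real (card (S \<inter> ball x R)) \<le> overlap"
proof -
  have "2 * R + t / 2 \<le> 2 ^ 4 * (t / 2)" using assms by simp
  from separated_card[OF assms(1,2) this]
  show "finite (S \<inter> ball x R)" "real (card (S \<inter> ball x R)) \<le> overlap" by (auto simp: overlap_def)
qed

text \<open>
  Here \<open>b z\<close> is the value of \<open>H\<close> at the good point of the ball \<open>B(z, t)\<close>, and \<open>A\<close> collects these values
  from the neighbourhood of a point. Integrating \<open>A\<^sup>p\<close> gives the sum over \<open>z\<close> of \<open>(b z)\<^sup>p\<close> times the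
  measure of \<open>B(z, 3 t)\<close>; by doubling and by the choice of the good points this is controlled by the
  sum of the integrals of \<open>H\<^sup>p\<close> over the balls \<open>B(z, t)\<close>, which have bounded overlap.
\<close>

lemma smoothing_Lp:
  assumes "0 < p" "0 < t" and S: "separated t S" and [measurable]: "H \<in> borel_measurable M"
    and w: "\<And>z. z \<in> S \<Longrightarrow> epowr (b z) p * \<mu> (ball z t) \<le> 2 * (\<integral>\<^sup>+y\<in>ball z t. epowr (H y) p \<partial>M)"
  defines "A \<equiv> \<lambda>x. epowr (\<Sum>z\<in>S \<inter> ball x (3 * t). epowr (b z) p) (1 / p)"
  shows "A \<in> borel_measurable M"
    and "Lp_norm M p A \<le> ennreal ((2 * dconst ^ 2 * overlap) powr (1 / p)) * Lp_norm M p H"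
proof -
  have cS: "countable S" by (rule separated_countable) fact+
  have ov: "0 \<le> overlap" using dconst(1) by (simp add: overlap_def)
  have A: "(\<Sum>z\<in>S \<inter> ball x (3 * t). epowr (b z) p)
      = (\<integral>\<^sup>+z. epowr (b z) p * indicator (ball z (3 * t)) x \<partial>count_space S)" for x
    using net_finite(1)[OF assms(2) S, of "3 * t" x]
    by (subst nn_integral_count_space'[where A = "S \<inter> ball x (3 * t)"])
       (auto simp: indicator_def dist_commute intro!: sum.cong)
  show Am: "A \<in> borel_measurable M"
    unfolding A_def A by (intro measurable_epowr measurable_nn_integral_count_space cS) measurable
  have "(\<integral>\<^sup>+x. epowr (A x) p \<partial>M)
      = (\<integral>\<^sup>+x. \<integral>\<^sup>+z. epowr (b z) p * indicator (ball z (3 * t)) x \<partial>count_space S \<partial>M)"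
    using assms(1) by (simp add: A_def epowr_inverse' A)
  also have "\<dots> = (\<integral>\<^sup>+z. \<integral>\<^sup>+x. epowr (b z) p * indicator (ball z (3 * t)) x \<partial>M \<partial>count_space S)"
    by (rule nn_integral_count_space_nn_integral[OF cS]) measurable
  also have "\<dots> = (\<integral>\<^sup>+z. epowr (b z) p * \<mu> (ball z (3 * t)) \<partial>count_space S)"
    by (simp add: nn_integral_cmult_indicator emeasure_ball)
  also have "\<dots> \<le> (\<integral>\<^sup>+z. ennreal (2 * dconst ^ 2) * (\<integral>\<^sup>+y. epowr (H y) p * indicator (ball z t) y \<partial>M) \<partial>count_space S)"
  proof (rule nn_integral_mono)
    fix z assume "z \<in> space (count_space S)"
    then have z: "z \<in> S" by simp
    have "\<mu> (ball z (3 * t)) \<le> \<mu> (ball z (2 ^ 2 * t))" using assms(2) by (intro mu_mono) auto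
    also have "\<dots> \<le> ennreal (dconst ^ 2) * \<mu> (ball z t)" by (rule doubling_iterate) fact
    finally have "epowr (b z) p * \<mu> (ball z (3 * t)) \<le> epowr (b z) p * (ennreal (dconst ^ 2) * \<mu> (ball z t))"
      by (rule mult_left_mono) simp
    also have "\<dots> = ennreal (dconst ^ 2) * (epowr (b z) p * \<mu> (ball z t))" by (simp add: mult_ac)
    also have "\<dots> \<le> ennreal (dconst ^ 2) * (2 * (\<integral>\<^sup>+y\<in>ball z t. epowr (H y) p \<partial>M))"
      by (intro mult_left_mono w z) simp
    also have "\<dots> = ennreal (2 * dconst ^ 2) * (\<integral>\<^sup>+y\<in>ball z t. epowr (H y) p \<partial>M)"
      by (simp add: ennreal_mult mult_ac)
    finally show "epowr (b z) p * \<mu> (ball z (3 * t))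
        \<le> ennreal (2 * dconst ^ 2) * (\<integral>\<^sup>+y\<in>ball z t. epowr (H y) p \<partial>M)" .
  qed
  also have "\<dots> = ennreal (2 * dconst ^ 2) * (\<integral>\<^sup>+z. \<integral>\<^sup>+y. epowr (H y) p * indicator (ball z t) y \<partial>M \<partial>count_space S)"
    by (simp add: nn_integral_cmult)
  also have "(\<integral>\<^sup>+z. \<integral>\<^sup>+y. epowr (H y) p * indicator (ball z t) y \<partial>M \<partial>count_space S)
      = (\<integral>\<^sup>+y. \<integral>\<^sup>+z. epowr (H y) p * indicator (ball z t) y \<partial>count_space S \<partial>M)"
    by (rule nn_integral_count_space_nn_integral[OF cS, symmetric]) measurable
  also have "\<dots> \<le> (\<integral>\<^sup>+y. epowr (H y) p * ennreal overlap \<partial>M)"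
  proof (rule nn_integral_mono)
    fix y
    have fin: "finite (S \<inter> ball y t)" "real (card (S \<inter> ball y t)) \<le> overlap"
      using net_finite[OF assms(2) S, of t y] assms(2) by auto
    have "(\<integral>\<^sup>+z. indicator (ball z t) y \<partial>count_space S) = (\<Sum>z\<in>S \<inter> ball y t. (1::ennreal))"
      using fin(1)
      by (subst nn_integral_count_space'[where A = "S \<inter> ball y t"])
         (auto simp: indicator_def dist_commute intro!: sum.cong)
    also have "\<dots> = ennreal (real (card (S \<inter> ball y t)))"
      by (simp add: ennreal_of_nat_eq_real_of_nat)
    also have "\<dots> \<le> ennreal overlap" by (intro ennreal_leI fin)
    finally have "(\<integral>\<^sup>+z. indicator (ball z t) y \<partial>count_space S) \<le> ennreal overlap" .
    then show "(\<integral>\<^sup>+z. epowr (H y) p * indicator (ball z t) y \<partial>count_space S) \<le> epowr (H y) p * ennreal overlap"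
      by (simp add: nn_integral_cmult mult_left_mono)
  qed
  also have "\<dots> = (\<integral>\<^sup>+y. epowr (H y) p \<partial>M) * ennreal overlap"
    by (simp add: nn_integral_multc)
  finally have "(\<integral>\<^sup>+x. epowr (A x) p \<partial>M) \<le> ennreal (2 * dconst ^ 2) * ((\<integral>\<^sup>+y. epowr (H y) p \<partial>M) * ennreal overlap)"
    by (simp add: mult_left_mono)
  also have "\<dots> = ennreal (2 * dconst ^ 2 * overlap) * (\<integral>\<^sup>+y. epowr (H y) p \<partial>M)"
    using ov dconst(1) by (simp add: ennreal_mult mult_ac)
  finally have "Lp_norm M p A \<le> epowr (ennreal (2 * dconst ^ 2 * overlap) * (\<integral>\<^sup>+y. epowr (H y) p \<partial>M)) (1 / p)"
    unfolding Lp_norm_def using assms(1) by (intro epowr_mono) auto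
  then show "Lp_norm M p A \<le> ennreal ((2 * dconst ^ 2 * overlap) powr (1 / p)) * Lp_norm M p H"
    using assms(1) ov dconst(1) by (simp add: epowr_mult epowr_ennreal Lp_norm_def)
qed

text \<open>
  Without normalization, the partition of unity subordinate to the balls of radius \<open>2 * t\<close>.
\<close>

definition bump :: "real \<Rightarrow> 'a \<Rightarrow> 'a \<Rightarrow> real" where
  "bump t z x = max 0 (1 - dist x z / (2 * t))"

text \<open>
  The sums run over \<open>B(x, 3 t)\<close>, although the bumps vanish outside \<open>B(x, 2 t)\<close>: with this room the index
  set of \<open>x\<close> also serves all points \<open>y\<close> at distance less than \<open>t\<close> from \<open>x\<close>.
\<close>

definition net_average :: "real \<Rightarrow> 'a set \<Rightarrow> ('a \<Rightarrow> real) \<Rightarrow> 'a \<Rightarrow> real" where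
  "net_average t S a x = (\<Sum>z\<in>S \<inter> ball x (3 * t). bump t z x * a z) / (\<Sum>z\<in>S \<inter> ball x (3 * t). bump t z x)"

lemma bump_nonneg: "0 \<le> bump t z x"
  by (simp add: bump_def)

lemma bump_lipschitz:
  assumes "0 < t" shows "\<bar>bump t z x - bump t z y\<bar> \<le> dist x y / (2 * t)"
proof -
  have "\<bar>bump t z x - bump t z y\<bar> \<le> \<bar>dist y z / (2 * t) - dist x z / (2 * t)\<bar>"
    by (auto simp: bump_def max_def)
  also have "\<dots> = \<bar>dist y z - dist x z\<bar> / (2 * t)"
    using assms by (simp add: diff_divide_distrib[symmetric] abs_divide)
  also have "\<dots> \<le> dist x y / (2 * t)"
    using assms dist_triangle[of y z x] dist_triangle[of x z y]
    by (intro divide_right_mono) (auto simp: dist_commute abs_le_iff)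
  finally show ?thesis .
qed

lemma bump_sum_ge:
  assumes "0 < t" "separated t S" "\<exists>z\<in>S. dist x z < t"
  shows "1 / 2 \<le> (\<Sum>z\<in>S \<inter> ball x (3 * t). bump t z x)"
proof -
  obtain z where z: "z \<in> S" "dist x z < t" using assms(3) by auto
  then have "1 / 2 \<le> bump t z x" using assms(1) by (simp add: bump_def field_simps)
  also have "\<dots> \<le> (\<Sum>z\<in>S \<inter> ball x (3 * t). bump t z x)"
    using z assms(1) net_finite(1)[OF assms(1,2), of "3 * t" x]
    by (intro member_le_sum) (auto simp: bump_nonneg)
  finally show ?thesis .
qed

lemma bump_sum_transport:
  assumes "0 < t" "separated t S" "dist x y < t"
  shows "(\<Sum>z\<in>S \<inter> ball y (3 * t). bump t z y * f z) = (\<Sum>z\<in>S \<inter> ball x (3 * t). bump t z y * f z)"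
proof (rule sum.mono_neutral_cong)
  show "bump t z y * f z = 0" if "z \<in> S \<inter> ball x (3 * t) - S \<inter> ball y (3 * t)" for z
    using that assms(1) by (auto simp: bump_def field_simps)
  show "bump t z y * f z = 0" if "z \<in> S \<inter> ball y (3 * t) - S \<inter> ball x (3 * t)" for z
    using that assms(1,3) dist_triangle[of x z y] by (auto simp: bump_def field_simps)
qed (use net_finite(1)[OF assms(1,2)] in auto)

lemma net_average_lipschitz:
  assumes "0 < t" and S: "separated t S" "\<And>x. \<exists>z\<in>S. dist x z < t" and xy: "dist x y < t"
    and osc: "\<And>z z'. z \<in> S \<inter> ball x (3 * t) \<Longrightarrow> z' \<in> S \<inter> ball x (3 * t) \<Longrightarrow> \<bar>a z - a z'\<bar> \<le> B"
  shows "\<bar>net_average t S a x - net_average t S a y\<bar> \<le> dist x y / t * (2 * overlap * B)"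
proof -
  define F where "F = S \<inter> ball x (3 * t)"
  obtain z0 where z0: "z0 \<in> S" "dist x z0 < t" using S(2) by auto
  then have z0F: "z0 \<in> F" using assms(1) by (auto simp: F_def)
  have B: "0 \<le> B" using osc[of z0 z0] z0F by (auto simp: F_def)
  have vx: "net_average t S a x = (\<Sum>z\<in>F. bump t z x * a z) / (\<Sum>z\<in>F. bump t z x)"
    by (simp add: net_average_def F_def)
  have vy: "net_average t S a y = (\<Sum>z\<in>F. bump t z y * a z) / (\<Sum>z\<in>F. bump t z y)"
    using bump_sum_transport[OF assms(1) S(1) xy, of a] bump_sum_transport[OF assms(1) S(1) xy, of "\<lambda>_. 1"]
    by (simp add: net_average_def F_def)
  have sy: "1 / 2 \<le> (\<Sum>z\<in>F. bump t z y)"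
    using bump_sum_ge[OF assms(1) S(1) S(2), of y] bump_sum_transport[OF assms(1) S(1) xy, of "\<lambda>_. 1"]
    by (simp add: F_def)
  have "\<bar>net_average t S a x - net_average t S a y\<bar> \<le> 4 * real (card F) * (dist x y / (2 * t)) * B"
    unfolding vx vy
    by (rule weighted_average_diff[where c = "a z0"])
       (use bump_nonneg sy bump_sum_ge[OF assms(1) S(1) S(2), of x] osc z0F bump_lipschitz[OF assms(1)]
         in \<open>auto simp: F_def\<close>)
  also have "\<dots> = dist x y / t * (2 * real (card F) * B)" using assms(1) by simp
  also have "\<dots> \<le> dist x y / t * (2 * overlap * B)"
    using net_finite(2)[OF assms(1) S(1), of "3 * t" x] assms(1) B
    by (intro mult_left_mono mult_right_mono) (auto simp: F_def)
  finally show ?thesis .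
qed

text \<open>
  The heart of the matter. Up to scale \<open>t\<close>, the hypothesis bounds the increments of \<open>u\<close> by \<open>H\<close>;
  beyond that scale, it makes \<open>2 * H / t\<close> act as a 1-gradient of \<open>u\<close>. The function \<open>v\<close> is
  the net average of the values of \<open>u\<close> at good points. On close pairs it is Lipschitz with a constant
  proportional to the oscillation of these values divided by \<open>t\<close>; for distant pairs one passes from \<open>v\<close> to \<open>u\<close> and back, since the error
  \<open>\<bar>u - v\<bar>\<close> is at most \<open>d(x,y) / t\<close> times itself.
\<close>

lemma smoothing:
  assumes "0 < p"
  obtains C :: real where "0 < C"
    "\<And>t u H E. \<lbrakk>0 < t; \<mu> E = 0; H \<in> borel_measurable M; Lp_norm M p H < top;
       \<And>x y. x \<notin> E \<Longrightarrow> y \<notin> E \<Longrightarrow> ennreal \<bar>u x - u y\<bar> \<le> ennreal (1 + dist x y / t) * (H x + H y)\<rbrakk>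
      \<Longrightarrow> \<exists>v h. continuous_on UNIV v \<and> h \<in> borel_measurable M \<and>
         Lp_norm M p h \<le> ennreal C * Lp_norm M p H \<and>
         (\<forall>x. x \<notin> E \<longrightarrow> ennreal \<bar>u x - v x\<bar> \<le> h x) \<and>
         (\<forall>x y. x \<notin> E \<longrightarrow> y \<notin> E \<longrightarrow> ennreal \<bar>v x - v y\<bar> \<le> ennreal (dist x y / t) * (h x + h y))"
proof -
  \<comment> \<open>Close pairs need \<open>36 * overlap\<close>: by \<open>net_average_lipschitz\<close> this is \<open>2 * overlap\<close> times the
      oscillation bound 18. Distant pairs need \<open>5 + 2\<close>: the deviation bound 5 and \<open>1 + d \<le> 2 * d\<close>.\<close>
  define C1 where "C1 = 36 * overlap + 7"
  define C2 where "C2 = (2 * dconst ^ 2 * overlap) powr (1 / p)"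
  define C where "C = C1 * (quasi_const p * (1 + C2))"
  have ov: "0 < overlap" using dconst(1) by (simp add: overlap_def)
  have C1: "7 \<le> C1" "36 * overlap \<le> C1" using ov by (auto simp: C1_def)
  have "0 < C" unfolding C_def using C1 by (intro mult_pos_pos) (auto simp: C2_def add_pos_nonneg)
  moreover have "\<exists>v h. continuous_on UNIV v \<and> h \<in> borel_measurable M \<and>
         Lp_norm M p h \<le> ennreal C * Lp_norm M p H \<and>
         (\<forall>x. x \<notin> E \<longrightarrow> ennreal \<bar>u x - v x\<bar> \<le> h x) \<and>
         (\<forall>x y. x \<notin> E \<longrightarrow> y \<notin> E \<longrightarrow> ennreal \<bar>v x - v y\<bar> \<le> ennreal (dist x y / t) * (h x + h y))"
    if t: "0 < t" and E: "\<mu> E = 0" and H [measurable]: "H \<in> borel_measurable M" and fin: "Lp_norm M p H < top"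
      and hyp: "\<And>x y. x \<notin> E \<Longrightarrow> y \<notin> E \<Longrightarrow> ennreal \<bar>u x - u y\<bar> \<le> ennreal (1 + dist x y / t) * (H x + H y)"
    for t :: real and u :: "'a \<Rightarrow> real" and H E
  proof -
    obtain S where S: "separated t S" "\<And>x. \<exists>z\<in>S. dist x z < t"
      using maximal_separated[OF t] by blast
    have "\<exists>y. dist z y < t \<and> y \<notin> E \<and> epowr (H y) p * \<mu> (ball z t) \<le> 2 * (\<integral>\<^sup>+y\<in>ball z t. epowr (H y) p \<partial>M)" for z
      by (rule good_point[OF t E, of "\<lambda>y. epowr (H y) p" z]) auto
    then obtain w where w: "\<And>z. dist z (w z) < t" "\<And>z. w z \<notin> E"
      "\<And>z. epowr (H (w z)) p * \<mu> (ball z t) \<le> 2 * (\<integral>\<^sup>+y\<in>ball z t. epowr (H y) p \<partial>M)"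
      by metis
    define A where "A = (\<lambda>x. epowr (\<Sum>z\<in>S \<inter> ball x (3 * t). epowr (H (w z)) p) (1 / p))"
    have A [measurable]: "A \<in> borel_measurable M" and AL: "Lp_norm M p A \<le> ennreal C2 * Lp_norm M p H"
      unfolding A_def C2_def by (rule smoothing_Lp[OF assms t S(1) H w(3)])+
    have HA: "H (w z) \<le> A x" if "z \<in> S" "dist x z < 3 * t" for x z
      unfolding A_def epowr_le_swap[OF assms]
      using that net_finite(1)[OF t S(1), of "3 * t" x] by (intro member_le_sum) auto
    have Hw: "H (w z) < top" for z
    proof -
      have "(\<integral>\<^sup>+y\<in>ball z t. epowr (H y) p \<partial>M) \<le> (\<integral>\<^sup>+y. epowr (H y) p \<partial>M)"
        by (intro nn_integral_mono) (auto simp: indicator_def)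
      also have "\<dots> < top" using fin assms by (simp add: Lp_norm_def)
      finally have "2 * (\<integral>\<^sup>+y\<in>ball z t. epowr (H y) p \<partial>M) < top"
        by (simp add: ennreal_mult_less_top)
      with w(3)[of z] have "epowr (H (w z)) p * \<mu> (ball z t) < top"
        by (rule order_le_less_trans)
      moreover have "\<mu> (ball z t) \<noteq> 0" using mu_ball_pos[OF t, of z] by simp
      ultimately have "H (w z) \<noteq> top" by (auto simp: ennreal_top_mult)
      then show ?thesis by (simp add: less_top)
    qed
    have Atop: "A x < top" for x
      using Hw net_finite(1)[OF t S(1), of "3 * t" x] by (auto simp: A_def)
    define v where "v = net_average t S (\<lambda>z. u (w z))"
    define h where "h = (\<lambda>x. ennreal C1 * (H x + A x))"
    \<comment> \<open>The points \<open>x\<close> and \<open>w z\<close> are at distance at most \<open>4 * t\<close>, so the factor is \<open>1 + 4\<close>.\<close>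
    have near: "ennreal \<bar>u x - u (w z)\<bar> \<le> ennreal 5 * (H x + A x)" if "x \<notin> E" "z \<in> S" "dist x z < 3 * t" for x z
    proof -
      have "dist x (w z) < 4 * t" using that w(1)[of z] dist_triangle[of x "w z" z] by simp
      then have "1 + dist x (w z) / t \<le> 5" using t by (simp add: field_simps)
      then have "ennreal (1 + dist x (w z) / t) * (H x + H (w z)) \<le> ennreal 5 * (H x + A x)"
        using HA[OF that(2,3)] by (intro mult_mono ennreal_leI add_mono) auto
      with hyp[OF that(1) w(2)[of z]] show ?thesis by (rule order_trans)
    qed
    \<comment> \<open>Two good points near \<open>x\<close> are at distance at most \<open>8 * t\<close>, which gives the factor \<open>2 * (1 + 8)\<close>.\<close>
    have osc: "\<bar>u (w z) - u (w z')\<bar> \<le> 18 * enn2real (A x)"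
      if "z \<in> S \<inter> ball x (3 * t)" "z' \<in> S \<inter> ball x (3 * t)" for x z z'
    proof -
      have "dist (w z) (w z') \<le> dist (w z) z + dist z x + dist x z' + dist z' (w z')"
        by metric
      then have "dist (w z) (w z') < 8 * t" using that w(1)[of z] w(1)[of z'] by (simp add: dist_commute)
      then have "1 + dist (w z) (w z') / t \<le> 9" using t by (simp add: field_simps)
      then have "ennreal (1 + dist (w z) (w z') / t) * (H (w z) + H (w z')) \<le> ennreal 9 * (A x + A x)"
        using HA[of z x] HA[of z' x] that by (intro mult_mono ennreal_leI add_mono) auto
      with hyp[OF w(2)[of z] w(2)[of z']] have "ennreal \<bar>u (w z) - u (w z')\<bar> \<le> ennreal 9 * (A x + A x)"
        by (rule order_trans)
      also have "\<dots> = ennreal (18 * enn2real (A x))"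
      proof -
        obtain r where r: "0 \<le> r" "A x = ennreal r" using Atop[of x] by (cases "A x") auto
        have "ennreal (18 * r) = ennreal (9 * (r + r))" by simp
        also have "\<dots> = ennreal 9 * (ennreal r + ennreal r)"
          using r(1) by (simp only: ennreal_mult ennreal_plus zero_le_numeral add_nonneg_nonneg)
        finally show ?thesis using r(1) by (simp only: r(2) enn2real_ennreal)
      qed
      finally show ?thesis by (simp add: ennreal_le_iff)
    qed
    have lip: "\<bar>v x - v y\<bar> \<le> dist x y / t * (36 * overlap * enn2real (A x))" if "dist x y < t" for x y
      using net_average_lipschitz[OF t S that, of "\<lambda>z. u (w z)", OF osc] by (simp add: v_def mult_ac)
    have dev: "ennreal \<bar>u x - v x\<bar> \<le> ennreal 5 * (H x + A x)" if "x \<notin> E" for x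
    proof (cases "H x = top")
      case True
      then show ?thesis by (simp add: ennreal_mult_top)
    next
      case False
      define B where "B = enn2real (ennreal 5 * (H x + A x))"
      have B: "ennreal 5 * (H x + A x) = ennreal B"
      proof -
        have "H x < top" using False by (simp add: less_top)
        then have "ennreal 5 * (H x + A x) < top" using Atop[of x] by (simp add: ennreal_mult_less_top)
        then show ?thesis unfolding B_def by simp
      qed
      have "\<bar>v x - u x\<bar> \<le> B"
        unfolding v_def net_average_def
      proof (rule weighted_average_dist)
        show "0 < (\<Sum>z\<in>S \<inter> ball x (3 * t). bump t z x)" using bump_sum_ge[OF t S(1) S(2), of x] by linarith
        fix z assume "z \<in> S \<inter> ball x (3 * t)"
        then have "ennreal \<bar>u x - u (w z)\<bar> \<le> ennreal B" using near[OF that, of z] B by simp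
        then show "\<bar>u (w z) - u x\<bar> \<le> B"
          by (subst (asm) ennreal_le_iff) (auto simp: B_def abs_minus_commute)
      qed (rule bump_nonneg)
      then show ?thesis unfolding B by (intro ennreal_leI) (simp add: abs_minus_commute)
    qed
    have "continuous_on UNIV v"
    proof -
      have "isCont v x" for x
      proof -
        define L where "L = 36 * overlap * enn2real (A x) / t"
        have "((\<lambda>y. L * dist x y) \<longlongrightarrow> L * dist x x) (at x)" by (intro tendsto_intros)
        then have lim: "((\<lambda>y. L * dist x y) \<longlongrightarrow> 0) (at x)" by simp
        have "eventually (\<lambda>y. dist (v y) (v x) \<le> L * dist x y) (at x)"
          using lip[of x] t unfolding eventually_at L_def
          by (intro exI[of _ t]) (auto simp: dist_real_def dist_commute abs_minus_commute mult_ac)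
        then have "((\<lambda>y. dist (v y) (v x)) \<longlongrightarrow> 0) (at x)"
          by (intro tendsto_sandwich[OF _ _ tendsto_const lim]) auto
        then show ?thesis unfolding isCont_def by (rule tendsto_dist_iff[THEN iffD2])
      qed
      then show ?thesis by (simp add: continuous_at_imp_continuous_on)
    qed
    moreover have "h \<in> borel_measurable M" by (simp add: h_def)
    moreover have "Lp_norm M p h \<le> ennreal C * Lp_norm M p H"
    proof -
      have "Lp_norm M p h = ennreal C1 * Lp_norm M p (\<lambda>x. H x + A x)"
        unfolding h_def by (intro Lp_norm_cmult assms) measurable
      also have "\<dots> \<le> ennreal C1 * (ennreal (quasi_const p) * (Lp_norm M p H + Lp_norm M p A))"
        by (intro mult_left_mono Lp_norm_add assms) auto
      also have "\<dots> \<le> ennreal C1 * (ennreal (quasi_const p) * (Lp_norm M p H + ennreal C2 * Lp_norm M p H))"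
        by (intro mult_left_mono add_mono AL) auto
      also have "Lp_norm M p H + ennreal C2 * Lp_norm M p H = ennreal (1 + C2) * Lp_norm M p H"
        by (simp add: C2_def distrib_right)
      also have "ennreal C1 * (ennreal (quasi_const p) * (ennreal (1 + C2) * Lp_norm M p H)) = ennreal C * Lp_norm M p H"
        using C1 quasi_const_pos[of p]
        by (simp add: C_def C2_def ennreal_mult mult.assoc del: quasi_const_pos)
      finally show ?thesis .
    qed
    moreover have "ennreal \<bar>u x - v x\<bar> \<le> h x" if "x \<notin> E" for x
      using dev[OF that] unfolding h_def
      by (rule order_trans) (use C1 in \<open>intro mult_right_mono ennreal_leI; auto\<close>)
    moreover have "ennreal \<bar>v x - v y\<bar> \<le> ennreal (dist x y / t) * (h x + h y)" if "x \<notin> E" "y \<notin> E" for x y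
    proof (cases "dist x y < t")
      case True
      have "ennreal \<bar>v x - v y\<bar> \<le> ennreal (dist x y / t * (36 * overlap * enn2real (A x)))"
        by (intro ennreal_leI lip True)
      also have "\<dots> = ennreal (dist x y / t) * (ennreal (36 * overlap) * A x)"
      proof -
        define a where "a = enn2real (A x)"
        have a: "A x = ennreal a" "0 \<le> a" using Atop[of x] by (auto simp: a_def)
        have "0 \<le> dist x y / t" "0 \<le> 36 * overlap" using t ov by auto
        with a(2) have "ennreal (dist x y / t * (36 * overlap * a)) = ennreal (dist x y / t) * (ennreal (36 * overlap) * ennreal a)"
          by (simp only: ennreal_mult mult_nonneg_nonneg)
        then show ?thesis using a(2) by (simp only: a(1) enn2real_ennreal)
      qed
      also have "\<dots> \<le> ennreal (dist x y / t) * (h x + h y)"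
        unfolding h_def using C1
        by (intro mult_left_mono order_trans[OF mult_mono[OF ennreal_leI, of _ C1 "A x" "H x + A x"]]) auto
      finally show ?thesis .
    next
      case False
      define d where "d = dist x y / t"
      define X where "X = H x + A x"
      define Y where "Y = H y + A y"
      have d: "1 \<le> d" using False t by (simp add: d_def)
      have "\<bar>v x - v y\<bar> \<le> \<bar>u x - v x\<bar> + \<bar>u x - u y\<bar> + \<bar>u y - v y\<bar>" by linarith
      then have "ennreal \<bar>v x - v y\<bar> \<le> ennreal \<bar>u x - v x\<bar> + ennreal \<bar>u x - u y\<bar> + ennreal \<bar>u y - v y\<bar>"
        by (simp add: ennreal_plus[symmetric] del: ennreal_plus)
      also have "\<dots> \<le> ennreal 5 * X + ennreal (1 + d) * (X + Y) + ennreal 5 * Y"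
        unfolding X_def Y_def d_def
        by (intro add_mono dev that order_trans[OF hyp[OF that]] mult_left_mono) auto
      also have "\<dots> \<le> ennreal (5 * d) * X + ennreal (2 * d) * (X + Y) + ennreal (5 * d) * Y"
        using d by (intro add_mono mult_right_mono ennreal_leI) auto
      also have "\<dots> = ennreal d * (ennreal 7 * X + ennreal 7 * Y)"
      proof -
        have "ennreal (5 * d) * X + ennreal (2 * d) * (X + Y) + ennreal (5 * d) * Y
            = (ennreal (5 * d) + ennreal (2 * d)) * X + (ennreal (5 * d) + ennreal (2 * d)) * Y"
          by (simp only: distrib_left distrib_right add_ac)
        also have "ennreal (5 * d) + ennreal (2 * d) = ennreal d * ennreal 7"
        proof -
          have "ennreal (5 * d) + ennreal (2 * d) = ennreal (d * 7)"
            using d by (simp add: ennreal_plus[symmetric] mult.commute del: ennreal_plus)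
          then show ?thesis using d by (simp only: ennreal_mult)
        qed
        finally show ?thesis by (simp only: distrib_left mult.assoc)
      qed
      also have "\<dots> \<le> ennreal d * (h x + h y)"
        unfolding h_def X_def[symmetric] Y_def[symmetric] using C1
        by (intro mult_left_mono add_mono mult_right_mono ennreal_leI) auto
      finally show ?thesis unfolding d_def .
    qed
    ultimately show ?thesis by blast
  qed
  ultimately show thesis by (rule that)
qed

end

section \<open>Besov functions lie in the interpolation space\<close>

text \<open>
  With \<open>\<rho> = d / 2^(-k)\<close>, which is about \<open>2^(k - j)\<close>, one has \<open>d powr s = 2^(-k s) * \<rho> powr s\<close>. If \<open>\<rho>\<close>
  is small, then \<open>\<rho> powr s\<close> decays like \<open>2^(-s \<bar>k - j\<bar>)\<close>; if it is large, then \<open>\<rho> powr s\<close> equals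
  \<open>\<rho> * \<rho> powr (s - 1)\<close>, and the second factor decays like \<open>2^(-(1 - s) \<bar>k - j\<bar>)\<close>.
\<close>

lemma dyadic_scale_factor:
  fixes d s :: real and j k :: int
  assumes "0 < s" "s < 1" "2 powr (- real_of_int j - 1) \<le> d" "d < 2 powr (- real_of_int j)"
  shows "d powr s \<le> (1 + d / 2 powr (- real_of_int k))
     * (2 * 2 powr (- real_of_int k * s)) * 2 powr (- min s (1 - s) * \<bar>real_of_int (k - j)\<bar>)"
proof -
  define \<rho> where "\<rho> = d / 2 powr (- real_of_int k)"
  define n where "n = real_of_int (k - j)"
  define D where "D = 2 powr (- min s (1 - s) * \<bar>n\<bar>)"
  have d: "0 < d" using assms(3) powr_gt_zero[of 2 "- real_of_int j - 1"] by linarith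
  then have \<rho>: "0 < \<rho>" by (simp add: \<rho>_def)
  have dk: "d = 2 powr (- real_of_int k) * \<rho>" by (simp add: \<rho>_def)
  have lo: "2 powr (n - 1) \<le> \<rho>"
  proof -
    have "2 powr (n - 1) = 2 powr (- real_of_int j - 1) / 2 powr (- real_of_int k)"
      by (simp add: n_def powr_diff[symmetric] algebra_simps)
    then show ?thesis unfolding \<rho>_def using assms(3) by (simp add: divide_right_mono)
  qed
  have hi: "\<rho> \<le> 2 powr n"
  proof -
    have "2 powr n = 2 powr (- real_of_int j) / 2 powr (- real_of_int k)"
      by (simp add: n_def powr_diff[symmetric] algebra_simps)
    then show ?thesis unfolding \<rho>_def using assms(4) by (simp add: divide_right_mono)
  qed
  have "\<rho> powr s \<le> (1 + \<rho>) * 2 * D"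
  proof (cases "n \<le> 0")
    case True
    have "\<rho> powr s \<le> (2 powr n) powr s" using hi \<rho> assms(1) by (intro powr_mono2) auto
    also have "\<dots> = 2 powr (n * s)" by (simp add: powr_powr)
    also have "\<dots> \<le> D"
      unfolding D_def using True assms(1) mult_left_mono_neg[of "min s (1 - s)" s n] by (intro powr_mono) (auto simp: mult.commute)
    also have "\<dots> \<le> (1 + \<rho>) * 2 * D"
      using \<rho> mult_right_mono[of 1 "(1 + \<rho>) * 2" D] by (simp add: D_def)
    finally show ?thesis .
  next
    case False
    have "\<rho> powr s = \<rho> * \<rho> powr (s - 1)"
      using \<rho> by (simp add: powr_diff)
    also have "\<rho> powr (s - 1) \<le> (2 powr (n - 1)) powr (s - 1)"
      using lo assms(2) by (intro powr_mono2') auto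
    also have "(2 powr (n - 1)) powr (s - 1) = 2 powr (1 - s) * 2 powr (- (1 - s) * n)"
      by (simp add: powr_powr powr_add[symmetric] algebra_simps)
    also have "\<dots> \<le> 2 powr 1 * D"
    proof -
      have "- (1 - s) * n \<le> - min s (1 - s) * \<bar>n\<bar>"
        using False mult_right_mono[of "min s (1 - s)" "1 - s" n] by (simp only: mult_minus_left neg_le_iff_le) simp
      then have "2 powr (- (1 - s) * n) \<le> D"
        unfolding D_def by (rule powr_mono) simp
      moreover have "2 powr (1 - s) \<le> 2 powr (1::real)"
        using assms(1) by (intro powr_mono) auto
      ultimately show ?thesis by (intro mult_mono) simp_all
    qed
    finally have "\<rho> powr s \<le> \<rho> * (2 powr 1 * D)" using \<rho> by (simp add: mult_left_mono)
    also have "\<dots> \<le> (1 + \<rho>) * 2 * D" using \<rho> by (simp add: D_def algebra_simps)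
    finally show ?thesis .
  qed
  then have "2 powr (- real_of_int k * s) * \<rho> powr s \<le> 2 powr (- real_of_int k * s) * ((1 + \<rho>) * 2 * D)"
    by (rule mult_left_mono) simp
  moreover have "d powr s = 2 powr (- real_of_int k * s) * \<rho> powr s"
    using \<rho> by (subst dk) (simp add: powr_mult powr_powr)
  ultimately show ?thesis
    unfolding \<rho>_def[symmetric] n_def[symmetric] D_def[symmetric] by (simp add: mult_ac)
qed

lemma powi_eq_powr: "(2::real) powi k = 2 powr (real_of_int k)"
  by (simp add: powr_real_of_int')

locale interpolation_setting = doubling_space +
  fixes p s :: real and q :: ennreal
  assumes p: "0 < p" and q: "0 < q" and s: "0 < s" "s < 1"
begin

abbreviation "K_hom \<equiv> K_functional M (Lp_space M p) (hom_Hajlasz_space \<mu> p)"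
abbreviation "K_inhom \<equiv> K_functional M (Lp_space M p) (Hajlasz_space \<mu> p)"
abbreviation "Lp u \<equiv> Lp_norm M p (\<lambda>x. e2ennreal \<bar>u x\<bar>)"

definition \<theta> :: real where "\<theta> = min s (1 - s)"

lemma theta: "0 < \<theta>" "\<theta> \<le> s" "\<theta> \<le> 1 - s"
  using s by (auto simp: \<theta>_def)

text \<open>
  All scales of a fractional gradient combine into one function that satisfies the hypothesis of
  \<open>smoothing\<close> at the scale \<open>2^(-k)\<close>.
\<close>

lemma fractional_gradient_dyadic_bound:
  fixes k :: int
  assumes grad: "\<And>j x y. x \<notin> E \<Longrightarrow> y \<notin> E \<Longrightarrow> 2 powi (-j - 1) \<le> dist x y \<Longrightarrow> dist x y < 2 powi (-j) \<Longrightarrow>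
       ennreal \<bar>u x - u y\<bar> \<le> ennreal (dist x y powr s) * (g j x + g j y)"
    and "x \<notin> E" "y \<notin> E"
  defines "H \<equiv> \<lambda>x. ennreal (2 * 2 powr (- real_of_int k * s)) * decay_sup \<theta> (\<lambda>j. g j x) k"
  shows "ennreal \<bar>u x - u y\<bar> \<le> ennreal (1 + dist x y / 2 powr (- real_of_int k)) * (H x + H y)"
proof (cases "x = y")
  case False
  define d where "d = dist x y"
  have d: "0 < d" using False by (simp add: d_def)
  obtain j where j: "2 powr (- real_of_int j - 1) \<le> d" "d < 2 powr (- real_of_int j)"
    using dyadic_scale[OF d] by blast
  define c where "c = (1 + d / 2 powr (- real_of_int k))"
  define e where "e = 2 * 2 powr (- real_of_int k * s)"
  have ce: "0 \<le> c" "0 \<le> e" using d by (auto simp: c_def e_def)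
  have "ennreal \<bar>u x - u y\<bar> \<le> ennreal (d powr s) * (g j x + g j y)"
    using grad[OF assms(2,3), of j] j by (simp add: powi_eq_powr d_def)
  also have "\<dots> \<le> ennreal (c * e * 2 powr (- \<theta> * \<bar>real_of_int (k - j)\<bar>)) * (g j x + g j y)"
    using dyadic_scale_factor[OF s j, of k] unfolding \<theta>_def c_def e_def
    by (intro mult_right_mono ennreal_leI) auto
  also have "\<dots> = ennreal c * (ennreal e * (decay \<theta> (k - j) * g j x) + ennreal e * (decay \<theta> (k - j) * g j y))"
    using ce by (simp add: decay_def ennreal_mult mult.assoc distrib_left)
  also have "\<dots> \<le> ennreal c * (H x + H y)"
    unfolding H_def e_def[symmetric]
    by (intro mult_left_mono add_mono decay_le_decay_sup[of \<theta> k j "\<lambda>j. g j x"] decay_le_decay_sup[of \<theta> k j "\<lambda>j. g j y"]) auto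
  finally show ?thesis by (simp add: c_def d_def)
qed simp

text \<open>
  The decomposition is \<open>u = (u - v) + v\<close> with the smoothing \<open>v\<close> of \<open>u\<close> at scale \<open>2^(-k)\<close>. The bounds are
  stated separately for the two parts because the inhomogeneous case needs them individually.
\<close>

lemma good_decomposition:
  obtains C :: real where "0 < C"
    "\<And>u g k. \<lbrakk>u \<in> L0 M; g \<in> fractional_gradients \<mu> s u; lq_norm q (\<lambda>j. Lp_norm M p (g j)) < top\<rbrakk> \<Longrightarrow>
      \<exists>f0 f1. (f0, f1) \<in> decompositions M (Lp_space M p) (hom_Hajlasz_space \<mu> p) u \<and>
        ennreal (2 powr (real_of_int k * s)) * Lp f0 \<le> ennreal C * decay_sup (\<theta> / 2) (\<lambda>j. Lp_norm M p (g j)) k \<and>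
        ennreal (2 powr (real_of_int k * s)) * (ennreal (2 powr (- real_of_int k)) * Hajlasz_seminorm \<mu> p f1)
          \<le> ennreal C * decay_sup (\<theta> / 2) (\<lambda>j. Lp_norm M p (g j)) k"
proof -
  obtain C1 :: real where C1: "0 < C1" "\<And>t u H E. \<lbrakk>0 < t; \<mu> E = 0; H \<in> borel_measurable M; Lp_norm M p H < top;
       \<And>x y. x \<notin> E \<Longrightarrow> y \<notin> E \<Longrightarrow> ennreal \<bar>u x - u y\<bar> \<le> ennreal (1 + dist x y / t) * (H x + H y)\<rbrakk>
      \<Longrightarrow> \<exists>v h. continuous_on UNIV v \<and> h \<in> borel_measurable M \<and>
         Lp_norm M p h \<le> ennreal C1 * Lp_norm M p H \<and>
         (\<forall>x. x \<notin> E \<longrightarrow> ennreal \<bar>u x - v x\<bar> \<le> h x) \<and>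
         (\<forall>x y. x \<notin> E \<longrightarrow> y \<notin> E \<longrightarrow> ennreal \<bar>v x - v y\<bar> \<le> ennreal (dist x y / t) * (h x + h y))"
    using smoothing[OF p] by blast
  obtain C2 :: real where C2: "0 < C2"
    "\<And>(g :: int \<Rightarrow> 'a \<Rightarrow> ennreal) k. (\<And>j. g j \<in> borel_measurable M) \<Longrightarrow>
       Lp_norm M p (\<lambda>x. decay_sup \<theta> (\<lambda>j. g j x) k) \<le> ennreal C2 * decay_sup (\<theta> / 2) (\<lambda>j. Lp_norm M p (g j)) k"
    using Lp_norm_decay_sup[OF p theta(1), of M] by blast
  define C where "C = C1 * (2 * C2)"
  have "0 < C" using C1 C2 by (simp add: C_def)
  moreover have "\<exists>f0 f1. (f0, f1) \<in> decompositions M (Lp_space M p) (hom_Hajlasz_space \<mu> p) u \<and>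
        ennreal (2 powr (real_of_int k * s)) * Lp f0 \<le> ennreal C * decay_sup (\<theta> / 2) (\<lambda>j. Lp_norm M p (g j)) k \<and>
        ennreal (2 powr (real_of_int k * s)) * (ennreal (2 powr (- real_of_int k)) * Hajlasz_seminorm \<mu> p f1)
          \<le> ennreal C * decay_sup (\<theta> / 2) (\<lambda>j. Lp_norm M p (g j)) k"
    if u: "u \<in> L0 M" and g: "g \<in> fractional_gradients \<mu> s u" and fin: "lq_norm q (\<lambda>j. Lp_norm M p (g j)) < top"
    for u g k
  proof -
    define t where "t = 2 powr (- real_of_int k)"
    define T where "T = decay_sup (\<theta> / 2) (\<lambda>j. Lp_norm M p (g j)) k"
    have t: "0 < t" by (simp add: t_def)
    have "T \<le> lq_norm q (\<lambda>j. Lp_norm M p (g j))"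
      unfolding T_def using theta q by (intro decay_sup_le_lq_norm) auto
    then have Tfin: "T < top" using fin by (rule order_le_less_trans)
    have gm [measurable]: "g j \<in> borel_measurable M" for j using g by (simp add: fractional_gradients_def)
    obtain E0 where E0: "\<mu> E0 = 0" "\<And>j x y. x \<notin> E0 \<Longrightarrow> y \<notin> E0 \<Longrightarrow> 2 powi (-j - 1) \<le> dist x y \<Longrightarrow> dist x y < 2 powi (-j) \<Longrightarrow>
              e2ennreal \<bar>u x - u y\<bar> \<le> ennreal (dist x y powr s) * (g j x + g j y)"
      using g unfolding fractional_gradients_def by auto
    have um [measurable]: "u \<in> borel_measurable M" and uf: "AE x in M. \<bar>u x\<bar> \<noteq> \<infinity>" using u by (auto simp: L0_def)
    obtain E where E: "\<mu> E = 0" "E0 \<subseteq> E" "\<And>x. x \<notin> E \<Longrightarrow> \<bar>u x\<bar> \<noteq> \<infinity>"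
      using AE_null_superset[OF uf E0(1)] by blast
    define u' where "u' x = real_of_ereal (u x)" for x
    have u': "u x = ereal (u' x)" if "x \<notin> E" for x
      using E(3)[OF that] by (simp add: u'_def ereal_real')
    define H where "H = (\<lambda>x. ennreal (2 * 2 powr (- real_of_int k * s)) * decay_sup \<theta> (\<lambda>j. g j x) k)"
    have Hm: "H \<in> borel_measurable M" unfolding H_def by measurable
    have HL: "Lp_norm M p H \<le> ennreal (2 * 2 powr (- real_of_int k * s)) * (ennreal C2 * T)"
    proof -
      have "Lp_norm M p H = ennreal (2 * 2 powr (- real_of_int k * s)) * Lp_norm M p (\<lambda>x. decay_sup \<theta> (\<lambda>j. g j x) k)"
        unfolding H_def by (intro Lp_norm_cmult p) measurable
      also have "\<dots> \<le> ennreal (2 * 2 powr (- real_of_int k * s)) * (ennreal C2 * T)"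
        unfolding T_def by (intro mult_left_mono C2 gm) auto
      finally show ?thesis .
    qed
    also have "\<dots> < top" using Tfin by (simp add: ennreal_mult_less_top)
    finally have Hfin: "Lp_norm M p H < top" .
    have "ennreal \<bar>u' x - u' y\<bar> \<le> ennreal (1 + dist x y / t) * (H x + H y)" if "x \<notin> E" "y \<notin> E" for x y
      unfolding t_def H_def
    proof (rule fractional_gradient_dyadic_bound[OF _ that])
      fix j :: int and x y assume "x \<notin> E" "y \<notin> E" "2 powi (-j - 1) \<le> dist x y" "dist x y < 2 powi (-j)"
      show "ennreal \<bar>u' x - u' y\<bar> \<le> ennreal (dist x y powr s) * (g j x + g j y)"
      proof -
        have "x \<notin> E0" "y \<notin> E0" using \<open>x \<notin> E\<close> \<open>y \<notin> E\<close> E(2) by auto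
        from E0(2)[OF this \<open>2 powi (-j - 1) \<le> dist x y\<close> \<open>dist x y < 2 powi (-j)\<close>]
        show ?thesis using u'[OF \<open>x \<notin> E\<close>] u'[OF \<open>y \<notin> E\<close>] by simp
      qed
    qed
    from C1(2)[OF t E(1) Hm Hfin this]
    obtain v h where v: "continuous_on UNIV v" and hm [measurable]: "h \<in> borel_measurable M"
      and hL: "Lp_norm M p h \<le> ennreal C1 * Lp_norm M p H"
      and uv: "\<And>x. x \<notin> E \<Longrightarrow> ennreal \<bar>u' x - v x\<bar> \<le> h x"
      and vv: "\<And>x y. x \<notin> E \<Longrightarrow> y \<notin> E \<Longrightarrow> ennreal \<bar>v x - v y\<bar> \<le> ennreal (dist x y / t) * (h x + h y)"
      by blast
    have "v \<in> borel_measurable borel" using v by (rule borel_measurable_continuous_onI)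
    then have vm [measurable]: "v \<in> borel_measurable M" by (rule borel_measurable_M)
    define f0 where "f0 x = u x - ereal (v x)" for x
    define f1 where "f1 x = ereal (v x)" for x
    have notE: "AE x in M. x \<notin> E" using E(1) null_sets_M AE_not_in by blast
    have f0L: "Lp f0 \<le> Lp_norm M p h"
    proof (rule Lp_norm_mono_AE[OF p])
      show "AE x in M. e2ennreal \<bar>f0 x\<bar> \<le> h x"
        using notE by eventually_elim (use uv u' in \<open>auto simp: f0_def\<close>)
    qed
    have f1L: "Hajlasz_seminorm \<mu> p f1 \<le> ennreal (1 / t) * Lp_norm M p h"
    proof -
      have "(\<lambda>x. ennreal (1 / t) * h x) \<in> one_gradients \<mu> f1"
        unfolding one_gradients_def mem_Collect_eq
      proof (intro conjI exI[of _ E] ballI)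
        fix x y assume "x \<in> - E" "y \<in> - E"
        then have "ennreal \<bar>v x - v y\<bar> \<le> ennreal (dist x y / t) * (h x + h y)" using vv by simp
        also have "\<dots> = ennreal (dist x y) * (ennreal (1 / t) * h x + ennreal (1 / t) * h y)"
          using t ennreal_mult[of "dist x y" "1 / t"] by (simp add: mult.assoc distrib_left)
        finally show "e2ennreal \<bar>f1 x - f1 y\<bar> \<le> ennreal (dist x y) * (ennreal (1 / t) * h x + ennreal (1 / t) * h y)"
          by (simp add: f1_def)
      qed (use E in auto)
      then have "Hajlasz_seminorm \<mu> p f1 \<le> Lp_norm M p (\<lambda>x. ennreal (1 / t) * h x)"
        unfolding Hajlasz_seminorm_def by (rule INF_lower)
      also have "\<dots> = ennreal (1 / t) * Lp_norm M p h" by (rule Lp_norm_cmult[OF p hm])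
      finally show ?thesis .
    qed
    have hT: "ennreal (2 powr (real_of_int k * s)) * Lp_norm M p h \<le> ennreal C * T"
    proof -
      have "ennreal (2 powr (real_of_int k * s)) * Lp_norm M p h
          \<le> ennreal (2 powr (real_of_int k * s)) * (ennreal C1 * (ennreal (2 * 2 powr (- real_of_int k * s)) * (ennreal C2 * T)))"
        by (intro mult_left_mono order_trans[OF hL] HL) auto
      also have "\<dots> = ennreal (2 powr (real_of_int k * s) * (C1 * (2 * 2 powr (- real_of_int k * s) * C2))) * T"
        using C1 C2 by (simp add: ennreal_mult mult.assoc)
      also have "2 powr (real_of_int k * s) * (C1 * (2 * 2 powr (- real_of_int k * s) * C2)) = C"
        by (simp add: C_def powr_minus field_simps)
      finally show ?thesis .
    qed
    have hfin: "Lp_norm M p h < top"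
      using hL Hfin by (auto simp: ennreal_mult_less_top elim!: order_le_less_trans)
    have f0: "f0 \<in> carrier_of (Lp_space M p)"
    proof -
      have "AE x in M. \<bar>f0 x\<bar> \<noteq> \<infinity>" using notE by eventually_elim (use u' in \<open>auto simp: f0_def\<close>)
      moreover have "f0 \<in> borel_measurable M" unfolding f0_def by measurable
      moreover have "Lp f0 < top" using f0L hfin by (rule order_le_less_trans)
      ultimately show ?thesis by (simp add: Lp_space_def L0_def)
    qed
    have f1: "f1 \<in> carrier_of (hom_Hajlasz_space \<mu> p)"
    proof -
      have "f1 \<in> borel_measurable M" unfolding f1_def by measurable
      moreover have "Hajlasz_seminorm \<mu> p f1 < top"
        using f1L hfin by (auto simp: ennreal_mult_less_top elim!: order_le_less_trans)
      ultimately show ?thesis by (simp add: hom_Hajlasz_space_def L0_def f1_def)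
    qed
    have "AE x in M. u x = f0 x + f1 x"
      using notE by eventually_elim (use u' in \<open>auto simp: f0_def f1_def\<close>)
    then have dec: "(f0, f1) \<in> decompositions M (Lp_space M p) (hom_Hajlasz_space \<mu> p) u"
      using f0 f1 by (simp add: decompositions_def)
    have 1: "ennreal (2 powr (real_of_int k * s)) * Lp f0 \<le> ennreal C * T"
      using hT by (rule order_trans[rotated]) (intro mult_left_mono f0L, simp)
    have "ennreal t * Hajlasz_seminorm \<mu> p f1 \<le> ennreal t * (ennreal (1 / t) * Lp_norm M p h)"
      by (intro mult_left_mono f1L) simp
    also have "\<dots> = Lp_norm M p h" using t by (simp add: mult.assoc[symmetric] ennreal_mult[symmetric])
    finally have 2: "ennreal (2 powr (real_of_int k * s)) * (ennreal t * Hajlasz_seminorm \<mu> p f1) \<le> ennreal C * T"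
      using hT by (elim order_trans[rotated]) (intro mult_left_mono, auto)
    show ?thesis using dec 1 2 unfolding T_def t_def by blast
  qed
  ultimately show thesis by (rule that)
qed

text \<open>
  The additive term \<open>Y\<close> is the \<open>L\<^sup>p\<close> norm in the inhomogeneous case; subtracting it reduces the claim
  to an infimum.
\<close>

lemma Besov_seminorm_boundI:
  assumes "0 < C"
    and "\<And>g. g \<in> fractional_gradients \<mu> s u \<Longrightarrow> lq_norm q (\<lambda>j. Lp_norm M p (g j)) < top \<Longrightarrow>
        X \<le> ennreal C * (lq_norm q (\<lambda>j. Lp_norm M p (g j)) + Y)"
  shows "X \<le> ennreal C * (Besov_seminorm \<mu> s p q u + Y)"
proof (cases "Y = top")
  case True
  then show ?thesis using assms(1) by (simp add: ennreal_mult_top)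
next
  case False
  have "X - ennreal C * Y \<le> ennreal C * Besov_seminorm \<mu> s p q u"
    unfolding Besov_seminorm_def
  proof (rule le_mult_INF[OF assms(1)])
    fix g assume g: "g \<in> fractional_gradients \<mu> s u"
    show "X - ennreal C * Y \<le> ennreal C * lq_norm q (\<lambda>j. Lp_norm M p (g j))"
    proof (cases "lq_norm q (\<lambda>j. Lp_norm M p (g j)) < top")
      case True
      have "ennreal C * Y \<noteq> top" using \<open>Y \<noteq> top\<close> by (simp add: ennreal_mult_eq_top_iff)
      with assms(2)[OF g True] show ?thesis
        by (simp add: ennreal_minus_le_iff distrib_left add.commute)
    next
      case False
      then show ?thesis using assms(1) by (simp add: not_less top_unique ennreal_mult_top)
    qed
  qed
  then have "X \<le> ennreal C * Y + ennreal C * Besov_seminorm \<mu> s p q u"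
    using False by (simp add: ennreal_minus_le_iff ennreal_mult_eq_top_iff)
  then show ?thesis by (simp add: distrib_left add.commute)
qed

lemma scale_norm_le_if_dyadic_le:
  obtains C :: real where "0 < C"
    "\<And>(f :: 'a \<Rightarrow> ereal) A1 a D. 0 < D \<Longrightarrow>
       (\<And>k. dyadic s (K_functional M (Lp_space M p) A1 f) k \<le> ennreal D * decay_sup (\<theta> / 2) a k) \<Longrightarrow>
       scale_norm s q (K_functional M (Lp_space M p) A1 f) \<le> ennreal (C * D) * lq_norm q a"
proof -
  have "0 < \<theta> / 2" using theta by simp
  then obtain C where C: "0 < C"
    "\<And>a. lq_norm q (decay_sup (\<theta> / 2) a) \<le> ennreal C * lq_norm q a"
    using lq_norm_decay_sup[OF q] by blast
  show thesis
  proof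
    show "0 < 2 powr s * C" using C by simp
    fix f :: "'a \<Rightarrow> ereal" and A1 a and D :: real
    assume D: "0 < D" and le: "\<And>k. dyadic s (K_functional M (Lp_space M p) A1 f) k \<le> ennreal D * decay_sup (\<theta> / 2) a k"
    have "scale_norm s q (K_functional M (Lp_space M p) A1 f)
        \<le> ennreal (2 powr s) * lq_norm q (dyadic s (K_functional M (Lp_space M p) A1 f))"
      by (intro scale_norm_le_dyadic q s K_functional_mono)
    also have "\<dots> \<le> ennreal (2 powr s) * lq_norm q (\<lambda>k. ennreal D * decay_sup (\<theta> / 2) a k)"
      by (intro mult_left_mono lq_norm_mono q le) simp
    also have "\<dots> \<le> ennreal (2 powr s) * (ennreal D * (ennreal C * lq_norm q a))"
      unfolding lq_norm_cmult[OF q] by (intro mult_left_mono C) simp_all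
    also have "\<dots> = ennreal (2 powr s * C * D) * lq_norm q a"
      using C D by (simp add: ennreal_mult mult_ac)
    finally show "scale_norm s q (K_functional M (Lp_space M p) A1 f) \<le> ennreal (2 powr s * C * D) * lq_norm q a" .
  qed
qed

lemma interpolation_le_Besov_hom:
  obtains C :: real where "0 < C"
    "\<And>u. u \<in> L0 M \<Longrightarrow> Besov_seminorm \<mu> s p q u < top \<Longrightarrow>
       u \<in> sum_carrier M (Lp_space M p) (hom_Hajlasz_space \<mu> p) \<and>
       scale_norm s q (K_hom u) \<le> ennreal C * Besov_seminorm \<mu> s p q u"
proof -
  obtain C1 :: real where C1: "0 < C1"
    "\<And>u g k. \<lbrakk>u \<in> L0 M; g \<in> fractional_gradients \<mu> s u; lq_norm q (\<lambda>j. Lp_norm M p (g j)) < top\<rbrakk> \<Longrightarrow>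
      \<exists>f0 f1. (f0, f1) \<in> decompositions M (Lp_space M p) (hom_Hajlasz_space \<mu> p) u \<and>
        ennreal (2 powr (real_of_int k * s)) * Lp f0 \<le> ennreal C1 * decay_sup (\<theta> / 2) (\<lambda>j. Lp_norm M p (g j)) k \<and>
        ennreal (2 powr (real_of_int k * s)) * (ennreal (2 powr (- real_of_int k)) * Hajlasz_seminorm \<mu> p f1)
          \<le> ennreal C1 * decay_sup (\<theta> / 2) (\<lambda>j. Lp_norm M p (g j)) k"
    using good_decomposition by blast
  obtain C2 :: real where C2: "0 < C2"
    "\<And>(f :: 'a \<Rightarrow> ereal) A1 a D. 0 < D \<Longrightarrow>
       (\<And>k. dyadic s (K_functional M (Lp_space M p) A1 f) k \<le> ennreal D * decay_sup (\<theta> / 2) a k) \<Longrightarrow>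
       scale_norm s q (K_functional M (Lp_space M p) A1 f) \<le> ennreal (C2 * D) * lq_norm q a"
    using scale_norm_le_if_dyadic_le by blast
  show thesis
  proof
    show "0 < C2 * (2 * C1)" using C1 C2 by simp
    fix u :: "'a \<Rightarrow> ereal" assume u: "u \<in> L0 M" and fin: "Besov_seminorm \<mu> s p q u < top"
    have "u \<in> sum_carrier M (Lp_space M p) (hom_Hajlasz_space \<mu> p)"
    proof -
      obtain g where "g \<in> fractional_gradients \<mu> s u" "lq_norm q (\<lambda>j. Lp_norm M p (g j)) < top"
        using fin unfolding Besov_seminorm_def INF_less_iff by blast
      from C1(2)[OF u this, of 0] u show ?thesis by (auto simp: sum_carrier_def)
    qed
    moreover have "scale_norm s q (K_hom u) \<le> ennreal (C2 * (2 * C1)) * (Besov_seminorm \<mu> s p q u + 0)"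
    proof (rule Besov_seminorm_boundI)
      fix g assume g: "g \<in> fractional_gradients \<mu> s u" "lq_norm q (\<lambda>j. Lp_norm M p (g j)) < top"
      define a where "a = (\<lambda>j. Lp_norm M p (g j))"
      have "dyadic s (K_hom u) k \<le> ennreal (2 * C1) * decay_sup (\<theta> / 2) a k" for k
      proof -
        from C1(2)[OF u g, of k, folded a_def] obtain f0 f1
          where f: "(f0, f1) \<in> decompositions M (Lp_space M p) (hom_Hajlasz_space \<mu> p) u"
            "ennreal (2 powr (real_of_int k * s)) * Lp f0 \<le> ennreal C1 * decay_sup (\<theta> / 2) a k"
            "ennreal (2 powr (real_of_int k * s)) * (ennreal (2 powr (- real_of_int k)) * Hajlasz_seminorm \<mu> p f1)
              \<le> ennreal C1 * decay_sup (\<theta> / 2) a k"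
          by blast
        have "dyadic s (K_hom u) k \<le> ennreal (2 powr (real_of_int k * s)) *
            (Lp f0 + ennreal (2 powr (- real_of_int k)) * Hajlasz_seminorm \<mu> p f1)"
          unfolding dyadic_def using K_functional_le[OF f(1)]
          by (intro mult_left_mono) (auto simp: Lp_space_def hom_Hajlasz_space_def)
        also have "\<dots> \<le> ennreal C1 * decay_sup (\<theta> / 2) a k + ennreal C1 * decay_sup (\<theta> / 2) a k"
          unfolding distrib_left by (intro add_mono f)
        also have "\<dots> = ennreal (2 * C1) * decay_sup (\<theta> / 2) a k"
        proof -
          have "ennreal (2 * C1) = ennreal C1 + ennreal C1" using C1 by (simp only: mult_2 ennreal_plus less_imp_le)
          then show ?thesis by (simp only: distrib_right)
        qed
        finally show ?thesis .
      qed
      from C2(2)[OF _ this] C1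
      show "scale_norm s q (K_hom u) \<le> ennreal (C2 * (2 * C1)) * (lq_norm q (\<lambda>j. Lp_norm M p (g j)) + 0)"
        by (simp add: a_def)
    qed (use C1 C2 in simp)
    ultimately show "u \<in> sum_carrier M (Lp_space M p) (hom_Hajlasz_space \<mu> p) \<and>
       scale_norm s q (K_hom u) \<le> ennreal (C2 * (2 * C1)) * Besov_seminorm \<mu> s p q u" by simp
  qed
qed

lemma Lp_triangle_AE:
  assumes "f0 \<in> borel_measurable M" "f1 \<in> borel_measurable M"
    and "AE x in M. e2ennreal \<bar>f x\<bar> \<le> e2ennreal \<bar>f0 x\<bar> + e2ennreal \<bar>f1 x\<bar>"
  shows "Lp f \<le> ennreal (quasi_const p) * (Lp f0 + Lp f1)"
proof -
  have [measurable]: "f0 \<in> borel_measurable M" "f1 \<in> borel_measurable M" by fact+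
  have "Lp f \<le> Lp_norm M p (\<lambda>x. e2ennreal \<bar>f0 x\<bar> + e2ennreal \<bar>f1 x\<bar>)"
    by (rule Lp_norm_mono_AE[OF p assms(3)])
  also have "\<dots> \<le> ennreal (quasi_const p) * (Lp f0 + Lp f1)"
    by (rule Lp_norm_add[OF p]) measurable
  finally show ?thesis .
qed

lemma L0_real:
  assumes "u \<in> L0 M" shows "AE x in M. u x = ereal (real_of_ereal (u x))"
proof -
  have "AE x in M. \<bar>u x\<bar> \<noteq> \<infinity>" using assms by (simp add: L0_def)
  then show ?thesis by eventually_elim (simp add: ereal_real')
qed

text \<open>
  At scales \<open>2^(-k) \<le> 1\<close> the homogeneous decomposition is used, with \<open>\<parallel>f\<^sub>1\<parallel>\<^sub>p\<close> bounded by
  \<open>\<parallel>u\<parallel>\<^sub>p + \<parallel>f\<^sub>0\<parallel>\<^sub>p\<close>; at larger scales the decomposition \<open>u = u + 0\<close> is. In both cases \<open>\<parallel>u\<parallel>\<^sub>p\<close> contributes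
  a term that decays geometrically in \<open>\<bar>k\<bar>\<close>, as if it were added to the sequence of gradient
  norms at index 0.
\<close>

lemma interpolation_le_Besov_inhom:
  obtains C :: real where "0 < C"
    "\<And>u. u \<in> carrier_of (Lp_space M p) \<Longrightarrow> Besov_seminorm \<mu> s p q u < top \<Longrightarrow>
       u \<in> sum_carrier M (Lp_space M p) (Hajlasz_space \<mu> p) \<and>
       scale_norm s q (K_inhom u) \<le> ennreal C * (Besov_seminorm \<mu> s p q u + Lp u)"
proof -
  obtain C1 :: real where C1: "0 < C1"
    "\<And>u g k. \<lbrakk>u \<in> L0 M; g \<in> fractional_gradients \<mu> s u; lq_norm q (\<lambda>j. Lp_norm M p (g j)) < top\<rbrakk> \<Longrightarrow>
      \<exists>f0 f1. (f0, f1) \<in> decompositions M (Lp_space M p) (hom_Hajlasz_space \<mu> p) u \<and>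
        ennreal (2 powr (real_of_int k * s)) * Lp f0 \<le> ennreal C1 * decay_sup (\<theta> / 2) (\<lambda>j. Lp_norm M p (g j)) k \<and>
        ennreal (2 powr (real_of_int k * s)) * (ennreal (2 powr (- real_of_int k)) * Hajlasz_seminorm \<mu> p f1)
          \<le> ennreal C1 * decay_sup (\<theta> / 2) (\<lambda>j. Lp_norm M p (g j)) k"
    using good_decomposition by blast
  obtain C2 :: real where C2: "0 < C2"
    "\<And>(f :: 'a \<Rightarrow> ereal) A1 a D. 0 < D \<Longrightarrow>
       (\<And>k. dyadic s (K_functional M (Lp_space M p) A1 f) k \<le> ennreal D * decay_sup (\<theta> / 2) a k) \<Longrightarrow>
       scale_norm s q (K_functional M (Lp_space M p) A1 f) \<le> ennreal (C2 * D) * lq_norm q a"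
    using scale_norm_le_if_dyadic_le by blast
  define Q where "Q = quasi_const p"
  have Q: "0 < Q" by (simp add: Q_def)
  define D where "D = 2 * C1 + Q * C1 + Q + 1"
  have D: "0 < D" using C1 Q by (auto simp: D_def intro!: add_pos_pos)
  define Q' where "Q' = quasi_const (enn2real q)"
  show thesis
  proof
    show "0 < C2 * D * Q'" using C2 D by (simp add: Q'_def)
    fix u :: "'a \<Rightarrow> ereal" assume uLp: "u \<in> carrier_of (Lp_space M p)" and fin: "Besov_seminorm \<mu> s p q u < top"
    then have u: "u \<in> L0 M" and uL: "Lp u < top" by (auto simp: Lp_space_def)
    have um: "u \<in> borel_measurable M" using u by (simp add: L0_def)
    define F where "F = Lp u"
    have zero: "(\<lambda>_. 0) \<in> carrier_of (Hajlasz_space \<mu> p)" "norm_of (Hajlasz_space \<mu> p) (\<lambda>_. 0) = 0"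
    proof -
      have e0: "e2ennreal 0 = 0" using e2ennreal_ereal[of 0] by (simp add: zero_ereal_def)
      have "\<mu> {} = 0" using emeasure_M[of "{}"] by simp
      then have "(\<lambda>_. 0) \<in> one_gradients \<mu> (\<lambda>_. 0)"
        by (auto simp: one_gradients_def e0 intro!: exI[of _ "{}"])
      then have "Hajlasz_seminorm \<mu> p (\<lambda>_. 0) \<le> Lp_norm M p (\<lambda>_. 0)"
        unfolding Hajlasz_seminorm_def by (rule INF_lower)
      then have "Hajlasz_seminorm \<mu> p (\<lambda>_. 0) = 0" by (simp add: Lp_norm_def)
      then show "(\<lambda>_. 0) \<in> carrier_of (Hajlasz_space \<mu> p)" "norm_of (Hajlasz_space \<mu> p) (\<lambda>_. 0) = 0"
        by (auto simp: Hajlasz_space_def inter_space_def Lp_space_def hom_Hajlasz_space_def L0_def Lp_norm_def e0)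
    qed
    have triv: "(u, \<lambda>_. 0) \<in> decompositions M (Lp_space M p) (Hajlasz_space \<mu> p) u"
      using uLp zero by (simp add: decompositions_def)
    then have "u \<in> sum_carrier M (Lp_space M p) (Hajlasz_space \<mu> p)"
      using u by (auto simp: sum_carrier_def)
    moreover have "scale_norm s q (K_inhom u) \<le> ennreal (C2 * D * Q') * (Besov_seminorm \<mu> s p q u + F)"
    proof (rule Besov_seminorm_boundI)
      fix g assume g: "g \<in> fractional_gradients \<mu> s u" "lq_norm q (\<lambda>j. Lp_norm M p (g j)) < top"
      define a where "a = (\<lambda>j. Lp_norm M p (g j))"
      \<comment> \<open>The sequence that absorbs the \<open>L\<^sup>p\<close> norm of \<open>u\<close> at index 0.\<close>
      define a' where "a' j = a j + F * indicator {0} j" for j :: int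
      have aa: "decay_sup (\<theta> / 2) a k \<le> decay_sup (\<theta> / 2) a' k" for k
        by (rule decay_sup_mono) (simp add: a'_def)
      have Fa: "decay (\<theta> / 2) k * F \<le> decay_sup (\<theta> / 2) a' k" for k
        using decay_le_decay_sup[of "\<theta> / 2" k 0 a'] mult_left_mono[of F "a' 0" "decay (\<theta> / 2) k"]
        by (auto simp: a'_def intro: order_trans)
      have "dyadic s (K_inhom u) k \<le> ennreal D * decay_sup (\<theta> / 2) a' k" for k
      proof (cases "0 \<le> k")
        case True
        from C1(2)[OF u g, of k, folded a_def] obtain f0 f1
          where f: "(f0, f1) \<in> decompositions M (Lp_space M p) (hom_Hajlasz_space \<mu> p) u"
            "ennreal (2 powr (real_of_int k * s)) * Lp f0 \<le> ennreal C1 * decay_sup (\<theta> / 2) a k"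
            "ennreal (2 powr (real_of_int k * s)) * (ennreal (2 powr (- real_of_int k)) * Hajlasz_seminorm \<mu> p f1)
              \<le> ennreal C1 * decay_sup (\<theta> / 2) a k"
          by blast
        have f0: "f0 \<in> L0 M" "Lp f0 < top" and f1: "f1 \<in> L0 M" "Hajlasz_seminorm \<mu> p f1 < top"
          and ae: "AE x in M. u x = f0 x + f1 x"
          using f(1) by (auto simp: decompositions_def Lp_space_def hom_Hajlasz_space_def)
        have f1L: "Lp f1 \<le> ennreal Q * (F + Lp f0)"
          unfolding F_def Q_def
        proof (rule Lp_triangle_AE[OF um])
          show "f0 \<in> borel_measurable M" using f0 by (simp add: L0_def)
          show "AE x in M. e2ennreal \<bar>f1 x\<bar> \<le> e2ennreal \<bar>u x\<bar> + e2ennreal \<bar>f0 x\<bar>"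
            using ae L0_real[OF f0(1)] L0_real[OF f1(1)]
          proof eventually_elim
            case (elim x)
            define y z where "y = real_of_ereal (f0 x)" and "z = real_of_ereal (f1 x)"
            have a: "f0 x = ereal y" unfolding y_def by (rule elim(2))
            have b: "f1 x = ereal z" unfolding z_def by (rule elim(3))
            have "u x = ereal (y + z)" by (simp only: elim(1) a b plus_ereal.simps)
            with a b show ?case by (simp add: ennreal_plus[symmetric] ennreal_leI del: ennreal_plus)
          qed
        qed
        then have "Lp f1 < top" using f0(2) uL by (auto simp: F_def ennreal_mult_less_top elim!: order_le_less_trans)
        then have dec: "(f0, f1) \<in> decompositions M (Lp_space M p) (Hajlasz_space \<mu> p) u"
          using f(1) f1(1) by (auto simp: decompositions_def Hajlasz_space_def inter_space_def Lp_space_def)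
        define c e where "c = 2 powr (real_of_int k * s)" and "e = 2 powr (- real_of_int k)"
        have e1: "e \<le> 1" using True powr_mono[of "- real_of_int k" 0 2] by (simp add: e_def)
        define X where "X = decay_sup (\<theta> / 2) a' k"
        have B0: "ennreal c * Lp f0 \<le> ennreal C1 * X"
          unfolding c_def X_def by (rule order_trans[OF f(2)]) (intro mult_left_mono aa, simp)
        have B1: "ennreal c * (ennreal e * Hajlasz_seminorm \<mu> p f1) \<le> ennreal C1 * X"
          unfolding c_def e_def X_def by (rule order_trans[OF f(3)]) (intro mult_left_mono aa, simp)
        have B2: "ennreal c * (ennreal e * F) \<le> X"
        proof -
          have "ennreal c * (ennreal e * F) = ennreal (c * e) * F"
            by (simp add: c_def e_def ennreal_mult mult.assoc)
          also have "c * e \<le> 2 powr (- (\<theta> / 2) * \<bar>real_of_int k\<bar>)"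
          proof -
            have "(\<theta> / 2) * real_of_int k \<le> (1 - s) * real_of_int k"
              using True theta by (intro mult_right_mono) auto
            then show ?thesis
              unfolding c_def e_def powr_add[symmetric] using True
              by (intro powr_mono) (auto simp: algebra_simps)
          qed
          then have "ennreal (c * e) * F \<le> decay (\<theta> / 2) k * F"
            unfolding decay_def by (intro mult_right_mono ennreal_leI) auto
          also have "\<dots> \<le> X" unfolding X_def by (rule Fa)
          finally show ?thesis .
        qed
        have B3: "ennreal c * (ennreal e * Lp f0) \<le> ennreal C1 * X"
        proof (rule order_trans[OF _ B0], rule mult_left_mono)
          show "ennreal e * Lp f0 \<le> Lp f0"
            using mult_right_mono[of "ennreal e" 1 "Lp f0"] e1 by simp
        qed simp
        have "dyadic s (K_inhom u) k \<le> ennreal c * (Lp f0 + ennreal e * (Lp f1 + Hajlasz_seminorm \<mu> p f1))"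
          unfolding dyadic_def c_def e_def using K_functional_le[OF dec]
          by (intro mult_left_mono) (auto simp: Lp_space_def Hajlasz_space_def inter_space_def hom_Hajlasz_space_def)
        also have "\<dots> \<le> ennreal c * (Lp f0 + ennreal e * (ennreal Q * (F + Lp f0) + Hajlasz_seminorm \<mu> p f1))"
          by (intro mult_left_mono add_left_mono add_right_mono f1L) auto
        also have "\<dots> = ennreal c * Lp f0 + ennreal Q * (ennreal c * (ennreal e * F))
            + ennreal Q * (ennreal c * (ennreal e * Lp f0)) + ennreal c * (ennreal e * Hajlasz_seminorm \<mu> p f1)"
          by (simp only: distrib_left mult_ac add_ac)
        also have "\<dots> \<le> ennreal C1 * X + ennreal Q * X + ennreal Q * (ennreal C1 * X) + ennreal C1 * X"
          by (intro add_mono B0 B1 mult_left_mono B2 B3) auto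
        also have "\<dots> = ennreal (C1 + Q + Q * C1 + C1) * X"
        proof -
          have "ennreal (C1 + Q + Q * C1 + C1) = ennreal C1 + ennreal Q + ennreal Q * ennreal C1 + ennreal C1"
            using C1 Q by (simp only: ennreal_plus ennreal_mult less_imp_le add_nonneg_nonneg mult_nonneg_nonneg)
          then show ?thesis by (simp only: distrib_right mult.assoc)
        qed
        also have "\<dots> \<le> ennreal D * X"
          by (intro mult_right_mono ennreal_leI) (auto simp: D_def)
        finally show ?thesis unfolding X_def .
      next
        case False
        have "dyadic s (K_inhom u) k \<le> ennreal (2 powr (real_of_int k * s)) * F"
          unfolding dyadic_def using K_functional_le[OF triv] zero(2)
          by (intro mult_left_mono) (auto simp: F_def Lp_space_def)
        also have "\<dots> \<le> decay (\<theta> / 2) k * F"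
          unfolding decay_def
        proof (intro mult_right_mono ennreal_leI powr_mono)
          have "real_of_int k * s \<le> real_of_int k * (\<theta> / 2)"
            using False theta by (intro mult_left_mono_neg) auto
          then show "real_of_int k * s \<le> - (\<theta> / 2) * \<bar>real_of_int k\<bar>"
            using False by (simp add: mult.commute)
        qed auto
        also have "\<dots> \<le> 1 * decay_sup (\<theta> / 2) a' k" using Fa by simp
        also have "\<dots> \<le> ennreal D * decay_sup (\<theta> / 2) a' k"
          using C1 Q by (intro mult_right_mono) (auto simp: D_def intro!: add_nonneg_nonneg)
        finally show ?thesis .
      qed
      from C2(2)[OF D this]
      have "scale_norm s q (K_inhom u) \<le> ennreal (C2 * D) * lq_norm q a'" .
      also have "lq_norm q a' \<le> ennreal Q' * (lq_norm q a + F)"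
      proof -
        have "lq_norm q a' \<le> ennreal Q' * (lq_norm q a + lq_norm q (\<lambda>j. F * indicator {0} j))"
          unfolding a'_def Q'_def by (rule lq_norm_add[OF q])
        then show ?thesis by (simp add: lq_norm_cmult[OF q] lq_norm_indicator[OF q])
      qed
      finally have "scale_norm s q (K_inhom u) \<le> ennreal (C2 * D) * (ennreal Q' * (lq_norm q a + F))"
        by (simp add: mult_left_mono)
      show "scale_norm s q (K_inhom u) \<le> ennreal (C2 * D * Q') * (lq_norm q (\<lambda>j. Lp_norm M p (g j)) + F)"
      proof -
        have "0 \<le> C2 * D" "0 \<le> Q'" using C2 D less_imp_le[OF quasi_const_pos] by (simp_all add: Q'_def)
        then have "ennreal (C2 * D * Q') = ennreal (C2 * D) * ennreal Q'" by (rule ennreal_mult)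
        with \<open>scale_norm s q (K_inhom u) \<le> ennreal (C2 * D) * (ennreal Q' * (lq_norm q a + F))\<close>
        show ?thesis by (simp only: mult.assoc a_def)
      qed
    qed (use C2 D in \<open>simp add: Q'_def\<close>)
    ultimately show "u \<in> sum_carrier M (Lp_space M p) (Hajlasz_space \<mu> p) \<and>
       scale_norm s q (K_inhom u) \<le> ennreal (C2 * D * Q') * (Besov_seminorm \<mu> s p q u + Lp u)"
      by (simp add: F_def)
  qed
qed

section \<open>Interpolation functions lie in the Besov space\<close>

lemma K_functional_lessD:
  assumes "0 < t" "K_hom u t < \<kappa>"
  obtains f0 f1 h where "(f0, f1) \<in> decompositions M (Lp_space M p) (hom_Hajlasz_space \<mu> p) u"
    "h \<in> one_gradients \<mu> f1" "Lp f0 \<le> \<kappa>" "ennreal t * Lp_norm M p h \<le> \<kappa>"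
proof -
  obtain f0 f1 where f: "(f0, f1) \<in> decompositions M (Lp_space M p) (hom_Hajlasz_space \<mu> p) u"
    and less: "Lp f0 + ennreal t * Hajlasz_seminorm \<mu> p f1 < \<kappa>"
    using assms(2) unfolding K_functional_def INF_less_iff by (auto simp: Lp_space_def hom_Hajlasz_space_def)
  have inv: "ennreal (1 / t) * (ennreal t * z) = z" "ennreal t * (ennreal (1 / t) * z) = z" for z
    using assms(1) by (simp_all add: mult.assoc[symmetric] ennreal_mult[symmetric])
  have "ennreal t * Hajlasz_seminorm \<mu> p f1 < \<kappa>"
    by (rule order_le_less_trans[OF _ less]) simp
  then have "Hajlasz_seminorm \<mu> p f1 < ennreal (1 / t) * \<kappa>"
    using assms(1) ennreal_mult_strict_left_mono[of "ennreal t * Hajlasz_seminorm \<mu> p f1" \<kappa> "ennreal (1 / t)"]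
    by (simp add: inv)
  then obtain h where h: "h \<in> one_gradients \<mu> f1" "Lp_norm M p h < ennreal (1 / t) * \<kappa>"
    unfolding Hajlasz_seminorm_def INF_less_iff by blast
  from mult_left_mono[OF less_imp_le[OF h(2)], of "ennreal t"] have "ennreal t * Lp_norm M p h \<le> \<kappa>"
    by (simp add: inv)
  moreover have "Lp f0 \<le> \<kappa>"
    by (rule less_imp_le[OF order_le_less_trans[OF _ less]]) simp
  ultimately show thesis using that f h(1) by blast
qed

text \<open>
  On pairs at distance about \<open>2^(-k)\<close> the decomposition at the scale \<open>2^(-k)\<close> supplies the \<open>k\<close>-th function
  of a fractional gradient.
\<close>

lemma Besov_le_near_optimal:
  assumes u: "u \<in> L0 M" and less: "\<And>k. K_hom u (2 powr (- real_of_int k)) < \<kappa> k"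
  shows "Besov_seminorm \<mu> s p q u
     \<le> ennreal (2 powr s * (2 * quasi_const p)) * lq_norm q (\<lambda>k. ennreal (2 powr (real_of_int k * s)) * \<kappa> k)"
proof -
  have "\<exists>f0 f1 h. (f0, f1) \<in> decompositions M (Lp_space M p) (hom_Hajlasz_space \<mu> p) u \<and>
    h \<in> one_gradients \<mu> f1 \<and> Lp f0 \<le> \<kappa> k \<and> ennreal (2 powr (- real_of_int k)) * Lp_norm M p h \<le> \<kappa> k" for k
    by (rule K_functional_lessD[OF _ less[of k]]) (auto)
  then obtain f0 f1 h where dec: "\<And>k. (f0 k, f1 k) \<in> decompositions M (Lp_space M p) (hom_Hajlasz_space \<mu> p) u"
    and h: "\<And>k. h k \<in> one_gradients \<mu> (f1 k)" and f0L: "\<And>k. Lp (f0 k) \<le> \<kappa> k"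
    and hL: "\<And>k. ennreal (2 powr (- real_of_int k)) * Lp_norm M p (h k) \<le> \<kappa> k"
    by metis
  have f0: "f0 k \<in> L0 M" and f1: "f1 k \<in> L0 M" and ae: "AE x in M. u x = f0 k x + f1 k x" for k
    using dec[of k] by (auto simp: decompositions_def Lp_space_def hom_Hajlasz_space_def)
  have f0m [measurable]: "f0 k \<in> borel_measurable M" for k using f0 by (simp add: L0_def)
  have hm [measurable]: "h k \<in> borel_measurable M" for k using h[of k] by (simp add: one_gradients_def)
  have "\<exists>E0. \<mu> E0 = 0 \<and> (\<forall>x\<in>-E0. \<forall>y\<in>-E0. e2ennreal \<bar>f1 k x - f1 k y\<bar> \<le> ennreal (dist x y) * (h k x + h k y))" for k
    using h[of k] by (simp add: one_gradients_def)
  then obtain E0 where E0: "\<And>k. \<mu> (E0 k) = 0"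
    "\<And>k x y. x \<notin> E0 k \<Longrightarrow> y \<notin> E0 k \<Longrightarrow> e2ennreal \<bar>f1 k x - f1 k y\<bar> \<le> ennreal (dist x y) * (h k x + h k y)"
    by (metis ComplI)
  have "AE x in M. \<forall>k. x \<notin> E0 k \<and> u x = f0 k x + f1 k x \<and>
      f0 k x = ereal (real_of_ereal (f0 k x)) \<and> f1 k x = ereal (real_of_ereal (f1 k x))"
    unfolding AE_all_countable
    using ae L0_real[OF f0] L0_real[OF f1] AE_not_in[OF null_sets_M[OF E0(1)]] by (auto intro!: AE_conjI)
  then obtain E where E: "\<mu> E = 0"
    "\<And>x k. x \<notin> E \<Longrightarrow> x \<notin> E0 k \<and> u x = f0 k x + f1 k x \<and>
      f0 k x = ereal (real_of_ereal (f0 k x)) \<and> f1 k x = ereal (real_of_ereal (f1 k x))"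
    unfolding AE_M_iff by blast
  define g where "g k = (\<lambda>x. ennreal (2 powr s) * (ennreal (2 powr (real_of_int k * s)) *
      (e2ennreal \<bar>f0 k x\<bar> + ennreal (2 powr (- real_of_int k)) * h k x)))" for k
  have gm: "g k \<in> borel_measurable M" for k unfolding g_def by measurable
  have grad: "e2ennreal \<bar>u x - u y\<bar> \<le> ennreal (dist x y powr s) * (g k x + g k y)"
    if xy: "x \<notin> E" "y \<notin> E" "2 powi (- k - 1) \<le> dist x y" "dist x y < 2 powi (- k)" for k x y
  proof -
    define d where "d = dist x y"
    have d: "2 powr (- real_of_int k - 1) \<le> d" "d < 2 powr (- real_of_int k)"
      using xy(3,4) by (auto simp: d_def powi_eq_powr)
    then have d0: "0 < d" using powr_gt_zero[of 2 "- real_of_int k - 1"] by linarith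
    define c where "c = 2 powr s * 2 powr (real_of_int k * s)"
    have c: "1 \<le> d powr s * c"
    proof -
      have "1 = (2 powr (- real_of_int k - 1)) powr s * c"
        by (simp add: c_def powr_powr powr_add[symmetric] algebra_simps)
      also have "\<dots> \<le> d powr s * c"
        using d s by (intro mult_right_mono powr_mono2) (auto simp: c_def)
      finally show ?thesis .
    qed
    define X0 Y0 where "X0 = e2ennreal \<bar>f0 k x\<bar>" and "Y0 = e2ennreal \<bar>f0 k y\<bar>"
    define X1 Y1 where "X1 = ennreal (2 powr (- real_of_int k)) * h k x" and "Y1 = ennreal (2 powr (- real_of_int k)) * h k y"
    obtain a0 a1 b0 b1 where ab: "f0 k x = ereal a0" "f1 k x = ereal a1" "f0 k y = ereal b0" "f1 k y = ereal b1"
      using E(2)[OF xy(1), of k] E(2)[OF xy(2), of k] by metis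
    have "u x = ereal (a0 + a1)" "u y = ereal (b0 + b1)"
      using E(2)[OF xy(1), of k] E(2)[OF xy(2), of k] ab by auto
    then have "e2ennreal \<bar>u x - u y\<bar> = ennreal \<bar>a0 + a1 - (b0 + b1)\<bar>" by simp
    also have "\<dots> \<le> ennreal (\<bar>a0\<bar> + \<bar>b0\<bar> + \<bar>a1 - b1\<bar>)" by (intro ennreal_leI) linarith
    also have "\<dots> = X0 + Y0 + e2ennreal \<bar>f1 k x - f1 k y\<bar>"
      by (simp add: X0_def Y0_def ab)
    also have "\<dots> \<le> X0 + Y0 + ennreal d * (h k x + h k y)"
      unfolding d_def using E(2)[OF xy(1), of k] E(2)[OF xy(2), of k] by (intro add_left_mono E0(2)) auto
    also have "\<dots> \<le> X0 + Y0 + ennreal (2 powr (- real_of_int k)) * (h k x + h k y)"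
      using d by (intro add_left_mono mult_right_mono ennreal_leI) auto
    also have "\<dots> = 1 * ((X0 + X1) + (Y0 + Y1))" by (simp add: X1_def Y1_def distrib_left add_ac)
    also have "\<dots> \<le> ennreal (d powr s * c) * ((X0 + X1) + (Y0 + Y1))"
      using c by (intro mult_right_mono) auto
    also have "\<dots> = ennreal (d powr s) * (g k x + g k y)"
      by (simp add: g_def c_def X0_def X1_def Y0_def Y1_def ennreal_mult mult.assoc distrib_left)
    finally show ?thesis unfolding d_def .
  qed
  have "g \<in> fractional_gradients \<mu> s u"
    unfolding fractional_gradients_def using gm grad E(1) by blast
  then have "Besov_seminorm \<mu> s p q u \<le> lq_norm q (\<lambda>k. Lp_norm M p (g k))"
    unfolding Besov_seminorm_def by (rule INF_lower)
  also have "\<dots> \<le> lq_norm q (\<lambda>k. ennreal (2 powr s * (2 * quasi_const p)) * (ennreal (2 powr (real_of_int k * s)) * \<kappa> k))"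
  proof (rule lq_norm_mono[OF q])
    fix k
    define c where "c = ennreal (2 powr (real_of_int k * s))"
    have "Lp_norm M p (g k) = ennreal (2 powr s) * (c * Lp_norm M p (\<lambda>x. e2ennreal \<bar>f0 k x\<bar> + ennreal (2 powr (- real_of_int k)) * h k x))"
      unfolding g_def c_def by (simp add: Lp_norm_cmult[OF p])
    also have "\<dots> \<le> ennreal (2 powr s) * (c * (ennreal (quasi_const p) * (Lp (f0 k) + Lp_norm M p (\<lambda>x. ennreal (2 powr (- real_of_int k)) * h k x))))"
      by (intro mult_left_mono Lp_norm_add[OF p]) auto
    also have "Lp_norm M p (\<lambda>x. ennreal (2 powr (- real_of_int k)) * h k x) = ennreal (2 powr (- real_of_int k)) * Lp_norm M p (h k)"
      by (rule Lp_norm_cmult[OF p hm])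
    also have "ennreal (2 powr s) * (c * (ennreal (quasi_const p) * (Lp (f0 k) + ennreal (2 powr (- real_of_int k)) * Lp_norm M p (h k))))
        \<le> ennreal (2 powr s) * (c * (ennreal (quasi_const p) * (\<kappa> k + \<kappa> k)))"
      by (intro mult_left_mono add_mono f0L hL) auto
    also have "\<dots> = ennreal (2 powr s * (2 * quasi_const p)) * (c * \<kappa> k)"
      using quasi_const_pos[of p] by (simp add: ennreal_mult mult_ac mult_2[symmetric] del: quasi_const_pos)
    finally show "Lp_norm M p (g k) \<le> ennreal (2 powr s * (2 * quasi_const p)) * (ennreal (2 powr (real_of_int k * s)) * \<kappa> k)"
      unfolding c_def .
  qed
  also have "\<dots> = ennreal (2 powr s * (2 * quasi_const p)) * lq_norm q (\<lambda>k. ennreal (2 powr (real_of_int k * s)) * \<kappa> k)"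
    by (rule lq_norm_cmult[OF q])
  finally show ?thesis .
qed

text \<open>
  Since the \<open>K\<close>-functional may vanish, near optimality is measured by adding \<open>\<epsilon> * 2^(-k s - \<bar>k\<bar>)\<close>: this is
  positive at every scale, and after multiplication by \<open>2^(k s)\<close> its \<open>\<ell>\<^sup>q\<close> norm tends to 0 with \<open>\<epsilon>\<close>.
\<close>

lemma Besov_le_interpolation_hom:
  obtains C :: real where "0 < C"
    "\<And>u. u \<in> L0 M \<Longrightarrow> scale_norm s q (K_hom u) < top \<Longrightarrow>
       Besov_seminorm \<mu> s p q u \<le> ennreal C * scale_norm s q (K_hom u)"
proof -
  define B where "B = 2 powr s * (2 * quasi_const p)"
  define Q where "Q = quasi_const (enn2real q)"
  define R where "R = 2 powr (s + 1 / enn2real q)"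
  have pos: "0 < B" "0 < Q" "0 < R" by (auto simp: B_def Q_def R_def)
  show thesis
  proof
    show "0 < B * Q * R" using pos by simp
    fix u :: "'a \<Rightarrow> ereal" assume u: "u \<in> L0 M" and fin: "scale_norm s q (K_hom u) < top"
    define S where "S = lq_norm q (dyadic s (K_hom u))"
    define Z where "Z = lq_norm q (decay 1)"
    have SR: "S \<le> ennreal R * scale_norm s q (K_hom u)"
      unfolding S_def R_def by (intro dyadic_le_scale_norm q s K_functional_mono)
    also have "\<dots> < top" using fin by (simp add: ennreal_mult_less_top)
    finally have Sfin: "S < top" .
    have Z: "Z < top" unfolding Z_def by (intro lq_norm_decay_less_top q) simp
    have "Besov_seminorm \<mu> s p q u \<le> ennreal (B * Q) * S + ennreal (B * Q) * (Z * ennreal \<epsilon>)" if \<epsilon>: "0 < \<epsilon>" for \<epsilon> :: real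
    proof -
      define \<kappa> where "\<kappa> k = K_hom u (2 powr (- real_of_int k)) + ennreal (2 powr (- real_of_int k * s)) * (ennreal \<epsilon> * decay 1 k)" for k
      have Kfin: "K_hom u (2 powr (- real_of_int k)) < top" for k
      proof -
        have "dyadic s (K_hom u) k < top"
          using lq_norm_component[OF q, of "dyadic s (K_hom u)" k] Sfin unfolding S_def by (rule order_le_less_trans)
        then show ?thesis by (auto simp: dyadic_def ennreal_mult_less_top)
      qed
      have "K_hom u (2 powr (- real_of_int k)) < \<kappa> k" for k
      proof -
        have "0 < ennreal (2 powr (- real_of_int k * s)) * (ennreal \<epsilon> * decay 1 k)"
          using \<epsilon> by (simp add: decay_def ennreal_zero_less_mult_iff)
        then show ?thesis unfolding \<kappa>_def using Kfin[of k]
            ennreal_add_left_cancel_less[of "K_hom u (2 powr (- real_of_int k))" 0]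
          by simp
      qed
      from Besov_le_near_optimal[OF u this]
      have "Besov_seminorm \<mu> s p q u \<le> ennreal B * lq_norm q (\<lambda>k. ennreal (2 powr (real_of_int k * s)) * \<kappa> k)"
        by (simp add: B_def)
      also have "(\<lambda>k. ennreal (2 powr (real_of_int k * s)) * \<kappa> k) = (\<lambda>k. dyadic s (K_hom u) k + ennreal \<epsilon> * decay 1 k)"
      proof
        fix k
        have "ennreal (2 powr (real_of_int k * s)) * (ennreal (2 powr (- real_of_int k * s)) * z) = z" for z
          by (simp add: mult.assoc[symmetric] ennreal_mult[symmetric] powr_add[symmetric])
        then show "ennreal (2 powr (real_of_int k * s)) * \<kappa> k = dyadic s (K_hom u) k + ennreal \<epsilon> * decay 1 k"
          by (simp add: \<kappa>_def dyadic_def distrib_left)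
      qed
      also have "ennreal B * lq_norm q \<dots> \<le> ennreal B * (ennreal Q * (S + lq_norm q (\<lambda>k. ennreal \<epsilon> * decay 1 k)))"
        unfolding S_def Q_def by (intro mult_left_mono lq_norm_add q) simp
      also have "lq_norm q (\<lambda>k. ennreal \<epsilon> * decay 1 k) = Z * ennreal \<epsilon>"
        unfolding Z_def by (simp add: lq_norm_cmult[OF q] mult.commute)
      finally show ?thesis
        using pos by (simp add: ennreal_mult mult.assoc distrib_left)
    qed
    note le = this
    have "Besov_seminorm \<mu> s p q u \<le> ennreal (B * Q) * S"
    proof (rule ennreal_le_epsilon)
      fix e :: real assume "0 < e"
      define z where "z = enn2real Z"
      have z: "Z = ennreal z" "0 \<le> z" using Z by (auto simp: z_def)
      define \<epsilon> where "\<epsilon> = e / (B * Q * (z + 1))"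
      have "0 < \<epsilon>" using \<open>0 < e\<close> pos z by (auto simp: \<epsilon>_def intro!: divide_pos_pos mult_pos_pos)
      from le[OF this]
      have "Besov_seminorm \<mu> s p q u \<le> ennreal (B * Q) * S + ennreal (B * Q * (z * \<epsilon>))"
        using z pos \<open>0 < \<epsilon>\<close> by (simp add: ennreal_mult)
      also have "B * Q * (z * \<epsilon>) \<le> e"
      proof -
        have "B * Q * (z * \<epsilon>) = e * (z / (z + 1))" using pos z by (simp add: \<epsilon>_def)
        also have "\<dots> \<le> e" using \<open>0 < e\<close> z by (intro mult_left_le) auto
        finally show ?thesis .
      qed
      then have "ennreal (B * Q) * S + ennreal (B * Q * (z * \<epsilon>)) \<le> ennreal (B * Q) * S + ennreal e"
        by (intro add_left_mono ennreal_leI)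
      finally show "Besov_seminorm \<mu> s p q u \<le> ennreal (B * Q) * S + ennreal e" .
    qed
    also have "\<dots> \<le> ennreal (B * Q) * (ennreal R * scale_norm s q (K_hom u))"
      by (intro mult_left_mono SR) simp
    finally show "Besov_seminorm \<mu> s p q u \<le> ennreal (B * Q * R) * scale_norm s q (K_hom u)"
      using pos by (simp add: ennreal_mult mult.assoc)
  qed
qed

section \<open>The inhomogeneous spaces\<close>

lemma decompositions_inhom_subset:
  "decompositions M (Lp_space M p) (Hajlasz_space \<mu> p) u \<subseteq> decompositions M (Lp_space M p) (hom_Hajlasz_space \<mu> p) u"
  by (auto simp: decompositions_def Hajlasz_space_def inter_space_def)

lemma K_hom_le_K_inhom: "K_hom u t \<le> K_inhom u t"
  unfolding K_functional_def
proof (rule INF_mono)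
  fix f assume "f \<in> decompositions M (Lp_space M p) (Hajlasz_space \<mu> p) u"
  then show "\<exists>g\<in>decompositions M (Lp_space M p) (hom_Hajlasz_space \<mu> p) u.
      (case g of (f0, f1) \<Rightarrow> norm_of (Lp_space M p) f0 + ennreal t * norm_of (hom_Hajlasz_space \<mu> p) f1)
      \<le> (case f of (f0, f1) \<Rightarrow> norm_of (Lp_space M p) f0 + ennreal t * norm_of (Hajlasz_space \<mu> p) f1)"
    using decompositions_inhom_subset[of u]
    by (intro bexI[of _ f])
       (auto simp: Hajlasz_space_def inter_space_def hom_Hajlasz_space_def split: prod.split intro!: add_left_mono mult_left_mono)
qed

lemma Lp_le_K_inhom:
  shows "Lp u \<le> ennreal (quasi_const p) * K_inhom u 1"
  unfolding K_functional_def
proof (rule le_mult_INF)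
  fix f assume f: "f \<in> decompositions M (Lp_space M p) (Hajlasz_space \<mu> p) u"
  obtain f0 f1 where ff: "f = (f0, f1)" by (cases f)
  have f0: "f0 \<in> L0 M" and f1: "f1 \<in> L0 M" and ae: "AE x in M. u x = f0 x + f1 x"
    using f ff by (auto simp: decompositions_def Lp_space_def Hajlasz_space_def inter_space_def)
  have "Lp u \<le> ennreal (quasi_const p) * (Lp f0 + Lp f1)"
  proof (rule Lp_triangle_AE)
    show "f0 \<in> borel_measurable M" "f1 \<in> borel_measurable M" using f0 f1 by (auto simp: L0_def)
    show "AE x in M. e2ennreal \<bar>u x\<bar> \<le> e2ennreal \<bar>f0 x\<bar> + e2ennreal \<bar>f1 x\<bar>"
      using ae L0_real[OF f0] L0_real[OF f1]
    proof eventually_elim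
      case (elim x)
      define y z where "y = real_of_ereal (f0 x)" and "z = real_of_ereal (f1 x)"
      have a: "f0 x = ereal y" unfolding y_def by (rule elim(2))
      have b: "f1 x = ereal z" unfolding z_def by (rule elim(3))
      have "u x = ereal (y + z)" by (simp only: elim(1) a b plus_ereal.simps)
      with a b show ?case by (simp add: ennreal_plus[symmetric] ennreal_leI del: ennreal_plus)
    qed
  qed
  also have "\<dots> \<le> ennreal (quasi_const p) * (Lp f0 + ennreal 1 * norm_of (Hajlasz_space \<mu> p) f1)"
    by (intro mult_left_mono add_left_mono) (auto simp: Hajlasz_space_def inter_space_def Lp_space_def)
  finally show "Lp u \<le> ennreal (quasi_const p) *
      (case f of (f0, f1) \<Rightarrow> norm_of (Lp_space M p) f0 + ennreal 1 * norm_of (Hajlasz_space \<mu> p) f1)"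
    by (simp add: ff Lp_space_def)
qed simp

lemma Lp_le_interpolation_inhom:
  "Lp u \<le> ennreal (quasi_const p * 2 powr (s + 1 / enn2real q)) * scale_norm s q (K_inhom u)"
proof -
  have "K_inhom u 1 = dyadic s (K_inhom u) 0" by (simp add: dyadic_def)
  also have "\<dots> \<le> lq_norm q (dyadic s (K_inhom u))" by (rule lq_norm_component[OF q])
  also have "\<dots> \<le> ennreal (2 powr (s + 1 / enn2real q)) * scale_norm s q (K_inhom u)"
    by (intro dyadic_le_scale_norm q s K_functional_mono)
  finally have "ennreal (quasi_const p) * K_inhom u 1
      \<le> ennreal (quasi_const p) * (ennreal (2 powr (s + 1 / enn2real q)) * scale_norm s q (K_inhom u))"
    by (rule mult_left_mono) simp
  with Lp_le_K_inhom[of u] have "Lp u \<le> ennreal (quasi_const p) * (ennreal (2 powr (s + 1 / enn2real q)) * scale_norm s q (K_inhom u))"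
    by (rule order_trans)
  then show ?thesis using quasi_const_pos[of p] by (simp add: ennreal_mult mult.assoc del: quasi_const_pos)
qed

section \<open>Equality of the spaces\<close>

lemma hom_equivalence:
  "eq_with_equivalent_norms (hom_Besov_space \<mu> s p q)
     (interpolation_space M (Lp_space M p) (hom_Hajlasz_space \<mu> p) s q)"
proof -
  obtain C1 :: real where C1: "0 < C1"
    "\<And>u. u \<in> L0 M \<Longrightarrow> Besov_seminorm \<mu> s p q u < top \<Longrightarrow>
       u \<in> sum_carrier M (Lp_space M p) (hom_Hajlasz_space \<mu> p) \<and>
       scale_norm s q (K_hom u) \<le> ennreal C1 * Besov_seminorm \<mu> s p q u"
    using interpolation_le_Besov_hom by blast
  obtain C2 :: real where C2: "0 < C2"
    "\<And>u. u \<in> L0 M \<Longrightarrow> scale_norm s q (K_hom u) < top \<Longrightarrow>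
       Besov_seminorm \<mu> s p q u \<le> ennreal C2 * scale_norm s q (K_hom u)"
    using Besov_le_interpolation_hom by blast
  show ?thesis
  proof (rule eq_with_equivalent_normsI[OF C1(1) C2(1)])
    fix u assume "u \<in> carrier_of (hom_Besov_space \<mu> s p q)"
    then have u: "u \<in> L0 M" "Besov_seminorm \<mu> s p q u < top" by (auto simp: hom_Besov_space_def)
    note le = C1(2)[OF this]
    then have "scale_norm s q (K_hom u) < top"
      using u(2) by (auto simp: ennreal_mult_less_top elim!: order_le_less_trans)
    then show "u \<in> carrier_of (interpolation_space M (Lp_space M p) (hom_Hajlasz_space \<mu> p) s q) \<and>
        norm_of (interpolation_space M (Lp_space M p) (hom_Hajlasz_space \<mu> p) s q) u \<le> ennreal C1 * norm_of (hom_Besov_space \<mu> s p q) u"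
      using le by (simp add: interpolation_space_def hom_Besov_space_def interpolation_norm_eq)
  next
    fix u assume "u \<in> carrier_of (interpolation_space M (Lp_space M p) (hom_Hajlasz_space \<mu> p) s q)"
    then have u: "u \<in> L0 M" "scale_norm s q (K_hom u) < top"
      by (auto simp: interpolation_space_def interpolation_norm_eq sum_carrier_def)
    note le = C2(2)[OF this]
    then have "Besov_seminorm \<mu> s p q u < top"
      using u(2) by (auto simp: ennreal_mult_less_top elim!: order_le_less_trans)
    then show "u \<in> carrier_of (hom_Besov_space \<mu> s p q) \<and>
        norm_of (hom_Besov_space \<mu> s p q) u \<le> ennreal C2 * norm_of (interpolation_space M (Lp_space M p) (hom_Hajlasz_space \<mu> p) s q) u"
      using le u by (simp add: interpolation_space_def hom_Besov_space_def interpolation_norm_eq)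
  qed
qed

lemma inhom_equivalence:
  "eq_with_equivalent_norms (Besov_space \<mu> s p q)
     (interpolation_space M (Lp_space M p) (Hajlasz_space \<mu> p) s q)"
proof -
  obtain C1 :: real where C1: "0 < C1"
    "\<And>u. u \<in> carrier_of (Lp_space M p) \<Longrightarrow> Besov_seminorm \<mu> s p q u < top \<Longrightarrow>
       u \<in> sum_carrier M (Lp_space M p) (Hajlasz_space \<mu> p) \<and>
       scale_norm s q (K_inhom u) \<le> ennreal C1 * (Besov_seminorm \<mu> s p q u + Lp u)"
    using interpolation_le_Besov_inhom by blast
  obtain C2 :: real where C2: "0 < C2"
    "\<And>u. u \<in> L0 M \<Longrightarrow> scale_norm s q (K_hom u) < top \<Longrightarrow>
       Besov_seminorm \<mu> s p q u \<le> ennreal C2 * scale_norm s q (K_hom u)"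
    using Besov_le_interpolation_hom by blast
  define C3 where "C3 = quasi_const p * 2 powr (s + 1 / enn2real q)"
  have C3: "0 < C3" by (simp add: C3_def)
  then have "0 < C3 + C2" using C2 by simp
  show ?thesis
  proof (rule eq_with_equivalent_normsI[OF C1(1) \<open>0 < C3 + C2\<close>])
    fix u assume "u \<in> carrier_of (Besov_space \<mu> s p q)"
    then have u: "u \<in> carrier_of (Lp_space M p)" "Besov_seminorm \<mu> s p q u < top"
      by (auto simp: Besov_space_def inter_space_def hom_Besov_space_def)
    then have uL: "Lp u < top" by (simp add: Lp_space_def)
    note le = C1(2)[OF u]
    then have "scale_norm s q (K_inhom u) < top"
      using u(2) uL by (auto simp: ennreal_mult_less_top elim!: order_le_less_trans)
    then show "u \<in> carrier_of (interpolation_space M (Lp_space M p) (Hajlasz_space \<mu> p) s q) \<and>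
        norm_of (interpolation_space M (Lp_space M p) (Hajlasz_space \<mu> p) s q) u \<le> ennreal C1 * norm_of (Besov_space \<mu> s p q) u"
      using le by (simp add: interpolation_space_def Besov_space_def inter_space_def hom_Besov_space_def
          Lp_space_def interpolation_norm_eq add.commute)
  next
    fix u assume "u \<in> carrier_of (interpolation_space M (Lp_space M p) (Hajlasz_space \<mu> p) s q)"
    then have u: "u \<in> L0 M" "scale_norm s q (K_inhom u) < top"
      by (auto simp: interpolation_space_def interpolation_norm_eq sum_carrier_def)
    have hi: "scale_norm s q (K_hom u) \<le> scale_norm s q (K_inhom u)"
      by (intro scale_norm_mono q K_hom_le_K_inhom)
    then have "scale_norm s q (K_hom u) < top" using u(2) by (rule order_le_less_trans)
    from C2(2)[OF u(1) this] hi have B: "Besov_seminorm \<mu> s p q u \<le> ennreal C2 * scale_norm s q (K_inhom u)"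
      by (meson mult_left_mono order_trans zero_le)
    have L: "Lp u \<le> ennreal C3 * scale_norm s q (K_inhom u)"
      unfolding C3_def by (rule Lp_le_interpolation_inhom)
    have fin: "Besov_seminorm \<mu> s p q u < top" "Lp u < top"
      using u(2) B L by (auto simp: ennreal_mult_less_top elim!: order_le_less_trans)
    have "Lp u + Besov_seminorm \<mu> s p q u \<le> ennreal (C3 + C2) * scale_norm s q (K_inhom u)"
      using add_mono[OF L B] C2 C3 by (simp add: distrib_right)
    then show "u \<in> carrier_of (Besov_space \<mu> s p q) \<and>
        norm_of (Besov_space \<mu> s p q) u \<le> ennreal (C3 + C2) * norm_of (interpolation_space M (Lp_space M p) (Hajlasz_space \<mu> p) s q) u"
      using u fin by (simp add: interpolation_space_def Besov_space_def inter_space_def hom_Besov_space_def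
          Lp_space_def interpolation_norm_eq)
  qed
qed

end

theorem theorem4p1:
  fixes \<mu> :: "'a::metric_space set \<Rightarrow> ennreal"
    and p s :: real and q :: ennreal
  assumes "doubling_measure \<mu>"
    and "0 < p" and "0 < q" and "0 < s" and "s < 1"
  shows "eq_with_equivalent_norms
           (hom_Besov_space \<mu> s p q)
           (interpolation_space (induced_measure \<mu>)
              (Lp_space (induced_measure \<mu>) p) (hom_Hajlasz_space \<mu> p) s q)
       \<and> eq_with_equivalent_norms
           (Besov_space \<mu> s p q)
           (interpolation_space (induced_measure \<mu>)
              (Lp_space (induced_measure \<mu>) p) (Hajlasz_space \<mu> p) s q)"
proof -
  interpret interpolation_setting \<mu> p s q by unfold_locales fact+
  show ?thesis using hom_equivalence inhom_equivalence by blast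
qed

end
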